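(* Let $r=(r_1,\dots,r_n)$ be positive reals normalized so that $\sum_i r_i=2$, with $r_j\le 1$ for all $j$ and $r_1\pm r_2\pm\cdots\pm r_n\ne 0$ for every choice of signs. Let ${\cal U}_r=\{(u_1,\dots,u_n)\in(S^4)^n:\sum_i r_iu_i=0\}$ and ${\cal M}_r={\cal U}_r/SO(5)$. Identify $S^4$ with $\mathbb{H}\mathbb{P}^1$ as below, let $M_{st}\subseteq(\mathbb{H}\mathbb{P}^1)^n$ be the set of stable points and $Q_{st}=M_{st}/PSL(2,\mathbb{H})$ (diagonal action, quotient topology). Then ${\cal U}_r\subseteq M_{st}$, and the map $\xi:{\cal M}_r\to Q_{st}$ induced by this inclusion (using $SO(5)\subset PSL(2,\mathbb{H})$ as a maximal compact subgroup) is a real analytic isomorphism.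
   Context: $\mathbb{H}\mathbb{P}^1=(\mathbb{H}^2\setminus\{0\})/\mathbb{H}^*$ with $\mathbb{H}^*$ acting by right multiplication; $PSL(2,\mathbb{H})=SL(2,\mathbb{H})/\{\pm1\}$ ($SL(2,\mathbb{H})$ = quaternionic $2\times 2$ matrices of Dieudonné determinant $1$) acts by $\begin{pmatrix}a&b\\c&d\end{pmatrix}\cdot[q_1:q_2]=[aq_1+bq_2:cq_1+dq_2]$. Identifying $\mathbb{H}\mathbb{P}^1=\mathbb{H}\cup\{\infty\}$ via $[v:1]\leftrightarrow v$, one identifies $\mathbb{H}\cup\{\infty\}$ with $S^4\subset\mathbb{R}^5$ via $v\mapsto \big(\tfrac{2v}{1+|v|^2},\tfrac{1-|v|^2}{1+|v|^2}\big)$ (with $\mathbb{H}=\mathbb{R}^4$), $\infty\mapsto(0,0,0,0,-1)$; under this identification the maximal compact subgroup $Sp(2)/\{\pm1\}\cong SO(5)$ of $PSL(2,\mathbb{H})$ acts by the standard rotations of $S^4$. A point $p=(p_1,\dots,p_n)\in(\mathbb{H}\mathbb{P}^1)^n$ is stable (for the weights $r$) if $\sum_{i:\,p_i=q} r_i<1$ for every $q\in\mathbb{H}\mathbb{P}^1$. *)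

theory Defs
  imports "HOL-Analysis.Analysis"
begin

datatype quat = Quat (q0: real) (q1: real) (q2: real) (q3: real)

definition qzero :: quat where "qzero = Quat 0 0 0 0"
definition qone :: quat where "qone = Quat 1 0 0 0"

definition qadd :: "quat \<Rightarrow> quat \<Rightarrow> quat" where
  "qadd p q = Quat (q0 p + q0 q) (q1 p + q1 q) (q2 p + q2 q) (q3 p + q3 q)"

definition qsub :: "quat \<Rightarrow> quat \<Rightarrow> quat" where
  "qsub p q = Quat (q0 p - q0 q) (q1 p - q1 q) (q2 p - q2 q) (q3 p - q3 q)"

text \<open>Hamilton product (i^2 = j^2 = k^2 = ijk = -1).\<close>
definition qmul :: "quat \<Rightarrow> quat \<Rightarrow> quat" where
  "qmul p q = Quat
     (q0 p * q0 q - q1 p * q1 q - q2 p * q2 q - q3 p * q3 q)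
     (q0 p * q1 q + q1 p * q0 q + q2 p * q3 q - q3 p * q2 q)
     (q0 p * q2 q - q1 p * q3 q + q2 p * q0 q + q3 p * q1 q)
     (q0 p * q3 q + q1 p * q2 q - q2 p * q1 q + q3 p * q0 q)"

definition qnorm2 :: "quat \<Rightarrow> real" where
  "qnorm2 q = (q0 q)^2 + (q1 q)^2 + (q2 q)^2 + (q3 q)^2"

definition qnorm :: "quat \<Rightarrow> real" where
  "qnorm q = sqrt (qnorm2 q)"

definition qinv :: "quat \<Rightarrow> quat" where
  "qinv q = Quat (q0 q / qnorm2 q) (- q1 q / qnorm2 q) (- q2 q / qnorm2 q) (- q3 q / qnorm2 q)"

type_synonym hp1 = "(quat \<times> quat) set"

definition hp1_class :: "quat \<Rightarrow> quat \<Rightarrow> hp1" where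
  "hp1_class a b = {(qmul a l, qmul b l) | l. l \<noteq> qzero}"

definition HP1 :: "hp1 set" where
  "HP1 = {hp1_class a b | a b. (a, b) \<noteq> (qzero, qzero)}"

type_synonym qmat = "quat \<times> quat \<times> quat \<times> quat"

text \<open>Dieudonne determinant, with values in H^*/[H^*,H^*] \<union> {0} identified with
  [0,\<infinity>) via the quaternionic norm.\<close>
definition ddet :: "qmat \<Rightarrow> real" where
  "ddet M = (case M of (a, b, c, d) \<Rightarrow>
     if a \<noteq> qzero then qnorm a * qnorm (qsub d (qmul c (qmul (qinv a) b)))
     else qnorm c * qnorm b)"

definition SL2H :: "qmat set" where
  "SL2H = {M. ddet M = 1}"

definition mat_act :: "qmat \<Rightarrow> hp1 \<Rightarrow> hp1" where
  "mat_act M P = (case M of (a, b, c, d) \<Rightarrow>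
     {(qadd (qmul a x) (qmul b y), qadd (qmul c x) (qmul d y)) | x y. (x, y) \<in> P})"

definition south :: "real^5" where
  "south = vector [0, 0, 0, 0, -1]"

definition stereo :: "quat \<Rightarrow> real^5" where
  "stereo v = (let n = qnorm2 v in
     vector [2 * q0 v / (1 + n), 2 * q1 v / (1 + n), 2 * q2 v / (1 + n),
             2 * q3 v / (1 + n), (1 - n) / (1 + n)])"

definition hp1_to_S4 :: "hp1 \<Rightarrow> real^5" where
  "hp1_to_S4 P = (let (x, y) = (SOME p. p \<in> P) in
     if y = qzero then south else stereo (qmul x (qinv y)))"

definition S4_to_hp1 :: "real^5 \<Rightarrow> hp1" where
  "S4_to_hp1 s = (if s = south then hp1_class qone qzero
     else hp1_class (Quat (s$1 / (1 + s$5)) (s$2 / (1 + s$5)) (s$3 / (1 + s$5)) (s$4 / (1 + s$5))) qone)"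

definition SO5 :: "(real^5^5) set" where
  "SO5 = {R. orthogonal_matrix R \<and> det R = 1}"

definition U_r :: "('n::finite \<Rightarrow> real) \<Rightarrow> (real^5^'n) set" where
  "U_r r = {u. (\<forall>i. norm (u$i) = 1) \<and> (\<Sum>i\<in>UNIV. r i *\<^sub>R (u$i)) = 0}"

definition M_r :: "('n::finite \<Rightarrow> real) \<Rightarrow> (real^5^'n) set set" where
  "M_r r = {{(\<chi> i. R *v (u$i)) | R. R \<in> SO5} | u. u \<in> U_r r}"

definition stable :: "('n::finite \<Rightarrow> real) \<Rightarrow> ('n \<Rightarrow> hp1) \<Rightarrow> bool" where
  "stable r p \<longleftrightarrow> (\<forall>q\<in>HP1. (\<Sum>i | p i = q. r i) < 1)"

definition M_st :: "('n::finite \<Rightarrow> real) \<Rightarrow> ('n \<Rightarrow> hp1) set" where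
  "M_st r = {p. (\<forall>i. p i \<in> HP1) \<and> stable r p}"

text \<open>Q_st = M_st / PSL(2,H), as the set of orbits of the diagonal action
  (the orbits of PSL(2,H) = SL(2,H)/{\<plusminus>1} are those of SL(2,H)).\<close>
definition G_orbit :: "('n::finite \<Rightarrow> hp1) \<Rightarrow> ('n \<Rightarrow> hp1) set" where
  "G_orbit p = {(\<lambda>i. mat_act A (p i)) | A. A \<in> SL2H}"

definition Q_st :: "('n::finite \<Rightarrow> real) \<Rightarrow> ('n \<Rightarrow> hp1) set set" where
  "Q_st r = {G_orbit p | p. p \<in> M_st r}"

definition hp1n_emb :: "('n::finite \<Rightarrow> hp1) \<Rightarrow> real^5^'n" where
  "hp1n_emb p = (\<chi> i. hp1_to_S4 (p i))"

definition multi_indices :: "('e::euclidean_space \<Rightarrow> nat) set" where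
  "multi_indices = {\<alpha>. \<forall>b. b \<notin> Basis \<longrightarrow> \<alpha> b = 0}"

definition real_analytic_at :: "('e::euclidean_space \<Rightarrow> real) \<Rightarrow> 'e \<Rightarrow> bool" where
  "real_analytic_at g a \<longleftrightarrow> (\<exists>c e. e > 0 \<and> (\<forall>x\<in>ball a e.
      ((\<lambda>\<alpha>. c \<alpha> * (\<Prod>b\<in>Basis. ((x - a) \<bullet> b) ^ \<alpha> b)) has_sum g x) multi_indices))"

definition real_analytic_on_set :: "'e::euclidean_space set \<Rightarrow> ('e \<Rightarrow> real) \<Rightarrow> bool" where
  "real_analytic_on_set S f \<longleftrightarrow> (\<forall>a\<in>S. \<exists>U g. open U \<and> a \<in> U \<and>
      (\<forall>x\<in>U. real_analytic_at g x) \<and> (\<forall>x\<in>S \<inter> U. f x = g x))"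

text \<open>A quotient space is given by its set P of classes (orbits) of points of type 'x,
  together with an injective embedding emb of the points into a Euclidean space.
  Open sets: quotient topology from the subspace topology.
  Analytic functions on an open V: those whose pull-back to the union of V is real analytic.\<close>
definition quotient_open :: "'x set set \<Rightarrow> ('x \<Rightarrow> 'e::euclidean_space) \<Rightarrow> 'x set set \<Rightarrow> bool" where
  "quotient_open P emb V \<longleftrightarrow> V \<subseteq> P \<and> openin (top_of_set (emb ` \<Union>P)) (emb ` \<Union>V)"

definition quotient_analytic ::
  "'x set set \<Rightarrow> ('x \<Rightarrow> 'e::euclidean_space) \<Rightarrow> 'x set set \<Rightarrow> ('x set \<Rightarrow> real) \<Rightarrow> bool" where
  "quotient_analytic P emb V f \<longleftrightarrow>
     real_analytic_on_set (emb ` \<Union>V) (\<lambda>y. f (THE C. C \<in> V \<and> y \<in> emb ` C))"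

text \<open>Real analytic isomorphism: bijection which is a homeomorphism of the quotient
  topologies and identifies the sheaves of real analytic functions.\<close>
definition analytic_quotient_iso ::
  "'x set set \<Rightarrow> ('x \<Rightarrow> 'e::euclidean_space) \<Rightarrow> 'y set set \<Rightarrow> ('y \<Rightarrow> 'f::euclidean_space)
     \<Rightarrow> ('x set \<Rightarrow> 'y set) \<Rightarrow> bool" where
  "analytic_quotient_iso P embP Q embQ \<xi> \<longleftrightarrow>
     bij_betw \<xi> P Q \<and>
     (\<forall>V. V \<subseteq> P \<longrightarrow> (quotient_open P embP V \<longleftrightarrow> quotient_open Q embQ (\<xi> ` V))) \<and>
     (\<forall>V f. quotient_open P embP V \<longrightarrow>
        (quotient_analytic P embP V (f \<circ> \<xi>) \<longleftrightarrow> quotient_analytic Q embQ (\<xi> ` V) f))"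

end

theory Submission
  imports Defs "HOL-Library.Multiset"
begin

text \<open>
  Write points of the sphere as null vectors: to \<open>(x, y)\<close> in \<open>H\<^sup>2\<close> belongs the vector
  \<open>(2 x y*, |y|\<^sup>2 - |x|\<^sup>2)\<close> of length \<open>|x|\<^sup>2 + |y|\<^sup>2\<close>, on which matrices act linearly up to a multiplier
  that is affine on the sphere. Comparing multipliers shows that the matrices act on the sphere exactly
  by the maps \<open>R \<circ> T\<^sub>w\<close> with \<open>R\<close> a rotation and \<open>T\<^sub>w\<close>, \<open>|w| < 1\<close>, a conformal boost.

  For a stable configuration the function \<open>(1 - |w|\<^sup>2)\<^sup>2 / \<Prod> |p\<^sub>i - w|\<^bsup>2 r i\<^esup>\<close> of \<open>w\<close> vanishes at the
  boundary of the ball, and at an interior maximum \<open>\<Sum> r\<^sub>i T\<^sub>w p\<^sub>i = 0\<close>: every stable orbit meets the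
  polygon space. Boosts strictly decrease the component of \<open>\<Sum> r\<^sub>i u\<^sub>i\<close> along \<open>w\<close> unless all \<open>u\<^sub>i\<close> are
  parallel to \<open>w\<close>, which genericity forbids: the orbit meets it in a single rotation orbit.
  For the same reason the derivative of \<open>\<Sum> r\<^sub>i T\<^sub>w p\<^sub>i\<close> in \<open>w\<close> is invertible at \<open>w = 0\<close>, so the balancing
  boost depends analytically on \<open>p\<close>, and this local analytic retraction onto the polygon space carries
  open sets and analytic functions from one quotient to the other. The analytic implicit function
  argument is a contraction in an algebra of absolutely convergent power series.
\<close>

section \<open>The Banach algebra of absolutely convergent power series\<close>

text \<open>A configuration spanning at most three dimensions is fixed by the rotations of the
  orthogonal complement, so the quotients may be singular and charts are avoided. All comparisons
  take place upstairs: an SO(5)-invariant \<open>W\<close> in \<open>U_r r\<close> against its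
  saturation under rotations and boosts, and one invariant function on both sets. Restricting to
  \<open>W\<close> is immediate; extending from \<open>W\<close> needs the retraction, only locally
  and without equivariance, because the function is invariant.

  The noncommutative determinant enters only through its positivity, which is equivalent to a
  trivial kernel; real scalars act trivially and adjust its value to 1. Two boosts do not in general
  compose to a boost, but matrices do compose, so transitivity of the orbit relation follows from
  the decomposition of a product matrix, with no addition formula.

  The unknown in the contraction is a family of power series, not a function. Its limit is therefore
  analytic by construction, and evaluation, being a continuous algebra homomorphism, turns the
  identity between series into one between functions.\<close>

no_notation Infinite_Set_Sum.abs_summable_on (infix \<open>abs'_summable'_on\<close> 50)

lemma has_sum_times:
  fixes f :: "'a \<Rightarrow> 'c::{banach,real_normed_algebra}" and g :: "'b \<Rightarrow> 'c"
  assumes f: "f abs_summable_on UNIV" and g: "g abs_summable_on UNIV"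
  shows abs_summable_times: "(\<lambda>(x, y). f x * g y) abs_summable_on UNIV"
    and "((\<lambda>(x, y). f x * g y) has_sum (infsum f UNIV * infsum g UNIV)) UNIV"
proof -
  have "(\<lambda>(x, y). norm (f x) * norm (g y)) abs_summable_on (UNIV \<times> UNIV)"
    by (rule iffD2[OF Infinite_Sum.abs_summable_on_Sigma_iff])
      (use summable_on_cmult_right[OF g] summable_on_cmult_left[OF f] in
        \<open>auto simp: abs_mult infsum_cmult_right' infsum_nonneg\<close>)
  then have "(\<lambda>(x, y). norm (f x) * norm (g y)) abs_summable_on UNIV" by simp
  then show *: "(\<lambda>(x, y). f x * g y) abs_summable_on UNIV"
    by (rule Infinite_Sum.abs_summable_on_comparison_test) (auto simp: norm_mult_ineq)
  have "((\<lambda>(x, y). f x * g y) has_sum (infsum f UNIV * infsum g UNIV)) (UNIV \<times> UNIV)"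
  proof (rule has_sum_SigmaI)
    show "((\<lambda>y. case (x, y) of (x, y) \<Rightarrow> f x * g y) has_sum f x * infsum g UNIV) UNIV" for x
      using has_sum_cmult_right[OF has_sum_infsum[OF Infinite_Sum.abs_summable_summable[OF g]]] by simp
    show "((\<lambda>x. f x * infsum g UNIV) has_sum infsum f UNIV * infsum g UNIV) UNIV"
      using has_sum_cmult_left[OF has_sum_infsum[OF Infinite_Sum.abs_summable_summable[OF f]]] by simp
    show "(\<lambda>(x, y). f x * g y) summable_on UNIV \<times> UNIV"
      using Infinite_Sum.abs_summable_summable[OF *] by simp
  qed
  then show "((\<lambda>(x, y). f x * g y) has_sum (infsum f UNIV * infsum g UNIV)) UNIV" by simp
qed

text \<open>The antidiagonal over \<open>M\<close> in the monoid of multisets. It is finite, so the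
  coefficients of a product of series are finite sums.\<close>

definition msplit :: "'a multiset \<Rightarrow> ('a multiset \<times> 'a multiset) set" where
  "msplit M = {(N, K). N + K = M}"

lemma finite_msplit [simp]: "finite (msplit M)"
proof -
  have "{N. N \<subseteq># M} \<subseteq> mset ` {xs. set xs \<subseteq> set_mset M \<and> length xs \<le> size M}"
  proof
    fix N assume N: "N \<in> {N. N \<subseteq># M}"
    obtain xs where "mset xs = N" using ex_mset by blast
    with N show "N \<in> mset ` {xs. set xs \<subseteq> set_mset M \<and> length xs \<le> size M}"
      by (auto intro!: image_eqI[of _ _ xs] dest: mset_subset_eqD size_mset_mono)
  qed
  then have "finite {N. N \<subseteq># M}"
    by (rule finite_subset) (intro finite_imageI finite_lists_length_le finite_set_mset)
  then have "finite ({N. N \<subseteq># M} \<times> {N. N \<subseteq># M})" by simp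
  then show ?thesis by (rule rev_finite_subset) (auto simp: msplit_def)
qed

text \<open>The double sum is regrouped along the fibres of addition of multisets: the Cauchy
  product formula in many variables at once.\<close>

lemma has_sum_convolution:
  fixes f g :: "'a multiset \<Rightarrow> 'c::{banach,real_normed_algebra}"
  assumes f: "f abs_summable_on UNIV" and g: "g abs_summable_on UNIV"
  shows "((\<lambda>M. \<Sum>(N, K)\<in>msplit M. f N * g K) has_sum (infsum f UNIV * infsum g UNIV)) UNIV"
proof (rule has_sum_SigmaD[where f = "\<lambda>(M, N, K). f N * g K"])
  show "((\<lambda>(M, N, K). f N * g K) has_sum infsum f UNIV * infsum g UNIV) (Sigma UNIV msplit)"
    using has_sum_times(2)[OF f g]
    by (subst has_sum_reindex_bij_witness[where j = "\<lambda>(M, N, K). (N, K)" and T = UNIV and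
          i = "\<lambda>(N, K). (N + K, N, K)" and h = "\<lambda>(N, K). f N * g K"])
      (auto simp: msplit_def)
qed (auto intro!: has_sum_finiteI simp: case_prod_unfold)

text \<open>Monomials are multisets of variables; the series converge on the closed unit polydisc.\<close>

typedef 'a pws = "{c :: 'a multiset \<Rightarrow> real. c abs_summable_on UNIV}"
  morphisms coeff Pws
  by (rule exI[of _ "\<lambda>_. 0"]) simp

setup_lifting type_definition_pws

lemma pws_eqI: "(\<And>M. coeff c M = coeff d M) \<Longrightarrow> c = d"
  by (metis coeff_inject ext)

lemma abs_summable_coeff: "coeff c abs_summable_on UNIV"
  using coeff by blast

instantiation pws :: (type) real_vector
begin

lift_definition zero_pws :: "'a pws" is "\<lambda>_. 0" by simp
lift_definition plus_pws :: "'a pws \<Rightarrow> 'a pws \<Rightarrow> 'a pws" is "\<lambda>c d M. c M + d M"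
  by (erule (1) Infinite_Sum.abs_summable_on_comparison_test'[OF summable_on_add]) (simp add: abs_triangle_ineq)
lift_definition uminus_pws :: "'a pws \<Rightarrow> 'a pws" is "\<lambda>c M. - c M" by simp
definition minus_pws :: "'a pws \<Rightarrow> 'a pws \<Rightarrow> 'a pws" where "minus_pws c d = c + - d"
lift_definition scaleR_pws :: "real \<Rightarrow> 'a pws \<Rightarrow> 'a pws" is "\<lambda>t c M. t * c M"
  by (simp add: abs_mult summable_on_cmult_right)

instance
proof
  fix a b c :: "'a pws" and s t :: real
  show "a - b = a + - b" by (simp add: minus_pws_def)
  show "a + b + c = a + (b + c)" by transfer (simp add: add.assoc)
  show "a + b = b + a" by transfer (simp add: add.commute)
  show "0 + a = a" by transfer simp
  show "- a + a = 0" by transfer simp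
  show "s *\<^sub>R (a + b) = s *\<^sub>R a + s *\<^sub>R b" by transfer (simp add: algebra_simps)
  show "(s + t) *\<^sub>R a = s *\<^sub>R a + t *\<^sub>R a" by transfer (simp add: algebra_simps)
  show "s *\<^sub>R t *\<^sub>R a = (s * t) *\<^sub>R a" by transfer (simp add: algebra_simps)
  show "1 *\<^sub>R a = a" by transfer simp
qed

end

instantiation pws :: (type) real_normed_vector
begin

definition norm_pws :: "'a pws \<Rightarrow> real" where "norm_pws c = (\<Sum>\<^sub>\<infinity>M. \<bar>coeff c M\<bar>)"
definition dist_pws :: "'a pws \<Rightarrow> 'a pws \<Rightarrow> real" where "dist_pws c d = norm (c - d)"
definition sgn_pws :: "'a pws \<Rightarrow> 'a pws" where "sgn_pws c = scaleR (inverse (norm c)) c"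
definition uniformity_pws :: "('a pws \<times> 'a pws) filter" where
  "uniformity_pws = (INF e\<in>{0 <..}. principal {(x, y). dist x y < e})"
definition open_pws :: "'a pws set \<Rightarrow> bool" where
  "open_pws U \<longleftrightarrow> (\<forall>x\<in>U. eventually (\<lambda>(x', y). x' = x \<longrightarrow> y \<in> U) uniformity)"

instance
proof
  fix a b :: "'a pws" and s :: real
  show "sgn a = a /\<^sub>R norm a" by (rule sgn_pws_def)
  show "dist a b = norm (a - b)" by (rule dist_pws_def)
  show "(uniformity :: ('a pws \<times> 'a pws) filter) = (INF e\<in>{0 <..}. principal {(x, y). dist x y < e})"
    by (rule uniformity_pws_def)
  show "open U \<longleftrightarrow> (\<forall>x\<in>U. eventually (\<lambda>(x', y). x' = x \<longrightarrow> y \<in> U) uniformity)" for U :: "'a pws set"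
    by (rule open_pws_def)
  show "norm a = 0 \<longleftrightarrow> a = 0"
  proof
    assume "norm a = 0"
    then have "\<bar>coeff a M\<bar> = 0" for M
      using nonneg_infsum_le_0D[of "\<lambda>M. \<bar>coeff a M\<bar>" UNIV M] abs_summable_coeff[of a]
      by (simp add: norm_pws_def)
    then show "a = 0" by (intro pws_eqI) (simp add: zero_pws.rep_eq)
  qed (simp add: norm_pws_def zero_pws.rep_eq)
  have "norm (a + b) = (\<Sum>\<^sub>\<infinity>M. \<bar>coeff a M + coeff b M\<bar>)"
    by (simp add: norm_pws_def plus_pws.rep_eq)
  also have "\<dots> \<le> (\<Sum>\<^sub>\<infinity>M. \<bar>coeff a M\<bar> + \<bar>coeff b M\<bar>)"
    using abs_summable_coeff[of "a + b"] abs_summable_coeff[of a] abs_summable_coeff[of b]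
    by (intro infsum_mono summable_on_add) (auto simp: plus_pws.rep_eq)
  also have "\<dots> = norm a + norm b"
    using abs_summable_coeff[of a] abs_summable_coeff[of b]
    by (simp add: norm_pws_def infsum_add)
  finally show "norm (a + b) \<le> norm a + norm b" .
  show "norm (s *\<^sub>R a) = \<bar>s\<bar> * norm a"
    by (simp add: norm_pws_def scaleR_pws.rep_eq abs_mult infsum_cmult_right')
qed

end


lemma coeff_simps [simp]:
  "coeff 0 M = 0" "coeff (c + d) M = coeff c M + coeff d M" "coeff (- c) M = - coeff c M"
  "coeff (c - d) M = coeff c M - coeff d M" "coeff (t *\<^sub>R c) M = t * coeff c M"
  unfolding minus_pws_def zero_pws.rep_eq plus_pws.rep_eq uminus_pws.rep_eq scaleR_pws.rep_eq by simp_all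

lemma abs_coeff_le_norm: "\<bar>coeff c M\<bar> \<le> norm c"
  using finite_sum_le_infsum[of "\<lambda>M. \<bar>coeff c M\<bar>" UNIV "{M}"] abs_summable_coeff[of c]
  by (simp add: norm_pws_def)

lift_definition pmonom :: "'a multiset \<Rightarrow> 'a pws" is "\<lambda>N M. if M = N then 1 else 0"
  by (rule has_sum_imp_summable[OF has_sum_finite_neutralI[of "{_}"]]) auto

lemma norm_pmonom [simp]: "norm (pmonom N) = 1"
  unfolding norm_pws_def pmonom.rep_eq
  by (rule infsumI, rule has_sum_finite_neutralI[of "{N}"]) auto

instantiation pws :: (type) "{real_normed_algebra_1, comm_ring_1}"
begin

lift_definition times_pws :: "'a pws \<Rightarrow> 'a pws \<Rightarrow> 'a pws" is "\<lambda>c d M. \<Sum>(N, K)\<in>msplit M. c N * d K"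
proof -
  fix c d :: "'a multiset \<Rightarrow> real"
  assume c: "c abs_summable_on UNIV" and d: "d abs_summable_on UNIV"
  show "(\<lambda>M. \<Sum>(N, K)\<in>msplit M. c N * d K) abs_summable_on UNIV"
    by (rule Infinite_Sum.abs_summable_on_comparison_test'[OF
          has_sum_imp_summable[OF has_sum_convolution[of "\<lambda>M. \<bar>c M\<bar>" "\<lambda>M. \<bar>d M\<bar>"]]])
      (use c d in \<open>auto simp: case_prod_unfold abs_mult intro: order.trans[OF sum_abs]\<close>)
qed

definition one_pws :: "'a pws" where "one_pws = pmonom {#}"

instance
proof
  fix a b c :: "'a pws" and s :: real
  show "a * b * c = a * (b * c)"
  proof (rule pws_eqI)
    fix M
    \<comment> \<open>Both bracketings sum over the ordered triples of multisets with sum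
      \<open>M\<close>; reindexing only moves the intermediate partial sum.\<close>
    have "coeff (a * b * c) M =
        (\<Sum>((N, K), A, B)\<in>(SIGMA NK:msplit M. msplit (fst NK)). coeff a A * coeff b B * coeff c K)"
      by (simp add: times_pws.rep_eq sum_distrib_right case_prod_unfold sum.Sigma)
    also have "\<dots> = (\<Sum>((A, L), B, K)\<in>(SIGMA AL:msplit M. msplit (snd AL)). coeff a A * coeff b B * coeff c K)"
      by (rule sum.reindex_bij_witness[of _ "\<lambda>((A, L), B, K). ((A + B, K), A, B)"
            "\<lambda>((N, K), A, B). ((A, B + K), B, K)"]) (auto simp: msplit_def add.assoc)
    also have "\<dots> = coeff (a * (b * c)) M"
      by (simp add: times_pws.rep_eq sum_distrib_left case_prod_unfold sum.Sigma mult.assoc)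
    finally show "coeff (a * b * c) M = coeff (a * (b * c)) M" .
  qed
  show comm: "a * b = b * a" for a b :: "'a pws"
    by (rule pws_eqI, unfold times_pws.rep_eq,
        rule sum.reindex_bij_witness[of _ "\<lambda>(N, K). (K, N)" "\<lambda>(N, K). (K, N)"])
      (auto simp: msplit_def add.commute mult.commute)
  show "1 * a = a"
  proof (rule pws_eqI)
    fix M
    have "coeff (1 * a) M = (\<Sum>(N, K)\<in>{({#} :: 'a multiset, M)}. coeff a K)"
      unfolding times_pws.rep_eq one_pws_def pmonom.rep_eq
      by (rule sum.mono_neutral_cong_right[OF finite_msplit]) (auto simp: msplit_def split: if_splits)
    then show "coeff (1 * a) M = coeff a M" by simp
  qed
  show "a * 1 = a" using \<open>1 * a = a\<close> comm[of a 1] by simp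
  show distrib: "(a + b) * c = a * c + b * c" for a b c :: "'a pws"
    by (rule pws_eqI) (simp add: times_pws.rep_eq sum.distrib[symmetric] case_prod_unfold algebra_simps)
  show "a * (b + c) = a * b + a * c" using distrib[of b c a] by (simp add: comm)
  show "s *\<^sub>R a * b = s *\<^sub>R (a * b)" "a * s *\<^sub>R b = s *\<^sub>R (a * b)"
    by (rule pws_eqI, simp add: times_pws.rep_eq sum_distrib_left case_prod_unfold algebra_simps)+
  show "(0::'a pws) \<noteq> 1"
    by (metis coeff_simps(1) one_pws_def pmonom.rep_eq zero_neq_one)
  show "norm (1::'a pws) = 1" by (simp add: one_pws_def)
  have *: "((\<lambda>M. \<Sum>(N, K)\<in>msplit M. \<bar>coeff a N\<bar> * \<bar>coeff b K\<bar>) has_sum norm a * norm b) UNIV"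
    using has_sum_convolution[of "\<lambda>M. \<bar>coeff a M\<bar>" "\<lambda>M. \<bar>coeff b M\<bar>"]
      abs_summable_coeff[of a] abs_summable_coeff[of b] by (simp add: norm_pws_def)
  have "norm (a * b) \<le> (\<Sum>\<^sub>\<infinity>M. \<Sum>(N, K)\<in>msplit M. \<bar>coeff a N\<bar> * \<bar>coeff b K\<bar>)"
    unfolding norm_pws_def
  proof (rule infsum_mono)
    show "(\<lambda>M. \<bar>coeff (a * b) M\<bar>) summable_on UNIV" using abs_summable_coeff[of "a * b"] by simp
    show "\<bar>coeff (a * b) M\<bar> \<le> (\<Sum>(N, K)\<in>msplit M. \<bar>coeff a N\<bar> * \<bar>coeff b K\<bar>)" for M
      unfolding times_pws.rep_eq
      by (rule order.trans[OF sum_abs]) (simp add: case_prod_unfold abs_mult)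
  qed (rule has_sum_imp_summable[OF *])
  then show "norm (a * b) \<le> norm a * norm b" using infsumI[OF *] by simp
qed

end

instance pws :: (type) banach
proof
  fix X :: "nat \<Rightarrow> 'a pws" assume X: "Cauchy X"
  have "Cauchy (\<lambda>n. coeff (X n) M)" for M
  proof (rule CauchyI)
    fix e :: real assume "e > 0"
    then obtain N where N: "\<And>m n. m \<ge> N \<Longrightarrow> n \<ge> N \<Longrightarrow> norm (X m - X n) < e" using CauchyD[OF X] by blast
    have "norm (coeff (X m) M - coeff (X n) M) < e" if "m \<ge> N" "n \<ge> N" for m n
      using N[OF that] abs_coeff_le_norm[of "X m - X n" M] by simp
    then show "\<exists>N. \<forall>m\<ge>N. \<forall>n\<ge>N. norm (coeff (X m) M - coeff (X n) M) < e" by blast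
  qed
  then have "\<forall>M. \<exists>l. (\<lambda>n. coeff (X n) M) \<longlonglongrightarrow> l"
    by (simp add: Cauchy_convergent_iff convergent_def)
  then obtain L where L: "\<And>M. (\<lambda>n. coeff (X n) M) \<longlonglongrightarrow> L M"
    by metis
  \<comment> \<open>The Cauchy estimate for finite partial sums survives letting one index tend to
    infinity. The bound is uniform in \<open>F\<close>, so it yields both membership of the limit in
    the space and convergence in norm.\<close>
  have tail: "\<exists>N. \<forall>n\<ge>N. \<forall>F. finite F \<longrightarrow> (\<Sum>M\<in>F. \<bar>L M - coeff (X n) M\<bar>) \<le> e" if "e > 0" for e
  proof -
    from CauchyD[OF X that]
    obtain N where N: "\<And>m n. m \<ge> N \<Longrightarrow> n \<ge> N \<Longrightarrow> norm (X m - X n) < e" by blast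
    have "(\<Sum>M\<in>F. \<bar>L M - coeff (X n) M\<bar>) \<le> e" if "finite F" "n \<ge> N" for F n
    proof (rule tendsto_upperbound)
      show "(\<lambda>m. \<Sum>M\<in>F. \<bar>coeff (X m) M - coeff (X n) M\<bar>) \<longlonglongrightarrow> (\<Sum>M\<in>F. \<bar>L M - coeff (X n) M\<bar>)"
        by (intro tendsto_intros L)
      have "(\<Sum>M\<in>F. \<bar>coeff (X m) M - coeff (X n) M\<bar>) \<le> e" if "m \<ge> N" for m
      proof -
        have "(\<Sum>M\<in>F. \<bar>coeff (X m - X n) M\<bar>) \<le> norm (X m - X n)"
          unfolding norm_pws_def
          by (rule finite_sum_le_infsum) (use abs_summable_coeff[of "X m - X n"] \<open>finite F\<close> in auto)
        then show ?thesis using N[OF that \<open>n \<ge> N\<close>] by simp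
      qed
      then show "\<forall>\<^sub>F m in sequentially. (\<Sum>M\<in>F. \<bar>coeff (X m) M - coeff (X n) M\<bar>) \<le> e"
        by (auto simp: eventually_sequentially)
    qed simp
    then show ?thesis by blast
  qed
  have summ: "(\<lambda>M. L M - coeff (X n) M) abs_summable_on UNIV"
    if "\<forall>F. finite F \<longrightarrow> (\<Sum>M\<in>F. \<bar>L M - coeff (X n) M\<bar>) \<le> e" for n e
    unfolding Infinite_Sum.abs_summable_iff_bdd_above by (rule bdd_aboveI[of _ e]) (use that in auto)
  obtain N where "\<forall>F. finite F \<longrightarrow> (\<Sum>M\<in>F. \<bar>L M - coeff (X N) M\<bar>) \<le> 1" using tail[of 1] by auto
  then have "L abs_summable_on UNIV"
    by (intro Infinite_Sum.abs_summable_on_comparison_test'[OF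
          summable_on_add[OF summ abs_summable_coeff[of "X N"]]]) auto
  then have coeff_L: "coeff (Pws L) = L" by (simp add: Pws_inverse)
  have "X \<longlonglongrightarrow> Pws L"
  proof (rule LIMSEQ_I)
    fix e :: real assume "e > 0"
    then obtain N where N: "\<forall>n\<ge>N. \<forall>F. finite F \<longrightarrow> (\<Sum>M\<in>F. \<bar>L M - coeff (X n) M\<bar>) \<le> e / 2"
      using tail[of "e / 2"] by auto
    have "norm (X n - Pws L) < e" if "n \<ge> N" for n
    proof -
      have "norm (Pws L - X n) \<le> e / 2"
        unfolding norm_pws_def coeff_simps coeff_L
        by (rule infsum_le_finite_sums) (use N that summ[of n "e / 2"] in auto)
      then show ?thesis using \<open>e > 0\<close> by (simp add: norm_minus_commute)
    qed
    then show "\<exists>N. \<forall>n\<ge>N. norm (X n - Pws L) < e" by blast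
  qed
  then show "convergent X" by (auto simp: convergent_def)
qed

section \<open>Evaluation and substitution of power series\<close>

definition mon :: "('a \<Rightarrow> 'b::comm_monoid_mult) \<Rightarrow> 'a multiset \<Rightarrow> 'b" where
  "mon y M = (\<Prod>a\<in>#M. y a)"

lemma mon_simps [simp]:
  "mon y {#} = 1" "mon y (add_mset a M) = y a * mon y M" "mon y (M + N) = mon y M * mon y N"
  by (simp_all add: mon_def)

lemma norm_mon_le:
  fixes y :: "'a \<Rightarrow> 'b::{real_normed_algebra_1,comm_ring_1}"
  assumes "\<And>a. norm (y a) \<le> t"
  shows "norm (mon y M) \<le> t ^ size M"
proof (induction M)
  case (add a M)
  have "norm (y a * mon y M) \<le> norm (y a) * norm (mon y M)" by (rule norm_mult_ineq)
  also have "\<dots> \<le> t * t ^ size M"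
    using assms add order.trans[OF norm_ge_zero assms] by (intro mult_mono) auto
  finally show ?case by simp
qed simp

lemma norm_mon_le_1:
  fixes y :: "'a \<Rightarrow> 'b::{real_normed_algebra_1,comm_ring_1}"
  shows "(\<And>a. norm (y a) \<le> 1) \<Longrightarrow> norm (mon y M) \<le> 1"
  using norm_mon_le[of y 1 M] by simp

text \<open>Telescoping one factor at a time imitates the mean value estimate. For the empty
  multiset the truncated subtraction is harmless, as the factor \<open>size M\<close> is 0.\<close>

lemma norm_mon_diff_le:
  fixes y z :: "'a \<Rightarrow> 'b::{real_normed_algebra_1,comm_ring_1}"
  assumes y: "\<And>a. norm (y a) \<le> t" and z: "\<And>a. norm (z a) \<le> t" and e: "\<And>a. norm (y a - z a) \<le> e"
  shows "norm (mon y M - mon z M) \<le> real (size M) * t ^ (size M - 1) * e"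
proof (induction M)
  case (add a M)
  have t: "t \<ge> 0" and e0: "e \<ge> 0" using order.trans[OF norm_ge_zero y] order.trans[OF norm_ge_zero e] by auto
  have "mon y (add_mset a M) - mon z (add_mset a M) = y a * (mon y M - mon z M) + (y a - z a) * mon z M"
    by (simp add: algebra_simps)
  also have "norm \<dots> \<le> norm (y a) * norm (mon y M - mon z M) + norm (y a - z a) * norm (mon z M)"
    by (intro order.trans[OF norm_triangle_ineq] add_mono norm_mult_ineq)
  also have "\<dots> \<le> t * (real (size M) * t ^ (size M - 1) * e) + e * t ^ size M"
    using t e0 by (intro add_mono mult_mono y e add norm_mon_le z) auto
  also have "\<dots> = real (size (add_mset a M)) * t ^ (size (add_mset a M) - 1) * e"
    by (cases "size M") (auto simp: algebra_simps)
  finally show ?case .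
qed simp

text \<open>The target is an arbitrary commutative Banach algebra: real arguments give the value of
  a series, arguments in \<open>pws\<close> the composite series.\<close>

definition psubst :: "'a pws \<Rightarrow> ('a \<Rightarrow> 'b::{real_normed_algebra_1,comm_ring_1,banach}) \<Rightarrow> 'b" where
  "psubst c y = (\<Sum>\<^sub>\<infinity>M. coeff c M *\<^sub>R mon y M)"

context
  fixes y :: "'a \<Rightarrow> 'b::{real_normed_algebra_1,comm_ring_1,banach}"
  assumes y: "\<And>a. norm (y a) \<le> 1"
begin

lemma psubst_abs_summable: "(\<lambda>M. coeff c M *\<^sub>R mon y M) abs_summable_on UNIV"
  by (rule Infinite_Sum.abs_summable_on_comparison_test'[OF abs_summable_coeff[of c]])
    (simp add: mult_left_le norm_mon_le_1 y)

lemma psubst_has_sum: "((\<lambda>M. coeff c M *\<^sub>R mon y M) has_sum psubst c y) UNIV"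
  unfolding psubst_def
  by (rule has_sum_infsum[OF Infinite_Sum.abs_summable_summable[OF psubst_abs_summable]])

lemma psubst_add: "psubst (c + d) y = psubst c y + psubst d y"
  using has_sum_unique[OF has_sum_add[OF psubst_has_sum[of c] psubst_has_sum[of d]]] psubst_has_sum[of "c + d"]
  by (simp add: algebra_simps)

lemma psubst_scaleR: "psubst (t *\<^sub>R c) y = t *\<^sub>R psubst c y"
  using has_sum_unique[OF has_sum_scaleR[OF psubst_has_sum[of c], of t]] psubst_has_sum[of "t *\<^sub>R c"]
  by simp

lemma norm_psubst_le: "norm (psubst c y) \<le> norm c"
  unfolding norm_pws_def real_norm_def[symmetric]
  by (rule norm_infsum_le[OF psubst_has_sum[of c] has_sum_infsum[OF abs_summable_coeff[of c]]])
    (simp add: mult_left_le norm_mon_le_1 y)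

lemma bounded_linear_psubst: "bounded_linear (\<lambda>c. psubst c y)"
  by (rule bounded_linear_intro[of _ 1]) (simp_all add: psubst_add psubst_scaleR norm_psubst_le)

lemma psubst_diff: "psubst (c - d) y = psubst c y - psubst d y"
  by (rule linear_diff[OF bounded_linear.linear[OF bounded_linear_psubst]])

lemma psubst_mult: "psubst (c * d) y = psubst c y * psubst d y"
proof -
  have "(\<Sum>(N, K)\<in>msplit M. coeff c N *\<^sub>R mon y N * coeff d K *\<^sub>R mon y K) = coeff (c * d) M *\<^sub>R mon y M" for M
    unfolding times_pws.rep_eq scaleR_left.sum by (rule sum.cong) (auto simp: msplit_def)
  with has_sum_convolution[OF psubst_abs_summable[of c] psubst_abs_summable[of d]]
  have "((\<lambda>M. coeff (c * d) M *\<^sub>R mon y M) has_sum psubst c y * psubst d y) UNIV"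
    by (simp add: psubst_def)
  then show ?thesis using psubst_has_sum has_sum_unique by blast
qed

lemma psubst_pmonom: "psubst (pmonom N) y = mon y N"
  unfolding psubst_def pmonom.rep_eq
  by (rule infsumI, rule has_sum_finite_neutralI[of "{N}"]) auto

lemma psubst_one: "psubst 1 y = 1"
  by (simp add: one_pws_def psubst_pmonom)

lemma psubst_mon: "psubst (mon Y M) y = mon (\<lambda>a. psubst (Y a) y) M"
  by (induction M) (simp_all add: psubst_one psubst_mult)

text \<open>Evaluation at \<open>y\<close> is a bounded algebra homomorphism, so it passes through
  the outer sum and through each monomial.\<close>

lemma psubst_psubst:
  assumes Y: "\<And>a. norm (Y a) \<le> 1"
  shows "psubst (psubst c Y) y = psubst c (\<lambda>a. psubst (Y a) y)"
proof -
  have "((\<lambda>M. psubst (coeff c M *\<^sub>R mon Y M) y) has_sum psubst (psubst c Y) y) UNIV"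
    by (rule has_sum_bounded_linear[OF bounded_linear_psubst])
      (unfold psubst_def, rule has_sum_infsum, rule Infinite_Sum.abs_summable_summable,
       rule Infinite_Sum.abs_summable_on_comparison_test'[OF abs_summable_coeff[of c]],
       simp add: mult_left_le norm_mon_le_1 Y)
  then show ?thesis unfolding psubst_scaleR psubst_mon by (simp add: infsumI psubst_def)
qed

end

text \<open>The remaining monomials have positive degree and are at most \<open>t\<close> in norm,
  since \<open>t\<close> is at most 1. This makes a series close to its constant term after
  shrinking the radius.\<close>

lemma norm_psubst_minus_const_le:
  fixes y :: "'a \<Rightarrow> 'b::{real_normed_algebra_1,comm_ring_1,banach}"
  assumes y: "\<And>a. norm (y a) \<le> t" and t: "t \<le> 1"
  shows "norm (psubst c y - coeff c {#} *\<^sub>R 1) \<le> t * norm c"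
proof -
  have y1: "norm (y a) \<le> 1" for a using y[of a] t by linarith
  have t0: "t \<ge> 0" using order.trans[OF norm_ge_zero y] .
  have "psubst c y - coeff c {#} *\<^sub>R 1 = psubst (c - coeff c {#} *\<^sub>R 1) y"
    by (simp add: psubst_diff psubst_scaleR psubst_one y1)
  also have "norm \<dots> \<le> t * norm c"
  proof (rule norm_infsum_le[OF psubst_has_sum[OF y1]])
    show "((\<lambda>M. t * \<bar>coeff c M\<bar>) has_sum t * norm c) UNIV"
      unfolding norm_pws_def using abs_summable_coeff[of c] by (intro has_sum_cmult_right has_sum_infsum) auto
    fix M :: "'a multiset"
    have "t ^ size M \<le> t" if "M \<noteq> {#}"
      using that t t0 by (cases "size M") (auto simp: mult_left_le power_le_one)
    then have "M \<noteq> {#} \<Longrightarrow> norm (mon y M) \<le> t" using norm_mon_le[of y t M] y by fastforce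
    then show "norm (coeff (c - coeff c {#} *\<^sub>R 1) M *\<^sub>R mon y M) \<le> t * \<bar>coeff c M\<bar>"
      using t0 by (auto simp: one_pws_def pmonom.rep_eq mult.commute[of t] intro!: mult_left_mono)
  qed
  finally show ?thesis .
qed

text \<open>Without terms of degree 0 and 1, substitution is Lipschitz with a constant proportional
  to \<open>t\<close>, hence a contraction for small \<open>t\<close>. The factor 2 arises because
  \<open>k * t ^ (k - 2)\<close> is at most 2 for \<open>k\<close> at least 2 and \<open>t\<close>
  at most 1/2.\<close>

lemma norm_psubst_diff_le:
  fixes y z :: "'a \<Rightarrow> 'b::{real_normed_algebra_1,comm_ring_1,banach}"
  assumes c: "\<And>M. size M \<le> 1 \<Longrightarrow> coeff c M = 0" and t: "t \<le> 1 / 2"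
    and y: "\<And>a. norm (y a) \<le> t" and z: "\<And>a. norm (z a) \<le> t" and e: "\<And>a. norm (y a - z a) \<le> e"
  shows "norm (psubst c y - psubst c z) \<le> 2 * t * e * norm c"
proof -
  have y1: "norm (y a) \<le> 1" and z1: "norm (z a) \<le> 1" for a using y[of a] z[of a] t by linarith+
  have t0: "t \<ge> 0" and e0: "e \<ge> 0" using order.trans[OF norm_ge_zero y] order.trans[OF norm_ge_zero e] by auto
  have "((\<lambda>M. coeff c M *\<^sub>R mon y M - coeff c M *\<^sub>R mon z M) has_sum psubst c y - psubst c z) UNIV"
    using has_sum_add[OF psubst_has_sum[OF y1, of c] has_sum_scaleR[OF psubst_has_sum[OF z1, of c], of "-1"]]
    by simp
  moreover have "((\<lambda>M. 2 * t * e * \<bar>coeff c M\<bar>) has_sum 2 * t * e * norm c) UNIV"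
    unfolding norm_pws_def using abs_summable_coeff[of c] by (intro has_sum_cmult_right has_sum_infsum) auto
  ultimately show ?thesis
  proof (rule norm_infsum_le)
    fix M :: "'a multiset"
    have "norm (coeff c M *\<^sub>R mon y M - coeff c M *\<^sub>R mon z M) = \<bar>coeff c M\<bar> * norm (mon y M - mon z M)"
      by (simp flip: scaleR_diff_right)
    also have "\<dots> \<le> \<bar>coeff c M\<bar> * (2 * t * e)"
    proof (cases "size M \<le> 1")
      case False
      then obtain n where n: "size M = Suc (Suc n)" by (metis One_nat_def le_SucI nat_le_linear not0_implies_Suc not_less_eq_eq)
      have "n + 2 \<le> 2 * 2 ^ n" for n :: nat by (induction n) auto
      then have "real (n + 2) \<le> 2 * 2 ^ n" by (metis of_nat_le_iff of_nat_mult of_nat_numeral of_nat_power)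
      then have "real (n + 2) * t ^ n \<le> (2 * 2 ^ n) * (1 / 2) ^ n"
        using t t0 by (intro mult_mono power_mono) auto
      also have "\<dots> = 2" by (simp add: power_one_over)
      finally have "real (n + 2) * t ^ n * (t * e) \<le> 2 * (t * e)" using t0 e0 by (intro mult_right_mono) auto
      moreover have "norm (mon y M - mon z M) \<le> real (size M) * t ^ (size M - 1) * e"
        by (rule norm_mon_diff_le[OF y z e])
      ultimately have "norm (mon y M - mon z M) \<le> 2 * t * e" by (simp add: n algebra_simps)
      then show ?thesis by (intro mult_left_mono) auto
    qed (simp add: c)
    finally show "norm (coeff c M *\<^sub>R mon y M - coeff c M *\<^sub>R mon z M) \<le> 2 * t * e * \<bar>coeff c M\<bar>"
      by (simp add: mult.commute)
  qed
qed

section \<open>Real analytic functions\<close>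

text \<open>All points of the space are variables, so those outside the basis are evaluated at 0.\<close>

definition crd :: "real \<Rightarrow> 'e::euclidean_space \<Rightarrow> 'e \<Rightarrow> real" where
  "crd \<rho> x b = (if b \<in> Basis then (x \<bullet> b) / \<rho> else 0)"

lemma abs_crd_le: "\<rho> > 0 \<Longrightarrow> \<bar>crd \<rho> x b\<bar> \<le> norm x / \<rho>"
  by (auto simp: crd_def divide_right_mono Basis_le_norm)

lemma norm_crd_le_1: "x \<in> ball a \<rho> \<Longrightarrow> norm (crd \<rho> (x - a) b) \<le> 1"
proof -
  assume x: "x \<in> ball a \<rho>"
  then have "\<rho> > 0" using zero_le_dist[of a x] by (simp del: zero_le_dist)
  moreover have "norm (x - a) / \<rho> \<le> 1" using x \<open>\<rho> > 0\<close> by (simp add: dist_norm norm_minus_commute)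
  ultimately show ?thesis using abs_crd_le[of \<rho> "x - a" b] order.trans unfolding real_norm_def by blast
qed

text \<open>Evaluation rules at points of the ball, cited below by position: 1 sum, 2 difference, 3
  scalar multiple, 4 product, 5 unit, 6 monomial, 7 composite, 8 zero.\<close>

lemmas psubst_crd = psubst_add[where y = "crd \<rho> (x - a)", OF norm_crd_le_1]
  psubst_diff[where y = "crd \<rho> (x - a)", OF norm_crd_le_1]
  psubst_scaleR[where y = "crd \<rho> (x - a)", OF norm_crd_le_1]
  psubst_mult[where y = "crd \<rho> (x - a)", OF norm_crd_le_1]
  psubst_one[where y = "crd \<rho> (x - a)", OF norm_crd_le_1]
  psubst_pmonom[where y = "crd \<rho> (x - a)", OF norm_crd_le_1]
  psubst_psubst[where y = "crd \<rho> (x - a)", OF norm_crd_le_1]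
  linear_0[OF bounded_linear.linear[OF bounded_linear_psubst[where y = "crd \<rho> (x - a)", OF norm_crd_le_1]]]
  for \<rho> x a

lemma mon_eq_prod:
  assumes "finite B" "set_mset M \<subseteq> B"
  shows "mon y M = (\<Prod>b\<in>B. y b ^ count M b)"
  using assms(2)
proof (induction M)
  case (add a M)
  have "(\<Prod>b\<in>B. y b ^ count (add_mset a M) b) = (\<Prod>b\<in>B. (if b = a then y b else 1) * y b ^ count M b)"
    by (rule prod.cong) auto
  also have "\<dots> = y a * mon y M" using add assms(1) by (simp add: prod.distrib)
  finally show ?case by simp
qed simp

text \<open>\<open>count\<close> identifies the multisets of basis vectors with the multi-indices of
  the analyticity definition; all other multisets receive the term 0.\<close>

lemma has_sum_multi_indices_iff:
  "(h has_sum s) (multi_indices :: ('e::euclidean_space \<Rightarrow> nat) set) \<longleftrightarrow>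
    ((\<lambda>M. if set_mset M \<subseteq> Basis then h (count M) else 0) has_sum s) UNIV"
proof -
  have fin: "finite {b. \<alpha> b > 0}" if "\<alpha> \<in> multi_indices" for \<alpha> :: "'e \<Rightarrow> nat"
    by (rule finite_subset[OF _ finite_Basis]) (use that in \<open>force simp: multi_indices_def\<close>)
  have "(h has_sum s) (multi_indices :: ('e \<Rightarrow> nat) set) \<longleftrightarrow>
      ((\<lambda>M. h (count M)) has_sum s) {M. set_mset M \<subseteq> Basis}"
  proof (rule has_sum_reindex_bij_witness[of _ count Abs_multiset])
    fix \<alpha> :: "'e \<Rightarrow> nat" assume \<alpha>: "\<alpha> \<in> multi_indices"
    then show c: "count (Abs_multiset \<alpha>) = \<alpha>" by (simp add: fin)
    have "x \<in> Basis" if "x \<in># Abs_multiset \<alpha>" for x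
      using that \<alpha> c unfolding count_greater_zero_iff[symmetric] by (auto simp: multi_indices_def)
    then show "Abs_multiset \<alpha> \<in> {M. set_mset M \<subseteq> Basis}" by blast
    show "h (count (Abs_multiset \<alpha>)) = h \<alpha>" by (simp add: c)
  qed (auto simp: multi_indices_def count_eq_zero_iff)
  also have "\<dots> \<longleftrightarrow> ((\<lambda>M. if set_mset M \<subseteq> Basis then h (count M) else 0) has_sum s) UNIV"
    by (rule has_sum_cong_neutral) auto
  finally show ?thesis .
qed

lemma mon_crd:
  assumes "set_mset M \<subseteq> (Basis :: 'e::euclidean_space set)"
  shows "mon (crd \<rho> x) M = (\<Prod>b\<in>Basis. (x \<bullet> b) ^ count M b) / \<rho> ^ size M"
proof -
  have "mon (crd \<rho> x) M = (\<Prod>b\<in>Basis. (x \<bullet> b) ^ count M b / \<rho> ^ count M b)"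
    using mon_eq_prod[OF finite_Basis assms, of "crd \<rho> x"] by (simp add: crd_def power_divide)
  also have "\<dots> = (\<Prod>b\<in>Basis. (x \<bullet> b) ^ count M b) / \<rho> ^ (\<Sum>b\<in>Basis. count M b)"
    by (simp add: prod_dividef power_sum)
  also have "(\<Sum>b\<in>Basis. count M b) = size M"
    unfolding size_multiset_overloaded_eq
    by (rule sum.mono_neutral_right) (use assms in \<open>auto simp: count_eq_zero_iff\<close>)
  finally show ?thesis .
qed

lemma mon_crd_eq_0: "\<not> set_mset M \<subseteq> (Basis :: 'e::euclidean_space set) \<Longrightarrow> mon (crd \<rho> x) M = 0"
  by (induction M) (auto simp: crd_def)

lemma one_less_2_DIM: "1 < real DIM('e::euclidean_space) * 2"
proof -
  have "1 \<le> real DIM('e)" by (simp add: Suc_leI)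
  then show ?thesis by linarith
qed

text \<open>From right to left the coefficients are merely rescaled by powers of
  \<open>\<rho>\<close>. The other direction has to extract an absolutely summable family from
  convergence on a ball, and does so by testing one point.\<close>

theorem real_analytic_at_iff_psubst:
  "real_analytic_at g a \<longleftrightarrow> (\<exists>\<rho>>0. \<exists>c. \<forall>x\<in>ball a \<rho>. g x = psubst c (crd \<rho> (x - a)))"
proof
  assume "real_analytic_at g a"
  then obtain c e where e: "e > 0" and sums: "\<And>x. x \<in> ball a e \<Longrightarrow>
      ((\<lambda>\<alpha>. c \<alpha> * (\<Prod>b\<in>Basis. ((x - a) \<bullet> b) ^ \<alpha> b)) has_sum g x) multi_indices"
    unfolding real_analytic_at_def by blast
  \<comment> \<open>The point with all coordinates \<open>\<rho>\<close> relative to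
    \<open>a\<close> is at distance at most \<open>\<rho> * DIM('a)\<close>, half of
    \<open>e\<close>, and so stays in the ball.\<close>
  define \<rho> where "\<rho> = e / (2 * DIM('a))"
  have \<rho>: "\<rho> > 0" "\<rho> < e"
    using e one_less_2_DIM[where 'e = 'a] by (auto simp: \<rho>_def field_simps)
  define d where "d M = (if set_mset M \<subseteq> Basis then c (count M) * \<rho> ^ size M else 0)" for M
  have conv: "(if set_mset M \<subseteq> Basis then c (count M) * (\<Prod>b\<in>Basis. ((x - a) \<bullet> b) ^ count M b) else 0)
      = d M * mon (crd \<rho> (x - a)) M" for M x
    using \<rho> by (simp add: d_def mon_crd)
  have sums': "((\<lambda>M. d M * mon (crd \<rho> (x - a)) M) has_sum g x) UNIV" if "x \<in> ball a e" for x
    using sums[OF that] unfolding has_sum_multi_indices_iff conv .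
  \<comment> \<open>All scaled coordinates of this point are 1, so the series there is the plain sum
    of \<open>d\<close>; for real families summability is absolute.\<close>
  define x0 where "x0 = a + \<rho> *\<^sub>R One"
  have "norm (One::'a) \<le> DIM('a)" by (rule order.trans[OF norm_sum]) simp
  then have "norm (\<rho> *\<^sub>R (One::'a)) \<le> \<rho> * DIM('a)" using \<rho> by simp
  also have "\<dots> < e" using e by (simp add: \<rho>_def)
  finally have "x0 \<in> ball a e" by (simp add: x0_def dist_norm)
  moreover have "(\<lambda>M. d M * mon (crd \<rho> (x0 - a)) M) = d"
    using \<rho> by (auto simp: d_def mon_eq_prod[OF finite_Basis] x0_def crd_def)
  ultimately have "d summable_on UNIV" using has_sum_imp_summable[OF sums'[of x0]] by metis
  then have "coeff (Pws d) = d"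
    by (intro Pws_inverse CollectI iffD1[OF summable_on_iff_abs_summable_on_real])
  then have "g x = psubst (Pws d) (crd \<rho> (x - a))" if "x \<in> ball a \<rho>" for x
    using infsumI[OF sums'[of x]] that \<rho> by (simp add: psubst_def)
  with \<rho> show "\<exists>\<rho>>0. \<exists>c. \<forall>x\<in>ball a \<rho>. g x = psubst c (crd \<rho> (x - a))" by blast
next
  assume "\<exists>\<rho>>0. \<exists>c. \<forall>x\<in>ball a \<rho>. g x = psubst c (crd \<rho> (x - a))"
  then obtain \<rho> c where \<rho>: "\<rho> > 0" and g: "\<And>x. x \<in> ball a \<rho> \<Longrightarrow> g x = psubst c (crd \<rho> (x - a))" by blast
  have "((\<lambda>\<alpha>. coeff c (Abs_multiset \<alpha>) / \<rho> ^ size (Abs_multiset \<alpha>) * (\<Prod>b\<in>Basis. ((x - a) \<bullet> b) ^ \<alpha> b)) has_sum g x)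
      multi_indices" if x: "x \<in> ball a \<rho>" for x
    unfolding has_sum_multi_indices_iff g[OF x]
    using psubst_has_sum[of "crd \<rho> (x - a)", OF norm_crd_le_1[OF x]]
    by (rule has_sum_cong[THEN iffD1, rotated]) (auto simp: count_inverse mon_crd mon_crd_eq_0)
  with \<rho> show "real_analytic_at g a" unfolding real_analytic_at_def
    by (intro exI[of _ "\<lambda>\<alpha>. coeff c (Abs_multiset \<alpha>) / \<rho> ^ size (Abs_multiset \<alpha>)"] exI[of _ \<rho>]) auto
qed

lemma psubst_crd_0: "psubst c (crd R 0) = coeff c {#}"
  using norm_psubst_minus_const_le[of "crd R 0" 0 c] by (simp add: crd_def)

text \<open>Passing from radius \<open>R\<close> to \<open>\<rho>\<close> substitutes
  \<open>\<rho> / R\<close> times each variable, which moves the series towards its constant term.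
  The form with an eventual radius lets finitely many functions share one.\<close>

lemma real_analytic_at_expansion:
  assumes "real_analytic_at g a" and \<epsilon>: "\<epsilon> > 0"
  shows "\<forall>\<^sub>F \<rho> in at_right 0. \<exists>c. norm (c - g a *\<^sub>R 1) \<le> \<epsilon> \<and> (\<forall>x\<in>ball a \<rho>. g x = psubst c (crd \<rho> (x - a)))"
proof -
  obtain R c where R: "R > 0" and g: "\<And>x. x \<in> ball a R \<Longrightarrow> g x = psubst c (crd R (x - a))"
    using assms(1) unfolding real_analytic_at_iff_psubst by blast
  have ga: "g a = coeff c {#}" using g[of a] R by (simp add: psubst_crd_0)
  define r where "r = min R (\<epsilon> * R / (norm c + 1))"
  have r: "r > 0" using R \<epsilon> by (simp add: r_def add_nonneg_pos)
  show ?thesis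
  proof (rule eventually_at_rightI[OF _ r])
    fix \<rho> assume "\<rho> \<in> {0<..<r}"
    then have \<rho>: "\<rho> > 0" "\<rho> < R" "\<rho> * (norm c + 1) < \<epsilon> * R"
      using norm_ge_zero[of c] by (auto simp: r_def pos_less_divide_eq add_nonneg_pos simp del: norm_ge_zero)
    define t where "t = \<rho> / R"
    have t: "t > 0" "t \<le> 1" using \<rho> R by (auto simp: t_def)
    define y :: "'a \<Rightarrow> 'a pws" where "y b = t *\<^sub>R pmonom {#b#}" for b
    have y: "norm (y b) \<le> t" for b using t by (simp add: y_def)
    then have y1: "norm (y b) \<le> 1" for b using t order.trans by blast
    have "norm (psubst c y - g a *\<^sub>R 1) \<le> t * norm c"
      unfolding ga using y t by (intro norm_psubst_minus_const_le) auto
    also have "\<dots> \<le> \<epsilon>" using \<rho> R by (simp add: t_def field_simps)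
    finally have "norm (psubst c y - g a *\<^sub>R 1) \<le> \<epsilon>" .
    moreover have "g x = psubst (psubst c y) (crd \<rho> (x - a))" if x: "x \<in> ball a \<rho>" for x
    proof -
      have "psubst (y b) (crd \<rho> (x - a)) = crd R (x - a) b" for b
        using \<rho> R by (simp add: y_def psubst_crd[OF x]) (simp add: crd_def t_def)
      moreover have "x \<in> ball a R" using x \<rho> by auto
      ultimately show ?thesis using g by (simp add: psubst_crd(7)[OF x y1])
    qed
    ultimately show "\<exists>c. norm (c - g a *\<^sub>R 1) \<le> \<epsilon> \<and> (\<forall>x\<in>ball a \<rho>. g x = psubst c (crd \<rho> (x - a)))" by blast
  qed
qed

definition analytic_map_at :: "('e::euclidean_space \<Rightarrow> 'f::euclidean_space) \<Rightarrow> 'e \<Rightarrow> bool" where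
  "analytic_map_at f a \<longleftrightarrow> (\<forall>b\<in>Basis. real_analytic_at (\<lambda>x. f x \<bullet> b) a)"

lemma real_analytic_atI:
  assumes "\<forall>\<^sub>F \<rho> in at_right 0. \<exists>c. \<forall>x\<in>ball a \<rho>. g x = psubst c (crd \<rho> (x - a))"
  shows "real_analytic_at g a"
proof -
  have "\<forall>\<^sub>F \<rho> in at_right 0. \<rho> > (0::real)" by (simp add: eventually_at_right_less)
  from eventually_happens[OF eventually_conj[OF this assms]] show ?thesis
    unfolding real_analytic_at_iff_psubst by force
qed

lemma inverse_one_minus_banach:
  fixes z :: "'b::{real_normed_algebra_1,banach}"
  assumes "norm z < 1"
  shows "\<exists>s. (1 - z) * s = 1"
proof -
  have summ: "summable (\<lambda>n. z ^ n)"
    by (rule summable_comparison_test'[OF summable_geometric[of "norm z"]]) (use assms in \<open>auto simp: norm_power_ineq\<close>)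
  have "(\<Sum>n. z ^ n) = 1 + z * (\<Sum>n. z ^ n)"
    using suminf_split_head[OF summ] suminf_mult[OF summ, of z] by (simp add: algebra_simps)
  then have "(1 - z) * (\<Sum>n. z ^ n) = 1" by (simp add: algebra_simps)
  then show ?thesis by blast
qed

section \<open>Closure properties of real analytic functions\<close>

lemma real_analytic_at_const [simp]: "real_analytic_at (\<lambda>x. k) a"
  unfolding real_analytic_at_iff_psubst
  by (intro exI[of _ 1] conjI exI[of _ "k *\<^sub>R 1"] ballI)
    (simp_all add: psubst_crd)

lemma real_analytic_at_coordinate: "b \<in> Basis \<Longrightarrow> real_analytic_at (\<lambda>x. x \<bullet> b) a"
  unfolding real_analytic_at_iff_psubst
  by (intro exI[of _ 1] conjI exI[of _ "pmonom {#b#} + (a \<bullet> b) *\<^sub>R 1"] ballI)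
    (simp_all add: psubst_crd, simp add: crd_def algebra_simps)

lemma real_analytic_at_add:
  assumes "real_analytic_at f a" "real_analytic_at g a"
  shows "real_analytic_at (\<lambda>x. f x + g x) a"
proof (rule real_analytic_atI)
  show "\<forall>\<^sub>F \<rho> in at_right 0. \<exists>c. \<forall>x\<in>ball a \<rho>. f x + g x = psubst c (crd \<rho> (x - a))"
    using real_analytic_at_expansion[OF assms(1) zero_less_one] real_analytic_at_expansion[OF assms(2) zero_less_one]
    by eventually_elim (metis psubst_crd(1))
qed

lemma real_analytic_at_mult:
  assumes "real_analytic_at f a" "real_analytic_at g a"
  shows "real_analytic_at (\<lambda>x. f x * g x) a"
proof (rule real_analytic_atI)
  show "\<forall>\<^sub>F \<rho> in at_right 0. \<exists>c. \<forall>x\<in>ball a \<rho>. f x * g x = psubst c (crd \<rho> (x - a))"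
    using real_analytic_at_expansion[OF assms(1) zero_less_one] real_analytic_at_expansion[OF assms(2) zero_less_one]
    by eventually_elim (metis psubst_crd(4))
qed

lemma real_analytic_at_uminus: "real_analytic_at f a \<Longrightarrow> real_analytic_at (\<lambda>x. - f x) a"
  using real_analytic_at_mult[OF real_analytic_at_const[of "-1"]] by simp

lemma real_analytic_at_diff:
  "real_analytic_at f a \<Longrightarrow> real_analytic_at g a \<Longrightarrow> real_analytic_at (\<lambda>x. f x - g x) a"
  using real_analytic_at_add[OF _ real_analytic_at_uminus] by simp

lemma real_analytic_at_sum:
  "(\<And>i. i \<in> I \<Longrightarrow> real_analytic_at (f i) a) \<Longrightarrow> real_analytic_at (\<lambda>x. \<Sum>i\<in>I. f i x) a"
  by (induction I rule: infinite_finite_induct) (auto intro: real_analytic_at_add)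

text \<open>After division by \<open>f a\<close> the series lies within 1/2 of the unit, so the
  Neumann series inverts it inside the algebra.\<close>

lemma real_analytic_at_inverse:
  assumes f: "real_analytic_at f a" and nz: "f a \<noteq> 0"
  shows "real_analytic_at (\<lambda>x. inverse (f x)) a"
proof -
  have g: "real_analytic_at (\<lambda>x. f x * inverse (f a)) a"
    by (intro real_analytic_at_mult f real_analytic_at_const)
  have "real_analytic_at (\<lambda>x. inverse (f x * inverse (f a))) a"
  proof (rule real_analytic_atI)
    show "\<forall>\<^sub>F \<rho> in at_right 0. \<exists>c. \<forall>x\<in>ball a \<rho>. inverse (f x * inverse (f a)) = psubst c (crd \<rho> (x - a))"
      using real_analytic_at_expansion[OF g half_gt_zero[OF zero_less_one]]
    proof eventually_elim
      case (elim \<rho>)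
      then obtain c where c: "norm (c - 1) \<le> 1 / 2"
        and eq: "\<And>x. x \<in> ball a \<rho> \<Longrightarrow> f x * inverse (f a) = psubst c (crd \<rho> (x - a))"
        using nz by (auto simp: right_inverse)
      from c have "norm (1 - c) < 1" by (simp add: norm_minus_commute)
      then obtain s where "c * s = 1" using inverse_one_minus_banach[of "1 - c"] by auto
      then have "psubst c (crd \<rho> (x - a)) * psubst s (crd \<rho> (x - a)) = 1" if "x \<in> ball a \<rho>" for x
        using psubst_crd(4,5)[OF that] by metis
      then show ?case using eq by (intro exI[of _ s] ballI) (metis inverse_unique)
    qed
  qed
  then have "real_analytic_at (\<lambda>x. inverse (f x * inverse (f a)) * inverse (f a)) a"
    by (intro real_analytic_at_mult real_analytic_at_const)
  then show ?thesis using nz by (simp add: mult.assoc)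
qed

theorem real_analytic_at_compose:
  assumes f: "analytic_map_at f a" and g: "real_analytic_at g (f a)"
  shows "real_analytic_at (\<lambda>x. g (f x)) a"
proof (rule real_analytic_atI)
  obtain R c where R: "R > 0" and g: "\<And>y. y \<in> ball (f a) R \<Longrightarrow> g y = psubst c (crd R (y - f a))"
    using g unfolding real_analytic_at_iff_psubst by blast
  \<comment> \<open>The bound \<open>e \<le> R\<close> makes the rescaled coordinate series
    admissible for substitution; \<open>e * DIM('b) < R\<close> keeps \<open>f x\<close> in the ball
    where the expansion of \<open>g\<close> holds.\<close>
  define e where "e = R / (2 * DIM('b))"
  have e: "e > 0" "e \<le> R" "e * DIM('b) < R"
    using R one_less_2_DIM[where 'e = 'b] by (auto simp: e_def field_simps)
  have "\<forall>\<^sub>F \<rho> in at_right 0. \<forall>b\<in>Basis. \<exists>c. norm (c - (f a \<bullet> b) *\<^sub>R 1) \<le> e \<and>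
      (\<forall>x\<in>ball a \<rho>. f x \<bullet> b = psubst c (crd \<rho> (x - a)))"
    using f e by (intro eventually_ball_finite ballI real_analytic_at_expansion)
      (auto simp: analytic_map_at_def)
  then show "\<forall>\<^sub>F \<rho> in at_right 0. \<exists>c. \<forall>x\<in>ball a \<rho>. g (f x) = psubst c (crd \<rho> (x - a))"
  proof eventually_elim
    case (elim \<rho>)
    then obtain C where C: "\<And>b. b \<in> Basis \<Longrightarrow> norm (C b - (f a \<bullet> b) *\<^sub>R 1) \<le> e"
      and eq: "\<And>b x. b \<in> Basis \<Longrightarrow> x \<in> ball a \<rho> \<Longrightarrow> f x \<bullet> b = psubst (C b) (crd \<rho> (x - a))"
      by metis
    define Y where "Y b = (if b \<in> Basis then (1 / R) *\<^sub>R (C b - (f a \<bullet> b) *\<^sub>R 1) else 0)" for b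
    have Y: "norm (Y b) \<le> 1" for b using C[of b] e R by (auto simp: Y_def)
    have "g (f x) = psubst (psubst c Y) (crd \<rho> (x - a))" if x: "x \<in> ball a \<rho>" for x
    proof -
      have comp: "psubst (C b - (f a \<bullet> b) *\<^sub>R 1) (crd \<rho> (x - a)) = (f x - f a) \<bullet> b" if "b \<in> Basis" for b
        using eq[OF that x] by (simp add: psubst_crd[OF x] inner_diff_left)
      have "\<bar>(f x - f a) \<bullet> b\<bar> \<le> e" if "b \<in> Basis" for b
        using norm_psubst_le[of "crd \<rho> (x - a)", OF norm_crd_le_1[OF x], of "C b - (f a \<bullet> b) *\<^sub>R 1"] C[OF that] comp[OF that] by simp
      then have "norm (f x - f a) \<le> e * DIM('b)"
        using norm_le_l1[of "f x - f a"] sum_bounded_above[of Basis "\<lambda>b. \<bar>(f x - f a) \<bullet> b\<bar>" e]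
        by (simp add: mult.commute)
      then have "f x \<in> ball (f a) R" using e by (simp add: dist_norm norm_minus_commute)
      moreover have "psubst (Y b) (crd \<rho> (x - a)) = crd R (f x - f a) b" for b
        using comp[of b] by (cases "b \<in> Basis")
          (simp_all add: Y_def psubst_crd[OF x], simp_all add: crd_def)
      ultimately show ?thesis using g by (simp add: psubst_crd(7)[OF x Y])
    qed
    then show ?case by blast
  qed
qed

text \<open>Re-expansion at a centre \<open>z\<close> within \<open>R / 2\<close>: each scaled
  coordinate becomes a constant of size at most 1/2 plus half of a new variable, a substitution of
  norm at most 1.\<close>

theorem real_analytic_at_eventually:
  assumes "real_analytic_at g a"
  shows "\<forall>\<^sub>F x in nhds a. real_analytic_at g x"
proof -
  obtain R c where R: "R > 0" and g: "\<And>y. y \<in> ball a R \<Longrightarrow> g y = psubst c (crd R (y - a))"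
    using assms unfolding real_analytic_at_iff_psubst by blast
  have "real_analytic_at g z" if z: "z \<in> ball a (R / 2)" for z
  proof -
    define Y where "Y b = (if b \<in> Basis then ((z - a) \<bullet> b / R) *\<^sub>R 1 + (1 / 2) *\<^sub>R pmonom {#b#} else 0)" for b :: 'a
    have Y: "norm (Y b) \<le> 1" for b
    proof (cases "b \<in> Basis")
      case True
      have "\<bar>(z - a) \<bullet> b\<bar> \<le> R / 2"
        using Basis_le_norm[OF True, of "z - a"] z by (simp add: dist_norm norm_minus_commute)
      then have "norm (((z - a) \<bullet> b / R) *\<^sub>R (1::'a pws)) \<le> 1 / 2" using R by (simp add: field_simps)
      moreover have "norm ((1 / 2) *\<^sub>R pmonom {#b#}) \<le> 1 / 2" by simp
      ultimately have "norm (((z - a) \<bullet> b / R) *\<^sub>R 1 + (1 / 2) *\<^sub>R pmonom {#b#}) \<le> 1"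
        using norm_triangle_mono by fastforce
      then show ?thesis using True by (simp add: Y_def)
    qed (simp add: Y_def)
    have "g x = psubst (psubst c Y) (crd (R / 2) (x - z))" if x: "x \<in> ball z (R / 2)" for x
    proof -
      have "psubst (Y b) (crd (R / 2) (x - z)) = crd R (x - a) b" for b
        using R by (cases "b \<in> Basis") (simp_all add: Y_def psubst_crd[OF x],
            simp_all add: crd_def field_simps inner_diff_left)
      moreover have "x \<in> ball a R" using x z dist_triangle[of a x z] by simp
      ultimately show ?thesis using g by (simp add: psubst_crd(7)[OF x Y])
    qed
    with R show ?thesis unfolding real_analytic_at_iff_psubst by (intro exI[of _ "R / 2"]) auto
  qed
  then show ?thesis using R unfolding eventually_nhds by (intro exI[of _ "ball a (R / 2)"]) auto
qed

section \<open>The analytic right inverse theorem\<close>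

lemma coeff_sum: "coeff (\<Sum>i\<in>I. c i) M = (\<Sum>i\<in>I. coeff (c i) M)"
  by (induction I rule: infinite_finite_induct) auto

lemma size_eq_Suc_0E: "size M = Suc 0 \<Longrightarrow> (\<And>b. M = {#b#} \<Longrightarrow> P) \<Longrightarrow> P"
  using size_1_singleton_mset by auto

lemma abs_psubst_minus_linear_le:
  fixes c :: "'e::euclidean_space pws"
  assumes \<xi>: "\<And>b. \<bar>crd R x b\<bar> \<le> t" and t: "t \<le> 1"
  shows "\<bar>psubst c (crd R x) - coeff c {#} - (\<Sum>b\<in>Basis. coeff c {#b#} * crd R x b)\<bar> \<le> t\<^sup>2 * norm c"
proof -
  let ?\<xi> = "crd R x"
  have t0: "t \<ge> 0" using order.trans[OF abs_ge_zero \<xi>] .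
  have 1: "norm (?\<xi> b) \<le> 1" for b using order.trans[OF \<xi> t] by simp
  define d where "d = c - coeff c {#} *\<^sub>R 1 - (\<Sum>b\<in>Basis. coeff c {#b#} *\<^sub>R pmonom {#b#})"
  have "psubst (\<Sum>b\<in>Basis. coeff c {#b#} *\<^sub>R pmonom {#b#}) ?\<xi> = (\<Sum>b\<in>Basis. coeff c {#b#} * ?\<xi> b)"
    unfolding linear_sum[OF bounded_linear.linear[OF bounded_linear_psubst[of ?\<xi>, OF 1]]]
    by (simp add: psubst_scaleR[of ?\<xi>, OF 1] psubst_pmonom[of ?\<xi>, OF 1])
  then have "psubst c ?\<xi> - coeff c {#} - (\<Sum>b\<in>Basis. coeff c {#b#} * ?\<xi> b) = psubst d ?\<xi>"
    by (simp add: d_def psubst_diff[of ?\<xi>, OF 1] psubst_scaleR[of ?\<xi>, OF 1] psubst_one[of ?\<xi>, OF 1])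
  also have "norm \<dots> \<le> t\<^sup>2 * norm c"
  proof (rule norm_infsum_le[OF psubst_has_sum[of ?\<xi>, OF 1]])
    show "((\<lambda>M. t\<^sup>2 * \<bar>coeff c M\<bar>) has_sum t\<^sup>2 * norm c) UNIV"
      unfolding norm_pws_def using abs_summable_coeff[of c] by (intro has_sum_cmult_right has_sum_infsum) auto
    fix M :: "'e multiset"
    have d: "coeff d M = coeff c M - coeff c {#} * (if M = {#} then 1 else 0) -
        (\<Sum>b\<in>Basis. if M = {#b#} then coeff c M else 0)"
      by (auto simp: d_def coeff_sum one_pws_def pmonom.rep_eq intro!: sum.cong)
    consider "size M = 0" | "size M = Suc 0" | n where "size M = Suc (Suc n)"
      by (metis not0_implies_Suc)
    then show "norm (coeff d M *\<^sub>R mon ?\<xi> M) \<le> t\<^sup>2 * \<bar>coeff c M\<bar>"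
    proof cases
      case 1
      then have "coeff d M = 0" unfolding d by simp
      then show ?thesis by simp
    next
      case 2
      then obtain b where b: "M = {#b#}" by (rule size_eq_Suc_0E)
      \<comment> \<open>A variable outside \<open>Basis\<close> keeps its coefficient in
        \<open>d\<close>, but is evaluated at 0.\<close>
      then have "coeff d M * mon ?\<xi> M = 0" by (cases "b \<in> Basis") (auto simp: d[unfolded b] crd_def)
      then show ?thesis by auto
    next
      case 3
      then have "M \<noteq> {#b#}" "M \<noteq> {#}" for b by auto
      then have "coeff d M = coeff c M" by (simp add: d)
      moreover have "norm (mon ?\<xi> M) \<le> t ^ size M" using \<xi> by (intro norm_mon_le) auto
      moreover have "t ^ size M \<le> t\<^sup>2" unfolding 3 power2_eq_square
        using t t0 by (simp add: mult_left_le mult_left_mono power_le_one mult.assoc[symmetric])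
      ultimately have "\<bar>coeff c M\<bar> * \<bar>mon ?\<xi> M\<bar> \<le> \<bar>coeff c M\<bar> * t\<^sup>2" by (intro mult_left_mono) auto
      then show ?thesis using \<open>coeff d M = coeff c M\<close> by (simp add: abs_mult mult.commute)
    qed
  qed
  finally show ?thesis by simp
qed

text \<open>Identifies the linear coefficients with the derivative. Besides continuity this gives,
  by uniqueness of derivatives, the vanishing of linear coefficients in the fixed point
  argument.\<close>

lemma psubst_has_derivative:
  assumes R: "R > 0" and f: "\<And>x. x \<in> ball a R \<Longrightarrow> f x = psubst c (crd R (x - a))"
  shows "(f has_derivative (\<lambda>h. \<Sum>b\<in>Basis. coeff c {#b#} * ((h \<bullet> b) / R))) (at a)"
proof (rule has_derivativeI_sandwich[where e = R and H = "\<lambda>y. norm c / R\<^sup>2 * norm (y - a)"])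
  show "bounded_linear (\<lambda>h. \<Sum>b\<in>Basis. coeff c {#b#} * ((h \<bullet> b) / R))"
    by (intro bounded_linear_sum bounded_linear_mult_right[THEN bounded_linear_compose]
        bounded_linear_divide[THEN bounded_linear_compose] bounded_linear_inner_left)
  show "((\<lambda>y. norm c / R\<^sup>2 * norm (y - a)) \<longlongrightarrow> 0) (at a)" using R by (auto intro!: tendsto_eq_intros)
  have fa: "f a = coeff c {#}" using f[of a] R by (simp add: psubst_crd_0)
  fix y assume y: "y \<noteq> a" "dist y a < R"
  define t where "t = norm (y - a) / R"
  have "\<bar>crd R (y - a) b\<bar> \<le> t" for b unfolding t_def by (rule abs_crd_le[OF R])
  moreover have "t \<le> 1" using y R by (simp add: t_def dist_norm)
  ultimately have "\<bar>f y - f a - (\<Sum>b\<in>Basis. coeff c {#b#} * crd R (y - a) b)\<bar> \<le> t\<^sup>2 * norm c"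
    using abs_psubst_minus_linear_le[of R "y - a" t c] f[of y] y by (simp add: fa dist_commute)
  then have "\<bar>f y - f a - (\<Sum>b\<in>Basis. coeff c {#b#} * ((y - a) \<bullet> b / R))\<bar> \<le> t\<^sup>2 * norm c"
    by (simp add: crd_def)
  then show "norm (f y - f a - (\<Sum>b\<in>Basis. coeff c {#b#} * ((y - a) \<bullet> b / R))) / norm (y - a)
      \<le> norm c / R\<^sup>2 * norm (y - a)"
    using y R by (simp add: t_def field_simps power2_eq_square)
qed (rule R)

lemma real_analytic_at_isCont: "real_analytic_at f a \<Longrightarrow> isCont f a"
  unfolding real_analytic_at_iff_psubst using psubst_has_derivative has_derivative_continuous by blast

lemma analytic_map_at_isCont:
  assumes "analytic_map_at f a"
  shows "isCont f a"
proof -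
  have "isCont (\<lambda>x. \<Sum>b\<in>Basis. (f x \<bullet> b) *\<^sub>R b) a"
    using assms unfolding analytic_map_at_def
    by (intro continuous_sum continuous_scaleR continuous_const) (auto intro: real_analytic_at_isCont)
  then show ?thesis by (simp add: euclidean_representation)
qed

lemma analytic_map_at_tendsto:
  "analytic_map_at f a \<Longrightarrow> filterlim f (nhds (f a)) (nhds a)"
  using analytic_map_at_isCont by (simp add: isCont_def tendsto_nhds_iff)

lemma analytic_map_at_compose:
  assumes "analytic_map_at f a" "analytic_map_at g (f a)"
  shows "analytic_map_at (\<lambda>x. g (f x)) a"
  using assms real_analytic_at_compose[OF assms(1)] by (auto simp: analytic_map_at_def)

lemma real_analytic_at_linear:
  fixes L :: "'e::euclidean_space \<Rightarrow> real"
  assumes "linear L"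
  shows "real_analytic_at L a"
proof -
  have eq: "L = (\<lambda>x. \<Sum>b\<in>Basis. L b * (x \<bullet> b))"
  proof
    fix x
    have "L (\<Sum>b\<in>Basis. (x \<bullet> b) *\<^sub>R b) = (\<Sum>b\<in>Basis. (x \<bullet> b) *\<^sub>R L b)"
      by (simp add: linear_sum[OF assms] linear_cmul[OF assms])
    then show "L x = (\<Sum>b\<in>Basis. L b * (x \<bullet> b))" by (simp add: euclidean_representation mult.commute)
  qed
  have "real_analytic_at (\<lambda>x. \<Sum>b\<in>Basis. L b * (x \<bullet> b)) a"
    by (intro real_analytic_at_sum real_analytic_at_mult real_analytic_at_const real_analytic_at_coordinate)
  then show ?thesis by (simp only: eq[symmetric])
qed

lemma analytic_map_at_linear: "linear L \<Longrightarrow> analytic_map_at L a"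
  unfolding analytic_map_at_def
  by (auto intro!: real_analytic_at_linear bounded_linear.linear[OF bounded_linear_inner_left_comp] simp: linear_conv_bounded_linear)

lemma analytic_map_at_const: "analytic_map_at (\<lambda>x. k) a"
  by (simp add: analytic_map_at_def)

lemma analytic_map_at_add:
  "analytic_map_at f a \<Longrightarrow> analytic_map_at g a \<Longrightarrow> analytic_map_at (\<lambda>x. f x + g x) a"
  by (simp add: analytic_map_at_def inner_add_left real_analytic_at_add)

lemma analytic_map_at_diff:
  "analytic_map_at f a \<Longrightarrow> analytic_map_at g a \<Longrightarrow> analytic_map_at (\<lambda>x. f x - g x) a"
  by (simp add: analytic_map_at_def inner_diff_left real_analytic_at_diff)

text \<open>Linear coefficients of variables outside \<open>Basis\<close> are invisible to
  evaluation and need not vanish. Dropping them gives a series to which the contraction estimate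
  applies.\<close>

lemma psubst_crd_truncate:
  fixes c :: "'e::euclidean_space pws"
  assumes "coeff c {#} = 0" "\<And>b. b \<in> Basis \<Longrightarrow> coeff c {#b#} = 0"
  obtains d where "\<And>M. size M \<le> 1 \<Longrightarrow> coeff d M = 0" "\<And>R x. psubst d (crd R x) = psubst c (crd R x)"
proof
  define d where "d = Pws (\<lambda>M. if size M \<le> 1 then 0 else coeff c M)"
  have d: "coeff d = (\<lambda>M. if size M \<le> 1 then 0 else coeff c M)"
    unfolding d_def
    by (rule Pws_inverse, rule CollectI, rule Infinite_Sum.abs_summable_on_comparison_test[OF abs_summable_coeff[of c]]) auto
  show "size M \<le> 1 \<Longrightarrow> coeff d M = 0" for M by (simp add: d)
  have "coeff c M * mon (crd R x) M = 0" if "size M \<le> 1" for M R and x :: 'e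
  proof (cases "size M = 0")
    case False
    with that have "size M = Suc 0" by linarith
    then obtain b where b: "M = {#b#}" by (rule size_eq_Suc_0E)
    then show ?thesis by (cases "b \<in> Basis") (auto simp: assms crd_def)
  qed (simp add: assms)
  then show "psubst d (crd R x) = psubst c (crd R x)" for R x
    unfolding psubst_def by (intro infsum_cong) (auto simp: d)
qed

text \<open>Contraction principle in the supremum distance of families bounded by \<open>t\<close>,
  iterated from 0. Only the finitely many indices in \<open>B\<close> matter, so convergence at each
  index is uniform.\<close>

lemma banach_fixed_family:
  fixes \<Phi> :: "('e \<Rightarrow> 'b::banach) \<Rightarrow> 'e \<Rightarrow> 'b"
  assumes B: "finite B" and t: "t \<ge> 0"
    and off: "\<And>y b. b \<notin> B \<Longrightarrow> \<Phi> y b = 0"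
    and stay: "\<And>y b. (\<And>b. norm (y b) \<le> t) \<Longrightarrow> norm (\<Phi> y b) \<le> t"
    and contr: "\<And>y z e b. (\<And>b. norm (y b) \<le> t) \<Longrightarrow> (\<And>b. norm (z b) \<le> t) \<Longrightarrow>
      (\<And>b. norm (y b - z b) \<le> e) \<Longrightarrow> norm (\<Phi> y b - \<Phi> z b) \<le> e / 2"
  shows "\<exists>L. (\<forall>b. norm (L b) \<le> t) \<and> \<Phi> L = L"
proof -
  define ys where "ys n = (\<Phi> ^^ n) (\<lambda>_. 0)" for n
  have ys_Suc: "ys (Suc n) = \<Phi> (ys n)" for n by (simp add: ys_def)
  have le: "norm (ys n b) \<le> t" for n b
    by (induction n arbitrary: b) (use t in \<open>auto simp: ys_Suc ys_def intro!: stay\<close>)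
  have step: "norm (ys (Suc n) b - ys n b) \<le> t * (1 / 2) ^ n" for n b
  proof (induction n arbitrary: b)
    case 0
    then show ?case using le[of "Suc 0" b] by (simp add: ys_def)
  next
    case (Suc n)
    then show ?case using contr[of "ys (Suc n)" "ys n" "t * (1 / 2) ^ n" b, OF le le Suc] by (simp add: ys_Suc)
  qed
  have "convergent (\<lambda>n. ys n b)" for b
  proof -
    have "summable (\<lambda>n. ys (Suc n) b - ys n b)"
      by (rule summable_comparison_test'[OF summable_mult[OF summable_geometric[of "1 / 2 :: real"]]])
        (use step in auto)
    then have "convergent (\<lambda>n. \<Sum>k<n. ys (Suc k) b - ys k b)" by (simp add: summable_iff_convergent)
    then show ?thesis unfolding sum_lessThan_telescope[of "\<lambda>k. ys k b"] by (simp add: ys_def)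
  qed
  then obtain L where L: "\<And>b. (\<lambda>n. ys n b) \<longlonglongrightarrow> L b" unfolding convergent_def by metis
  have L_le: "norm (L b) \<le> t" for b
    by (rule tendsto_upperbound[OF tendsto_norm[OF L]]) (auto simp: le)
  have ys_off: "ys n b = 0" if "b \<notin> B" for n b using off[OF that] by (cases n) (auto simp: ys_def)
  then have L_off: "L b = 0" if "b \<notin> B" for b using LIMSEQ_unique[OF L[of b]] that by (simp add: ys_off[OF that])
  have "\<Phi> L b = L b" for b
  proof -
    define e where "e n = (\<Sum>b\<in>B. norm (ys n b - L b))" for n
    have e: "norm (ys n b - L b) \<le> e n" for n b
    proof (cases "b \<in> B")
      case True
      then show ?thesis unfolding e_def by (intro member_le_sum B) auto
    qed (simp add: ys_off L_off e_def sum_nonneg)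
    have "(\<lambda>n. ys n b - L b) \<longlonglongrightarrow> 0" for b using L[of b] by (simp add: LIM_zero_iff)
    then have "e \<longlonglongrightarrow> (\<Sum>b\<in>B. norm (0::'b))" unfolding e_def by (intro tendsto_sum tendsto_norm)
    then have e0: "(\<lambda>n. e n / 2) \<longlonglongrightarrow> 0" by (simp add: tendsto_divide_zero)
    have "norm (\<Phi> (ys n) b - \<Phi> L b) \<le> e n / 2" for n by (rule contr[OF le L_le e])
    then have "(\<lambda>n. \<Phi> (ys n) b - \<Phi> L b) \<longlonglongrightarrow> 0"
      by (intro Lim_null_comparison[OF _ e0]) auto
    then have "(\<lambda>n. ys (Suc n) b) \<longlonglongrightarrow> \<Phi> L b" by (simp add: ys_Suc LIM_zero_iff)
    then show ?thesis using LIMSEQ_unique LIMSEQ_Suc[OF L[of b]] by blast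
  qed
  then show ?thesis using L_le by blast
qed


text \<open>The equation is solved for series \<open>L b\<close> in \<open>pws\<close>:
  \<open>L b\<close> is \<open>t / 2\<close> times the variable \<open>b\<close> plus
  \<open>1 / R\<close> times the expansion of the component \<open>b\<close> of \<open>h\<close> at
  \<open>L\<close>. As \<open>h\<close> has no constant and linear terms, this is a contraction;
  evaluating \<open>L\<close> gives \<open>Y\<close>.\<close>

lemma real_analytic_fixed_point:
  fixes h :: "'e::euclidean_space \<Rightarrow> 'e"
  assumes h: "analytic_map_at h 0" and h0: "h 0 = 0" and h': "(h has_derivative (\<lambda>_. 0)) (at 0)"
  shows "\<exists>Y. analytic_map_at Y 0 \<and> Y 0 = 0 \<and> (\<forall>\<^sub>F x in nhds 0. Y x = x + h (Y x))"
proof -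
  have "\<forall>\<^sub>F \<rho> in at_right 0. \<forall>b\<in>Basis. \<exists>c. norm (c - (h 0 \<bullet> b) *\<^sub>R 1) \<le> 1 \<and>
      (\<forall>x\<in>ball 0 \<rho>. h x \<bullet> b = psubst c (crd \<rho> (x - 0)))"
    using h by (intro eventually_ball_finite ballI real_analytic_at_expansion) (auto simp: analytic_map_at_def)
  moreover have "\<forall>\<^sub>F \<rho> in at_right 0. \<rho> > (0::real)" by (simp add: eventually_at_right_less)
  ultimately have "\<forall>\<^sub>F \<rho> in at_right 0. \<rho> > 0 \<and> (\<forall>b\<in>Basis. \<exists>c. \<forall>x\<in>ball 0 \<rho>. h x \<bullet> b = psubst c (crd \<rho> x))"
    by eventually_elim auto
  from eventually_happens'[OF _ this]
  obtain R where R: "R > 0" and ex: "\<forall>b\<in>Basis. \<exists>c. \<forall>x\<in>ball 0 R. h x \<bullet> b = psubst c (crd R x)"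
    by auto
  have "\<exists>d. (\<forall>M. size M \<le> 1 \<longrightarrow> coeff d M = 0) \<and> (\<forall>x\<in>ball 0 R. h x \<bullet> b = psubst d (crd R x))"
    if b: "b \<in> Basis" for b
  proof -
    obtain c where c: "\<And>x. x \<in> ball 0 R \<Longrightarrow> h x \<bullet> b = psubst c (crd R x)" using ex b by blast
    have c0: "coeff c {#} = 0" using c[of 0] R h0 by (simp add: psubst_crd_0)
    have "((\<lambda>x. h x \<bullet> b) has_derivative (\<lambda>h. \<Sum>b\<in>Basis. coeff c {#b#} * ((h \<bullet> b) / R))) (at 0)"
      by (rule psubst_has_derivative[OF R]) (simp add: c)
    moreover have "((\<lambda>x. h x \<bullet> b) has_derivative (\<lambda>_. 0 \<bullet> b)) (at 0)" by (rule has_derivative_inner_left[OF h'])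
    ultimately have lin: "(\<lambda>h. \<Sum>b\<in>Basis. coeff c {#b#} * ((h \<bullet> b) / R)) = (\<lambda>_. 0 \<bullet> b)"
      by (rule has_derivative_unique)
    have "coeff c {#b'#} = 0" if "b' \<in> Basis" for b'
    proof -
      have "(\<Sum>b\<in>Basis. coeff c {#b#} * ((b' \<bullet> b) / R)) = (\<Sum>b\<in>Basis. if b = b' then coeff c {#b#} / R else 0)"
        by (rule sum.cong) (use that in \<open>auto simp: inner_Basis\<close>)
      then show ?thesis using fun_cong[OF lin, of b'] that R by simp
    qed
    from psubst_crd_truncate[OF c0 this] obtain d where
      "\<And>M. size M \<le> 1 \<Longrightarrow> coeff d M = 0" "\<And>R x. psubst d (crd R x) = psubst c (crd R x)" by blast
    then show ?thesis using c by (intro exI[of _ d]) auto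
  qed
  then obtain C where C0: "\<And>b M. b \<in> Basis \<Longrightarrow> size M \<le> 1 \<Longrightarrow> coeff (C b) M = 0"
    and C: "\<And>b x. b \<in> Basis \<Longrightarrow> x \<in> ball 0 R \<Longrightarrow> h x \<bullet> b = psubst (C b) (crd R x)"
    by metis
  define K where "K = 1 + (\<Sum>b\<in>Basis. norm (C b))"
  have K: "norm (C b) \<le> K" if "b \<in> Basis" for b
    unfolding K_def using member_le_sum[OF that, of "\<lambda>b. norm (C b)"] by simp
  have K1: "K \<ge> 1" by (simp add: K_def sum_nonneg)
  \<comment> \<open>The first entry makes the Lipschitz constant \<open>2 * t * K\<close> at most
    \<open>R / 2\<close>; the second keeps \<open>Y x\<close> inside the ball of radius
    \<open>R\<close>.\<close>
  define t where "t = min (R / (4 * K)) (1 / (2 * DIM('e)))"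
  have t1: "t \<le> R / (4 * K)" and t2: "t \<le> 1 / (2 * DIM('e))" by (simp_all add: t_def)
  have "1 / (2 * real DIM('e)) \<le> 1 / 2" by (simp add: Suc_leI)
  then have t: "t > 0" "t \<le> 1 / 2" "4 * t * K \<le> R" "t * DIM('e) \<le> 1 / 2"
    using R K1 t1 t2 by (simp add: t_def, linarith, simp_all add: field_simps)
  \<comment> \<open>Stated for every commutative Banach algebra: used in \<open>pws\<close> for the
    contraction and in the reals for \<open>Y 0 = 0\<close>.\<close>
  have bound: "norm (psubst (C b) y - psubst (C b) z) \<le> R * (e / 2)"
    if b: "b \<in> Basis" and y: "\<And>b. norm (y b) \<le> t" and z: "\<And>b. norm (z b) \<le> t" and e: "\<And>b. norm (y b - z b) \<le> e"
    for b e and y z :: "'e \<Rightarrow> 'b::{real_normed_algebra_1,comm_ring_1,banach}"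
  proof -
    have e0: "e \<ge> 0" using order.trans[OF norm_ge_zero e] .
    have "norm (psubst (C b) y - psubst (C b) z) \<le> 2 * t * e * norm (C b)"
      by (rule norm_psubst_diff_le) (use C0[OF b] t y z e in auto)
    also have "\<dots> \<le> 2 * t * e * K" using t e0 K[OF b] by (intro mult_left_mono) auto
    also have "\<dots> = (4 * t * K) * (e / 2)" by simp
    also have "\<dots> \<le> R * (e / 2)" using t e0 by (intro mult_right_mono) auto
    finally show ?thesis .
  qed
  have C_zero: "psubst (C b) (\<lambda>_. 0 :: 'b::{real_normed_algebra_1,comm_ring_1,banach}) = 0" if "b \<in> Basis" for b
    using norm_psubst_minus_const_le[of "\<lambda>_. 0 :: 'b" 0 "C b"] C0[OF that, of "{#}"] by simp
  define \<Phi> where "\<Phi> y b = (if b \<in> Basis then (t / 2) *\<^sub>R pmonom {#b#} + (1 / R) *\<^sub>R psubst (C b) y else 0)"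
    for y :: "'e \<Rightarrow> 'e pws" and b
  have "\<exists>L. (\<forall>b. norm (L b) \<le> t) \<and> \<Phi> L = L"
  proof (rule banach_fixed_family[OF finite_Basis])
    show "\<Phi> y b = 0" if "b \<notin> Basis" for y b using that by (simp add: \<Phi>_def)
    show "norm (\<Phi> y b - \<Phi> z b) \<le> e / 2" if "\<And>b. norm (y b) \<le> t" "\<And>b. norm (z b) \<le> t" "\<And>b. norm (y b - z b) \<le> e" for y z e b
    proof (cases "b \<in> Basis")
      case True
      have "\<Phi> y b - \<Phi> z b = (1 / R) *\<^sub>R (psubst (C b) y - psubst (C b) z)"
        using True by (simp add: \<Phi>_def scaleR_diff_right)
      then have "norm (\<Phi> y b - \<Phi> z b) = norm (psubst (C b) y - psubst (C b) z) / R"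
        using R by (simp only: norm_scaleR) simp
      also have "\<dots> \<le> R * (e / 2) / R" using bound[of b y z e, OF True that] R by (intro divide_right_mono) auto
      finally show ?thesis using R by simp
    qed (use order.trans[OF norm_ge_zero that(3)] in \<open>simp add: \<Phi>_def\<close>)
    show "norm (\<Phi> y b) \<le> t" if y: "\<And>b. norm (y b) \<le> t" for y b
    proof (cases "b \<in> Basis")
      case True
      have "norm (psubst (C b) y) \<le> R * (t / 2)"
        using bound[of b y "\<lambda>_. 0" t, OF True y] y t by (simp add: C_zero[OF True])
      then have "norm ((1 / R) *\<^sub>R psubst (C b) y) \<le> t / 2" using R by (simp add: field_simps)
      moreover have "norm ((t / 2) *\<^sub>R pmonom {#b#}) \<le> t / 2" using t by simp
      ultimately have "norm ((t / 2) *\<^sub>R pmonom {#b#} + (1 / R) *\<^sub>R psubst (C b) y) \<le> t / 2 + t / 2"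
        using norm_triangle_mono by blast
      then show ?thesis using True by (simp add: \<Phi>_def)
    qed (use t in \<open>simp add: \<Phi>_def\<close>)
  qed (use t in simp)
  then obtain L where L: "\<And>b. norm (L b) \<le> t" and fix_L: "\<Phi> L = L" by blast
  have L1: "norm (L b) \<le> 1" for b using L[of b] t by linarith
  \<comment> \<open>With this radius the inhomogeneous term
    \<open>R * (t / 2 * crd \<sigma> x b)\<close> is exactly \<open>x \<bullet> b\<close>.\<close>
  define \<sigma> where "\<sigma> = R * t / 2"
  have \<sigma>: "\<sigma> > 0" using R t by (simp add: \<sigma>_def)
  define Y where "Y x = (\<Sum>b\<in>Basis. (R * psubst (L b) (crd \<sigma> x)) *\<^sub>R b)" for x :: 'e
  have Y: "Y x \<bullet> b = R * psubst (L b) (crd \<sigma> x)" if "b \<in> Basis" for x b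
    using that by (simp add: Y_def inner_sum_left_Basis)
  have crd_Y: "crd R (Y x) b = psubst (L b) (crd \<sigma> x)" for x b
  proof (cases "b \<in> Basis")
    case False
    then have "L b = 0" using fun_cong[OF fix_L, of b] by (simp add: \<Phi>_def)
    then show ?thesis using False by (simp add: crd_def psubst_def)
  qed (use R Y in \<open>simp add: crd_def\<close>)
  have ball: "x \<in> ball 0 \<sigma> \<Longrightarrow> norm (crd \<sigma> x b) \<le> 1" for x b using norm_crd_le_1[of x 0 \<sigma> b] by simp
  have crd_Y_le: "\<bar>crd R (Y x) b\<bar> \<le> t" if "x \<in> ball 0 \<sigma>" for x b
    using order.trans[OF norm_psubst_le[of "crd \<sigma> x", OF ball[OF that]] L] by (simp add: crd_Y)
  have Y_ball: "Y x \<in> ball 0 R" if x: "x \<in> ball 0 \<sigma>" for x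
  proof -
    have "\<bar>Y x \<bullet> b\<bar> \<le> R * t" if "b \<in> Basis" for b
      using crd_Y_le[OF x, of b] that R by (simp add: crd_def field_simps)
    then have "norm (Y x) \<le> R * (t * DIM('e))"
      using norm_le_l1[of "Y x"] sum_bounded_above[of Basis "\<lambda>b. \<bar>Y x \<bullet> b\<bar>" "R * t"] by (simp add: algebra_simps)
    also have "\<dots> \<le> R * (1 / 2)" using t R by (intro mult_left_mono) auto
    finally show ?thesis using R by simp
  qed
  have eq: "Y x = x + h (Y x)" if x: "x \<in> ball 0 \<sigma>" for x
  proof (rule euclidean_eqI)
    fix b :: 'e assume b: "b \<in> Basis"
    note simps = psubst_crd[of x 0 \<sigma>, simplified, OF x[simplified]]
    note hY = C[OF b Y_ball[OF x]]
    have "psubst (L b) (crd \<sigma> x) = psubst (\<Phi> L b) (crd \<sigma> x)" by (simp add: fix_L)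
    also have "\<dots> = t / 2 * crd \<sigma> x b + psubst (psubst (C b) L) (crd \<sigma> x) / R"
      using b by (simp add: \<Phi>_def simps)
    also have "psubst (psubst (C b) L) (crd \<sigma> x) = psubst (C b) (crd R (Y x))"
      using psubst_psubst[of "crd \<sigma> x", OF ball[OF x] L1, of "C b"] crd_Y[of x] by presburger
    finally have "Y x \<bullet> b = R * (t / 2 * crd \<sigma> x b) + h (Y x) \<bullet> b" using R by (simp add: Y[OF b] hY field_simps)
    also have "R * (t / 2 * crd \<sigma> x b) = x \<bullet> b" using b R t by (simp add: crd_def \<sigma>_def)
    finally show "Y x \<bullet> b = (x + h (Y x)) \<bullet> b" by (simp add: inner_add_left)
  qed
  have "analytic_map_at Y 0"
    unfolding analytic_map_at_def real_analytic_at_iff_psubst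
  proof (intro ballI exI conjI)
    fix b x :: 'e assume b: "b \<in> Basis" and x: "x \<in> ball 0 \<sigma>"
    show "Y x \<bullet> b = psubst (R *\<^sub>R L b) (crd \<sigma> (x - 0))"
      using psubst_scaleR[of "crd \<sigma> x", OF ball[OF x], of R "L b"] by (simp add: Y[OF b])
  qed (rule \<sigma>)
  moreover have "Y 0 = 0"
  proof -
    \<comment> \<open>\<open>Y 0\<close> is a fixed point of \<open>h\<close>, so the contraction
      estimate halves the bound on its coordinates as often as desired.\<close>
    have "\<bar>crd R (Y 0) b\<bar> \<le> t * (1 / 2) ^ n" for b n
    proof (induction n arbitrary: b)
      case 0
      then show ?case using crd_Y_le[of 0 b] \<sigma> by simp
    next
      case (Suc n)
      show ?case
      proof (cases "b \<in> Basis")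
        case True
        have "Y 0 = h (Y 0)" "h (Y 0) \<bullet> b = psubst (C b) (crd R (Y 0))"
          using eq[of 0] \<sigma> C[OF True Y_ball[of 0]] by auto
        then have "Y 0 \<bullet> b = psubst (C b) (crd R (Y 0))" by metis
        moreover have "\<bar>psubst (C b) (crd R (Y 0))\<bar> \<le> R * (t * (1 / 2) ^ n / 2)"
          using bound[of b "crd R (Y 0)" "\<lambda>_. 0" "t * (1 / 2) ^ n", OF True] crd_Y_le[of 0] Suc \<sigma> t
          by (simp add: C_zero[OF True])
        ultimately show ?thesis using True R by (simp add: crd_def field_simps)
      qed (use t in \<open>simp add: crd_def\<close>)
    qed
    moreover have "(\<lambda>n. t * (1 / 2) ^ n) \<longlonglongrightarrow> 0"
      by (intro tendsto_mult_right_zero LIMSEQ_power_zero) simp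
    ultimately have crd_0: "\<bar>crd R (Y 0) b\<bar> \<le> 0" for b using LIMSEQ_le_const by blast
    have inner_0: "Y 0 \<bullet> b = 0" if "b \<in> Basis" for b
      using abs_le_zero_iff[THEN iffD1, OF crd_0[of b]] that R by (simp add: crd_def)
    show ?thesis by (rule euclidean_eqI) (simp add: inner_0)
  qed
  moreover have "\<forall>\<^sub>F x in nhds 0. Y x = x + h (Y x)"
    unfolding eventually_nhds using eq \<sigma> by (intro exI[of _ "ball 0 \<sigma>"]) auto
  ultimately show ?thesis by blast
qed

text \<open>With \<open>E\<close> inverse to the derivative,
  \<open>h y = y - E (G (a + y) - G a)\<close> has zero derivative at 0, and
  \<open>Y = x + h Y\<close> means \<open>E (G (a + Y) - G a) = x\<close>. A one-sided inverse near
  \<open>G a\<close> is what the slice requires.\<close>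

theorem real_analytic_right_inverse:
  fixes G :: "'e::euclidean_space \<Rightarrow> 'e"
  assumes G: "analytic_map_at G a" and D: "(G has_derivative D) (at a)" and inj: "inj D"
  shows "\<exists>S. analytic_map_at S (G a) \<and> S (G a) = a \<and> (\<forall>\<^sub>F y in nhds (G a). G (S y) = y)"
proof -
  have linD: "linear D" using D by (rule has_derivative_linear)
  obtain E where linE: "linear E" and ED: "\<And>x. E (D x) = x" and DE: "\<And>x. D (E x) = x"
    using linear_injective_isomorphism[OF linD inj] by blast
  define h where "h y = y - E (G (a + y) - G a)" for y
  have shift: "analytic_map_at (\<lambda>y. a + y) 0" "analytic_map_at (\<lambda>y. y) x" for x :: 'e
    by (intro analytic_map_at_add analytic_map_at_const analytic_map_at_linear linear_id[unfolded id_def])+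
  have "analytic_map_at (\<lambda>y. G (a + y) - G a) 0"
    using analytic_map_at_compose[OF shift(1), of G] G
    by (intro analytic_map_at_diff analytic_map_at_const) auto
  from analytic_map_at_compose[OF this analytic_map_at_linear[OF linE]]
  have "analytic_map_at h 0" unfolding h_def by (intro analytic_map_at_diff shift)
  moreover have "h 0 = 0" by (simp add: h_def linear_0[OF linE])
  moreover have "(h has_derivative (\<lambda>_. 0)) (at 0)"
  proof -
    have "(G has_derivative D) (at (a + 0))" using D by simp
    from has_derivative_compose[OF has_derivative_add[OF has_derivative_const has_derivative_ident] this]
    have "((\<lambda>y. G (a + y)) has_derivative D) (at 0)" by simp
    then have "((\<lambda>y. E (G (a + y) - G a)) has_derivative (\<lambda>y. E (D y - 0))) (at 0)"
      by (intro bounded_linear.has_derivative[OF linear_conv_bounded_linear[THEN iffD1, OF linE]]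
          has_derivative_diff has_derivative_const)
    then have "(h has_derivative (\<lambda>y. y - E (D y - 0))) (at 0)"
      unfolding h_def by (intro has_derivative_diff has_derivative_ident)
    then show ?thesis by (simp add: ED)
  qed
  ultimately obtain Y where Y: "analytic_map_at Y 0" "Y 0 = 0" and eq: "\<forall>\<^sub>F x in nhds 0. Y x = x + h (Y x)"
    using real_analytic_fixed_point by blast
  define S where "S y = a + Y (E (y - G a))" for y
  have E: "analytic_map_at (\<lambda>y. E (y - G a)) (G a)"
    by (rule analytic_map_at_compose[OF _ analytic_map_at_linear[OF linE]])
      (intro analytic_map_at_diff shift analytic_map_at_const)
  have "analytic_map_at S (G a)"
    unfolding S_def using analytic_map_at_compose[OF E, of Y] Y linear_0[OF linE]
    by (intro analytic_map_at_add analytic_map_at_const) auto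
  moreover have "S (G a) = a" by (simp add: S_def linear_0[OF linE] Y)
  moreover have "\<forall>\<^sub>F y in nhds (G a). G (S y) = y"
  proof -
    have "filterlim (\<lambda>y. E (y - G a)) (nhds 0) (nhds (G a))"
      using analytic_map_at_tendsto[OF E] linear_0[OF linE] by simp
    from eventually_compose_filterlim[OF eq this] show ?thesis
    proof eventually_elim
      case (elim y)
      then have "E (G (S y) - G a) = E (y - G a)" by (simp add: h_def S_def)
      then have "D (E (G (S y) - G a)) = D (E (y - G a))" by simp
      then show ?case by (simp add: DE)
    qed
  qed
  ultimately show ?thesis by blast
qed

section \<open>Conformal boosts of the sphere and balanced configurations\<close>

lemma real_analytic_at_inner:
  fixes f g :: "'e::euclidean_space \<Rightarrow> 'f::euclidean_space"
  assumes "analytic_map_at f a" "analytic_map_at g a"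
  shows "real_analytic_at (\<lambda>x. f x \<bullet> g x) a"
proof -
  have "real_analytic_at (\<lambda>x. \<Sum>b\<in>Basis. (f x \<bullet> b) * (g x \<bullet> b)) a"
    using assms by (intro real_analytic_at_sum real_analytic_at_mult) (auto simp: analytic_map_at_def)
  moreover have "(\<lambda>x. f x \<bullet> g x) = (\<lambda>x. \<Sum>b\<in>Basis. (f x \<bullet> b) * (g x \<bullet> b))"
    by (rule ext, rule euclidean_inner)
  ultimately show ?thesis by (simp only:)
qed

lemma analytic_map_at_scaleR:
  "real_analytic_at s a \<Longrightarrow> analytic_map_at f a \<Longrightarrow> analytic_map_at (\<lambda>x. s x *\<^sub>R f x) a"
  by (simp add: analytic_map_at_def real_analytic_at_mult)

lemma analytic_map_at_sum:
  "(\<And>i. i \<in> I \<Longrightarrow> analytic_map_at (f i) a) \<Longrightarrow> analytic_map_at (\<lambda>x. \<Sum>i\<in>I. f i x) a"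
  by (simp add: analytic_map_at_def inner_sum_left real_analytic_at_sum)

lemma analytic_map_at_Pair:
  "analytic_map_at f a \<Longrightarrow> analytic_map_at g a \<Longrightarrow> analytic_map_at (\<lambda>x. (f x, g x)) a"
  by (auto simp: analytic_map_at_def Basis_prod_def)

lemma analytic_map_at_vec_lambda:
  fixes f :: "'e::euclidean_space \<Rightarrow> 'n::finite \<Rightarrow> 'f::euclidean_space"
  assumes "\<And>i. analytic_map_at (\<lambda>x. f x i) a"
  shows "analytic_map_at (\<lambda>x. \<chi> i. f x i) a"
  using assms by (auto simp: analytic_map_at_def Basis_vec_def inner_axis)

lemma analytic_map_at_vec_nth: "analytic_map_at f a \<Longrightarrow> analytic_map_at (\<lambda>x. f x $ i) a"
  by (rule analytic_map_at_compose[OF _ analytic_map_at_linear])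
    (auto intro: bounded_linear.linear bounded_linear_vec_nth)

section \<open>Boundary values of Moebius maps of the ball\<close>

abbreviation bden :: "'a::real_inner \<Rightarrow> 'a \<Rightarrow> real" where
  "bden w u \<equiv> 1 - 2 * (u \<bullet> w) + w \<bullet> w"

text \<open>On the unit sphere this is the boundary value of the Moebius map of the ball that sends
  \<open>w\<close> to 0. The denominator is \<open>(norm (u - w))\<^sup>2\<close> there, written as
  an affine function of \<open>u\<close> to match the multipliers of matrices.\<close>

definition boost :: "'a::real_inner \<Rightarrow> 'a \<Rightarrow> 'a" where
  "boost w u = ((1 - w \<bullet> w) / bden w u) *\<^sub>R (u - w) - w"

lemma boost_0 [simp]: "boost 0 u = u"
  by (simp add: boost_def)

lemma bden_eq:
  assumes "norm u = 1"
  shows "bden w u = (norm (u - w))\<^sup>2"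
  using assms by (simp add: power2_norm_eq_inner inner_diff_left inner_diff_right inner_commute norm_eq_1)

lemma bden_pos:
  assumes "norm u = 1" "norm w < 1"
  shows "bden w u > 0"
  using assms by (auto simp: bden_eq)

lemma inner_self_less_1: "norm w < 1 \<Longrightarrow> w \<bullet> w < 1"
  by (metis abs_norm_cancel abs_square_less_1 power2_norm_eq_inner)

lemma norm_boost:
  assumes u: "norm u = 1" and w: "norm w < 1"
  shows "norm (boost w u) = 1"
proof -
  let ?D = "bden w u"
  define k where "k = (1 - w \<bullet> w) / ?D"
  have D: "?D > 0" by (rule bden_pos[OF u w])
  have kD: "k * ?D = 1 - w \<bullet> w" using D by (simp add: k_def)
  have "boost w u \<bullet> boost w u = k * (k * ?D) - 2 * k * (u \<bullet> w - w \<bullet> w) + w \<bullet> w"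
    using u unfolding boost_def k_def[symmetric]
    by (simp add: algebra_simps inner_commute norm_eq_1)
  also have "\<dots> = k * (1 - w \<bullet> w) - 2 * k * (u \<bullet> w - w \<bullet> w) + w \<bullet> w" by (simp only: kD)
  also have "\<dots> = k * ?D + w \<bullet> w" by (simp add: algebra_simps)
  also have "\<dots> = 1" unfolding kD by simp
  finally show ?thesis by (simp add: norm_eq_1)
qed

lemma boost_plus: "boost w u + w = ((1 - w \<bullet> w) / bden w u) *\<^sub>R (u - w)"
  by (simp add: boost_def)

text \<open>The left side is the denominator of the boost by \<open>- w\<close> at
  \<open>boost w u\<close>. Hence the denominators of a boost and its inverse multiply to the
  constant \<open>(1 - w \<bullet> w)\<^sup>2\<close>.\<close>

lemma norm_boost_plus:
  assumes u: "norm u = 1" and w: "norm w < 1"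
  shows "(norm (boost w u + w))\<^sup>2 = (1 - w \<bullet> w)\<^sup>2 / (norm (u - w))\<^sup>2"
  using bden_pos[OF u w]
  by (simp add: boost_plus bden_eq[OF u] power_mult_distrib power2_eq_square)

lemma boost_minus:
  assumes u: "norm u = 1" and w: "norm w < 1"
  shows "boost (- w) (boost w u) = u"
proof -
  have D: "bden (- w) (boost w u) = (1 - w \<bullet> w)\<^sup>2 / (norm (u - w))\<^sup>2"
    using bden_eq[OF norm_boost[OF u w], of "- w"] norm_boost_plus[OF u w] by simp
  have "norm (u - w) \<noteq> 0" "1 - w \<bullet> w \<noteq> 0" using u w inner_self_less_1[OF w] by auto
  then show ?thesis
    unfolding boost_def[of "- w"] D
    by (simp add: boost_plus bden_eq[OF u] power2_eq_square)
qed

lemma boost_orthogonal: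
  "orthogonal_transformation Q \<Longrightarrow> boost (Q w) (Q u) = Q (boost w u)"
  by (simp add: boost_def orthogonal_transformation_def linear_diff linear_cmul)

lemma inner_boost:
  assumes u: "norm u = 1" and w: "norm w < 1"
  shows "w \<bullet> (boost w u - u) = - 2 * ((w \<bullet> w - (w \<bullet> u)\<^sup>2) / bden w u)"
proof -
  define W X where "W = w \<bullet> w" and "X = w \<bullet> u"
  define D where "D = 1 - 2 * X + W"
  define k where "k = (1 - W) / D"
  have D: "D > 0" using bden_pos[OF u w] by (simp add: D_def W_def X_def inner_commute)
  have kD: "k * D = 1 - W" using D by (simp add: k_def)
  have "w \<bullet> (boost w u - u) = k * (X - W) - W - X"
    by (simp add: boost_def inner_diff_right k_def D_def W_def X_def inner_commute)
  moreover have "(k * (X - W) - W - X) * D = (k * D) * (X - W) - (W + X) * D" by (simp add: algebra_simps)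
  then have "(k * (X - W) - W - X) * D = - 2 * (W - X\<^sup>2)"
    unfolding kD by (simp add: D_def algebra_simps power2_eq_square)
  then have "k * (X - W) - W - X = - 2 * ((W - X\<^sup>2) / D)" using D by (simp add: field_simps)
  ultimately show ?thesis by (simp add: D_def W_def X_def inner_commute)
qed

lemma analytic_map_at_boost:
  fixes f g :: "'e::euclidean_space \<Rightarrow> 'f::euclidean_space"
  assumes "analytic_map_at f a" "analytic_map_at g a" "1 - 2 * (g a \<bullet> f a) + f a \<bullet> f a \<noteq> 0"
  shows "analytic_map_at (\<lambda>x. boost (f x) (g x)) a"
  unfolding boost_def divide_inverse using assms
  by (intro analytic_map_at_diff analytic_map_at_scaleR real_analytic_at_mult
      real_analytic_at_inverse real_analytic_at_diff real_analytic_at_add real_analytic_at_inner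
      real_analytic_at_const) auto

section \<open>Balanced configurations: uniqueness, local slice and existence\<close>

definition generic_weights :: "('n::finite \<Rightarrow> real) \<Rightarrow> bool" where
  "generic_weights r \<longleftrightarrow> (\<forall>\<epsilon>::'n \<Rightarrow> real. (\<forall>i. \<epsilon> i = 1 \<or> \<epsilon> i = -1) \<longrightarrow> (\<Sum>i\<in>UNIV. \<epsilon> i * r i) \<noteq> 0)"

text \<open>Otherwise each \<open>w \<bullet> u i\<close> is plus or minus \<open>norm w\<close>,
  and pairing the balance condition with \<open>w\<close> gives a signed sum of the weights equal to
  0.\<close>

lemma generic_not_collinear:
  fixes r :: "'n::finite \<Rightarrow> real"
  assumes r: "generic_weights r" and bal: "(\<Sum>i\<in>UNIV. r i *\<^sub>R u i) = 0" and col: "\<And>i. (w \<bullet> u i)\<^sup>2 = w \<bullet> w"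
  shows "w = 0"
proof (rule ccontr)
  assume "w \<noteq> 0"
  then have pos: "norm w > 0" by simp
  define \<epsilon> where "\<epsilon> i = (w \<bullet> u i) / norm w" for i
  have "(\<epsilon> i)\<^sup>2 = 1" for i using pos by (simp add: \<epsilon>_def power_divide col power2_norm_eq_inner)
  then have "\<forall>i. \<epsilon> i = 1 \<or> \<epsilon> i = -1" by (simp add: power2_eq_1_iff)
  then have "(\<Sum>i\<in>UNIV. \<epsilon> i * r i) \<noteq> 0" using r unfolding generic_weights_def by blast
  moreover have "(\<Sum>i\<in>UNIV. \<epsilon> i * r i) = (w \<bullet> (\<Sum>i\<in>UNIV. r i *\<^sub>R u i)) / norm w"
    by (simp add: \<epsilon>_def inner_sum_right sum_divide_distrib mult.commute)
  ultimately show False by (simp add: bal)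
qed

lemma inner_square_le: "norm u = 1 \<Longrightarrow> (w \<bullet> u)\<^sup>2 \<le> w \<bullet> w"
  using Cauchy_Schwarz_ineq[of w u] by (simp add: norm_eq_1)

text \<open>Cauchy-Schwarz makes every summand nonnegative. The factors \<open>c\<close> cover both
  uses: the reciprocal denominators of a finite boost and a constant for the derivative at
  0.\<close>

lemma collinearI:
  fixes r :: "'n::finite \<Rightarrow> real"
  assumes pos: "\<And>i. r i > 0" and c: "\<And>i. c i > 0" and u: "\<And>i. norm (u i) = 1"
    and sum0: "(\<Sum>i\<in>UNIV. r i * (c i * (w \<bullet> w - (w \<bullet> u i)\<^sup>2))) = 0"
  shows "(w \<bullet> u i)\<^sup>2 = w \<bullet> w"
proof -
  have "r i * (c i * (w \<bullet> w - (w \<bullet> u i)\<^sup>2)) \<ge> 0" for i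
    using less_imp_le[OF pos[of i]] less_imp_le[OF c[of i]] inner_square_le[OF u, of w] by simp
  then have "r i * (c i * (w \<bullet> w - (w \<bullet> u i)\<^sup>2)) = 0" using sum0 by (simp add: sum_nonneg_eq_0_iff)
  then show ?thesis using pos[of i] c[of i] by simp
qed

theorem balanced_boost_unique:
  fixes r :: "'n::finite \<Rightarrow> real"
  assumes pos: "\<And>i. r i > 0" and gen: "generic_weights r"
    and u: "\<And>i. norm (u i) = 1" and w: "norm w < 1"
    and bal: "(\<Sum>i\<in>UNIV. r i *\<^sub>R u i) = 0" and bal': "(\<Sum>i\<in>UNIV. r i *\<^sub>R boost w (u i)) = 0"
  shows "w = 0"
proof (rule generic_not_collinear[OF gen bal])
  define c where "c i = 1 / bden w (u i)" for i
  have "(\<Sum>i\<in>UNIV. r i * (w \<bullet> (boost w (u i) - u i))) =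
      w \<bullet> (\<Sum>i\<in>UNIV. r i *\<^sub>R boost w (u i)) - w \<bullet> (\<Sum>i\<in>UNIV. r i *\<^sub>R u i)"
    by (simp add: inner_sum_right inner_diff_right right_diff_distrib sum_subtractf)
  then have "(\<Sum>i\<in>UNIV. r i * (w \<bullet> (boost w (u i) - u i))) = 0" by (simp add: bal bal')
  moreover have "r i * (w \<bullet> (boost w (u i) - u i)) = - 2 * (r i * (c i * (w \<bullet> w - (w \<bullet> u i)\<^sup>2)))" for i
    unfolding inner_boost[OF u w] c_def times_divide_eq_left mult_1 by (simp only: mult.left_commute)
  ultimately have "(\<Sum>i\<in>UNIV. r i * (c i * (w \<bullet> w - (w \<bullet> u i)\<^sup>2))) = 0"
    by (simp add: sum_negf flip: sum_distrib_left)
  then show "(w \<bullet> u i)\<^sup>2 = w \<bullet> w" for i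
    by (intro collinearI[of r c u w]) (use pos u bden_pos[OF u w] in \<open>auto simp: c_def\<close>)
qed

text \<open>Keeping \<open>p\<close> as the first component of \<open>G\<close> makes the problem
  square, so the right inverse theorem applies; \<open>\<omega> p\<close> is the second component of
  the preimage of \<open>(p, 0)\<close>.\<close>

theorem balancing_slice:
  fixes u :: "'a::euclidean_space ^ 'n::finite"
  assumes pos: "\<And>i. r i > 0" and gen: "generic_weights r"
    and u: "\<And>i. norm (u $ i) = 1" and bal: "(\<Sum>i\<in>UNIV. r i *\<^sub>R (u $ i)) = 0"
  shows "\<exists>\<omega>. analytic_map_at \<omega> u \<and> \<omega> u = 0 \<and> (\<forall>\<^sub>F p in nhds u. (\<Sum>i\<in>UNIV. r i *\<^sub>R boost (\<omega> p) (p $ i)) = 0)"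
proof -
  define G where "G x = (fst x, \<Sum>i\<in>UNIV. r i *\<^sub>R boost (snd x) (fst x $ i))" for x :: "('a ^ 'n) \<times> 'a"
  have Gu: "G (u, 0) = (u, 0)" by (simp add: G_def bal)
  have lin: "analytic_map_at fst x" "analytic_map_at snd x" for x :: "('a ^ 'n) \<times> 'a"
    by (auto intro!: analytic_map_at_linear bounded_linear.linear bounded_linear_fst bounded_linear_snd)
  have "analytic_map_at G (u, 0)"
    unfolding G_def by (intro analytic_map_at_Pair analytic_map_at_sum analytic_map_at_scaleR
        real_analytic_at_const analytic_map_at_boost analytic_map_at_vec_nth lin) auto
  \<comment> \<open>At \<open>w = 0\<close> the boost varies with \<open>w\<close> by
    \<open>(2 * (u \<bullet> w)) *\<^sub>R u - 2 *\<^sub>R w\<close> and with the point by the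
    identity.\<close>
  moreover define D where "D x = (fst x, \<Sum>i\<in>UNIV. r i *\<^sub>R ((2 * (u $ i \<bullet> snd x)) *\<^sub>R u $ i + fst x $ i - 2 *\<^sub>R snd x))"
    for x :: "('a ^ 'n) \<times> 'a"
  have "(G has_derivative D) (at (u, 0))"
    unfolding G_def D_def
  proof (intro has_derivative_Pair has_derivative_fst has_derivative_ident has_derivative_sum has_derivative_scaleR_right)
    fix i
    have nth: "((\<lambda>x. fst x $ i) has_derivative (\<lambda>x. fst x $ i)) (at (u, 0 :: 'a))"
      by (intro bounded_linear.has_derivative[OF bounded_linear_vec_nth] has_derivative_fst has_derivative_ident)
    show "((\<lambda>x. boost (snd x) (fst x $ i)) has_derivative
        (\<lambda>x. (2 * (u $ i \<bullet> snd x)) *\<^sub>R u $ i + fst x $ i - 2 *\<^sub>R snd x)) (at (u, 0))"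
      unfolding boost_def
      by (rule has_derivative_eq_rhs, (rule derivative_intros nth | simp)+)
        (auto simp: fun_eq_iff scaleR_2)
  qed
  moreover have "inj D"
  proof -
    have linD: "linear D" using \<open>(G has_derivative D) (at (u, 0))\<close> by (rule has_derivative_linear)
    have "x = 0" if "D x = 0" for x
    proof -
      define w where "w = snd x"
      have "fst x = 0" using that by (simp add: D_def zero_prod_def)
      then have x: "x = (0, w)" by (simp add: prod_eq_iff w_def)
      \<comment> \<open>Pairing the kernel equation with \<open>w\<close> itself leaves a sum of
        Cauchy-Schwarz defects.\<close>
      have "0 = w \<bullet> (\<Sum>i\<in>UNIV. r i *\<^sub>R ((2 * (u $ i \<bullet> w)) *\<^sub>R u $ i - 2 *\<^sub>R w))"
        using that by (simp add: D_def x zero_prod_def)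
      also have "\<dots> = (\<Sum>i\<in>UNIV. r i * (- 2 * (w \<bullet> w - (w \<bullet> u $ i)\<^sup>2)))"
        by (simp add: inner_sum_right inner_diff_right power2_eq_square inner_commute algebra_simps)
      also have "\<dots> = - (\<Sum>i\<in>UNIV. r i * (2 * (w \<bullet> w - (w \<bullet> u $ i)\<^sup>2)))"
        by (simp only: sum_negf[symmetric] mult_minus_left mult_minus_right)
      finally have "(\<Sum>i\<in>UNIV. r i * (2 * (w \<bullet> w - (w \<bullet> u $ i)\<^sup>2))) = 0"
        by simp
      then have "(w \<bullet> u $ i)\<^sup>2 = w \<bullet> w" for i
        using collinearI[of r "\<lambda>_. 2" "\<lambda>i. u $ i" w i] pos u by simp
      then have "w = 0" by (rule generic_not_collinear[OF gen bal])
      then show ?thesis by (simp add: x zero_prod_def)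
    qed
    then show ?thesis using linear_injective_0[OF linD] by blast
  qed
  ultimately obtain S where S: "analytic_map_at S (u, 0)" "S (u, 0) = (u, 0)"
    and ev: "\<forall>\<^sub>F y in nhds (u, 0). G (S y) = y"
    using real_analytic_right_inverse[of G "(u, 0)" D] unfolding Gu by blast
  define \<omega> where "\<omega> p = snd (S (p, 0))" for p
  have emb: "analytic_map_at (\<lambda>p. (p, 0 :: 'a)) u"
    by (intro analytic_map_at_Pair analytic_map_at_const analytic_map_at_linear linear_id[unfolded id_def])
  have "analytic_map_at \<omega> u"
    unfolding \<omega>_def using analytic_map_at_compose[OF analytic_map_at_compose[OF emb, of S] lin(2)] S by simp
  moreover have "\<omega> u = 0" by (simp add: \<omega>_def S)
  moreover have "\<forall>\<^sub>F p in nhds u. (\<Sum>i\<in>UNIV. r i *\<^sub>R boost (\<omega> p) (p $ i)) = 0"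
  proof -
    from eventually_compose_filterlim[OF ev analytic_map_at_tendsto[OF emb]] show ?thesis
      by eventually_elim (auto simp: G_def \<omega>_def)
  qed
  ultimately show ?thesis by blast
qed

text \<open>The gradient of \<open>\<phi>\<close>, the logarithm of the potential, is a positive
  multiple of the sum of the boosted points. The total weight 2 has to match the exponent of
  \<open>1 - w \<bullet> w\<close>, whose derivative accounts for the terms \<open>- w\<close> of
  the boosts.\<close>

theorem balanced_boost_exists:
  fixes p :: "'n::finite \<Rightarrow> 'a::euclidean_space"
  assumes pos: "\<And>i. r i > 0" and sum2: "(\<Sum>i\<in>UNIV. r i) = 2" and p: "\<And>i. norm (p i) = 1"
    and stab: "\<And>q. norm q = 1 \<Longrightarrow> (\<Sum>i | p i = q. r i) < 1"
  shows "\<exists>w. norm w < 1 \<and> (\<Sum>i\<in>UNIV. r i *\<^sub>R boost w (p i)) = 0"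
proof -
  let ?D = "\<lambda>i w. (p i - w) \<bullet> (p i - w)"
  define \<phi> where "\<phi> w = 2 * ln (1 - w \<bullet> w) - (\<Sum>i\<in>UNIV. r i * ln (?D i w))" for w
  define h where "h w = (if norm w < 1 then exp (\<phi> w) else 0)" for w
  have D: "?D i w > 0" if "norm w < 1" for w i
    using that p[of i] by auto
  have \<phi>': "(\<phi> has_derivative (\<lambda>v. 2 / (1 - w \<bullet> w) * (v \<bullet> (\<Sum>i\<in>UNIV. r i *\<^sub>R boost w (p i))))) (at w)"
    if w: "norm w < 1" for w
  proof -
    have W: "1 - w \<bullet> w > 0" using inner_self_less_1[OF w] by simp
    have "((\<lambda>w. ln (?D i w)) has_derivative (\<lambda>v. - (2 * ((p i - w) \<bullet> v)) / ?D i w)) (at w)" for i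
      using D[OF w, of i] by (auto intro!: derivative_eq_intros simp: fun_eq_iff inner_commute field_simps)
    moreover have "((\<lambda>w. ln (1 - w \<bullet> w)) has_derivative (\<lambda>v. - (2 * (w \<bullet> v)) / (1 - w \<bullet> w))) (at w)"
      using W by (auto intro!: derivative_eq_intros simp: fun_eq_iff inner_commute field_simps)
    ultimately have "(\<phi> has_derivative (\<lambda>v. 2 * (- (2 * (w \<bullet> v)) / (1 - w \<bullet> w)) -
        (\<Sum>i\<in>UNIV. r i * (- (2 * ((p i - w) \<bullet> v)) / ?D i w)))) (at w)"
      unfolding \<phi>_def by (intro has_derivative_diff has_derivative_sum has_derivative_mult_right)
    moreover have "2 * (- (2 * (w \<bullet> v)) / (1 - w \<bullet> w)) -
        (\<Sum>i\<in>UNIV. r i * (- (2 * ((p i - w) \<bullet> v)) / ?D i w)) =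
        2 / (1 - w \<bullet> w) * (v \<bullet> (\<Sum>i\<in>UNIV. r i *\<^sub>R boost w (p i)))" for v
    proof -
      have summand: "v \<bullet> (r i *\<^sub>R boost w (p i)) = (1 - w \<bullet> w) * (r i * (((p i - w) \<bullet> v) / ?D i w)) - r i * (v \<bullet> w)" for i
      proof -
        have "v \<bullet> (a *\<^sub>R ((b / c) *\<^sub>R d - w)) = b * (a * ((d \<bullet> v) / c)) - a * (v \<bullet> w)" for a b c d
          by (simp add: inner_diff_right inner_commute[of d] algebra_simps)
        then show ?thesis unfolding boost_def bden_eq[OF p] power2_norm_eq_inner .
      qed
      have "v \<bullet> (\<Sum>i\<in>UNIV. r i *\<^sub>R boost w (p i)) =
          (1 - w \<bullet> w) * (\<Sum>i\<in>UNIV. r i * (((p i - w) \<bullet> v) / ?D i w)) - 2 * (v \<bullet> w)"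
        unfolding inner_sum_right summand sum_subtractf sum_distrib_left[symmetric] sum_distrib_right[symmetric] sum2 ..
      moreover have "(\<Sum>i\<in>UNIV. r i * (- (2 * ((p i - w) \<bullet> v)) / ?D i w)) =
          - 2 * (\<Sum>i\<in>UNIV. r i * (((p i - w) \<bullet> v) / ?D i w))"
        unfolding sum_distrib_left by (rule sum.cong) simp_all
      ultimately show ?thesis using W by (simp add: field_simps inner_commute)
    qed
    ultimately show ?thesis by simp
  qed
  have "continuous_on (cball 0 1) h"
    unfolding continuous_on_def
  proof
    fix x :: 'a assume x: "x \<in> cball 0 1"
    show "(h \<longlongrightarrow> h x) (at x within cball 0 1)"
    proof (cases "norm x < 1")
      case True
      have "isCont \<phi> x" using has_derivative_continuous[OF \<phi>'[OF True]] .
      then have "((\<lambda>w. exp (\<phi> w)) \<longlongrightarrow> h x) (at x within cball 0 1)"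
        using True by (auto simp: h_def isCont_def intro!: tendsto_exp intro: tendsto_within_subset)
      moreover have "\<forall>\<^sub>F w in at x within cball 0 1. exp (\<phi> w) = h w"
      proof (rule eventually_mono[OF eventually_at_ball'[of "1 - norm x" x "cball 0 1"]])
        fix w assume "w \<in> ball x (1 - norm x) \<and> w \<noteq> x \<and> w \<in> cball 0 1"
        then have "norm w < 1" using norm_triangle_sub[of w x] by (simp add: dist_norm norm_minus_commute)
        then show "exp (\<phi> w) = h w" by (simp add: h_def)
      qed (use True in simp)
      ultimately show ?thesis by (rule Lim_transform_eventually)
    next
      case False
      with x have q: "norm x = 1" by simp
      define S where "S = (\<Sum>i | p i = x. r i)"
      have S: "S < 1" unfolding S_def by (rule stab[OF q])
      define \<psi> where "\<psi> w = (\<Sum>i | p i \<noteq> x. r i * ln (?D i w))" for w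
      \<comment> \<open>Near a boundary point \<open>x\<close>, the points equal to \<open>x\<close>
        contribute at most \<open>1 - norm w\<close> to the power \<open>- 2 * S\<close>, while
        \<open>1 - w \<bullet> w\<close> is at most \<open>2 * (1 - norm w)\<close>, whose square
        gives the 4. The exponent left is positive by stability, and \<open>\<psi>\<close> is
        continuous at \<open>x\<close>.\<close>
      define B where "B w = 4 * (1 - norm w) powr (2 - 2 * S) * exp (- \<psi> w)" for w
      have "((\<lambda>w. (1 - norm w) powr (2 - 2 * S)) \<longlongrightarrow> 0) (at x within cball 0 1)"
      proof (rule tendsto_zero_powrI)
        show "((\<lambda>w. 1 - norm w) \<longlongrightarrow> 0) (at x within cball 0 1)" using q by (auto intro!: tendsto_eq_intros)
        show "\<forall>\<^sub>F w in at x within cball 0 1. 0 \<le> 1 - norm w"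
          by (auto simp: eventually_at_filter)
        show "((\<lambda>w. 2 - 2 * S) \<longlongrightarrow> 2 - 2 * S) (at x within cball 0 1)" by simp
      qed (use S in simp)
      moreover have "((\<lambda>w. exp (- \<psi> w)) \<longlongrightarrow> exp (- \<psi> x)) (at x within cball 0 1)"
        unfolding \<psi>_def by (intro tendsto_intros) auto
      ultimately have "(B \<longlongrightarrow> 4 * 0 * exp (- \<psi> x)) (at x within cball 0 1)"
        unfolding B_def by (intro tendsto_mult tendsto_const)
      then have B0: "(B \<longlongrightarrow> 0) (at x within cball 0 1)" by simp
      have "norm (h w) \<le> B w" if "w \<in> cball 0 1" for w
      proof (cases "norm w < 1")
        case True
        let ?l = "ln (1 - norm w)"
        have split: "(\<Sum>i\<in>UNIV. r i * ln (?D i w)) = (\<Sum>i | p i = x. r i * ln (?D i w)) + \<psi> w"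
          unfolding \<psi>_def by (subst sum.union_disjoint[symmetric]) (auto intro: sum.cong)
        have "S * (2 * ?l) \<le> (\<Sum>i | p i = x. r i * ln (?D i w))"
          unfolding S_def sum_distrib_right
        proof (rule sum_mono)
          fix i
          have "(1 - norm w)\<^sup>2 \<le> (norm (p i - w))\<^sup>2"
            using True norm_triangle_ineq2[of "p i" w] p[of i] by (intro power_mono) auto
          then have "ln ((1 - norm w)\<^sup>2) \<le> ln (?D i w)"
            using True by (intro ln_mono) (auto simp: power2_norm_eq_inner)
          then have "2 * ?l \<le> ln (?D i w)" using True by (simp add: ln_realpow)
          then show "r i * (2 * ?l) \<le> r i * ln (?D i w)" using pos[of i] by (intro mult_left_mono) auto
        qed
        moreover have "ln (1 - w \<bullet> w) \<le> ?l + ln 2"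
        proof -
          have "1 - w \<bullet> w = (1 - norm w) * (1 + norm w)"
            by (simp add: power2_norm_eq_inner[symmetric] power2_eq_square algebra_simps)
          also have "ln \<dots> = ?l + ln (1 + norm w)" using True add_pos_nonneg[OF zero_less_one norm_ge_zero[of w]]
            by (intro ln_mult_pos) auto
          also have "\<dots> \<le> ?l + ln 2" using True by (simp add: add_pos_nonneg)
          finally show ?thesis .
        qed
        ultimately have "\<phi> w \<le> 2 * ln 2 + (2 - 2 * S) * ?l - \<psi> w"
          unfolding \<phi>_def split by (simp add: algebra_simps)
        then have "exp (\<phi> w) \<le> exp (2 * ln 2) * exp ((2 - 2 * S) * ?l) * exp (- \<psi> w)"
          by (simp flip: exp_add)
        moreover have "exp (2 * ln 2) = (4::real)" using exp_of_nat_mult[of 2 "ln 2 :: real"] by simp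
        ultimately show ?thesis using True by (simp add: h_def B_def powr_def)
      qed (simp add: h_def B_def)
      then have "\<forall>\<^sub>F w in at x within cball 0 1. norm (h w) \<le> B w" by (auto simp: eventually_at_filter)
      then have "(h \<longlongrightarrow> 0) (at x within cball 0 1)" by (rule Lim_null_comparison[OF _ B0])
      moreover have "h x = 0" using False by (simp add: h_def)
      ultimately show ?thesis by (simp only:)
    qed
  qed
  from continuous_attains_sup[OF compact_cball _ this]
  obtain w where w: "w \<in> cball 0 1" and max: "\<And>v. v \<in> cball 0 1 \<Longrightarrow> h v \<le> h w" by auto
  have "h 0 > 0" by (simp add: h_def)
  with max[of 0] have "h w > 0" by simp
  then have w1: "norm w < 1" by (auto simp: h_def split: if_splits)
  have "(\<lambda>v. 2 / (1 - w \<bullet> w) * (v \<bullet> (\<Sum>i\<in>UNIV. r i *\<^sub>R boost w (p i)))) = (\<lambda>v. 0)"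
  proof (rule differential_zero_maxmin[OF _ _ \<phi>'[OF w1]])
    have "\<phi> y \<le> \<phi> w" if "y \<in> ball 0 1" for y using max[of y] that w1 by (simp add: h_def)
    then show "(\<forall>y\<in>ball 0 1. \<phi> y \<le> \<phi> w) \<or> (\<forall>y\<in>ball 0 1. \<phi> w \<le> \<phi> y)" by blast
  qed (use w1 in auto)
  \<comment> \<open>Testing the vanishing differential on the sum itself gives a positive multiple
    of its squared norm.\<close>
  from fun_cong[OF this, of "\<Sum>i\<in>UNIV. r i *\<^sub>R boost w (p i)"] have "(\<Sum>i\<in>UNIV. r i *\<^sub>R boost w (p i)) = 0"
    using inner_self_less_1[OF w1] by simp
  then show ?thesis using w1 by blast
qed

section \<open>Quaternions and the projective line\<close>

lemma exhaust_5: "x = 1 \<or> x = 2 \<or> x = 3 \<or> x = 4 \<or> x = (5::5)"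
proof (induct x)
  case (of_int z)
  then have "z = 0 \<or> z = 1 \<or> z = 2 \<or> z = 3 \<or> z = 4" by (simp, arith)
  then show ?case by auto
qed

lemma forall_5: "(\<forall>i::5. P i) \<longleftrightarrow> P 1 \<and> P 2 \<and> P 3 \<and> P 4 \<and> P 5"
  by (metis exhaust_5)

lemma UNIV_5: "UNIV = {1, 2, 3, 4, 5::5}"
  using exhaust_5 by auto

lemma sum_5: "sum f (UNIV::5 set) = f 1 + f 2 + f 3 + f 4 + f 5"
  unfolding UNIV_5 by (simp add: ac_simps)

lemma vector_5 [simp]:
  "(vector [a, b, c, d, e] :: 'a::zero^5) $ 1 = a"
  "(vector [a, b, c, d, e] :: 'a::zero^5) $ 2 = b"
  "(vector [a, b, c, d, e] :: 'a::zero^5) $ 3 = c"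
  "(vector [a, b, c, d, e] :: 'a::zero^5) $ 4 = d"
  "(vector [a, b, c, d, e] :: 'a::zero^5) $ 5 = e"
  unfolding vector_def by simp_all

lemma inner_5: "(v::real^5) \<bullet> w = v$1 * w$1 + v$2 * w$2 + v$3 * w$3 + v$4 * w$4 + v$5 * w$5"
  by (simp add: inner_vec_def sum_5)

lemma vec5_eq_iff: "(v::'a^5) = w \<longleftrightarrow> v$1 = w$1 \<and> v$2 = w$2 \<and> v$3 = w$3 \<and> v$4 = w$4 \<and> v$5 = w$5"
  by (simp add: vec_eq_iff forall_5)

lemma quat_eq_iff: "x = y \<longleftrightarrow> q0 x = q0 y \<and> q1 x = q1 y \<and> q2 x = q2 y \<and> q3 x = q3 y"
  by (cases x; cases y) auto

lemma qnorm2_eq_0: "qnorm2 q = 0 \<longleftrightarrow> q = qzero"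
  by (cases q) (auto simp: qnorm2_def qzero_def add_nonneg_eq_0_iff)

instantiation quat :: division_ring
begin

definition zero_quat :: quat where "0 = qzero"
definition one_quat :: quat where "1 = qone"
definition plus_quat :: "quat \<Rightarrow> quat \<Rightarrow> quat" where "x + y = qadd x y"
definition minus_quat :: "quat \<Rightarrow> quat \<Rightarrow> quat" where "x - y = qsub x y"
definition uminus_quat :: "quat \<Rightarrow> quat" where "- x = qsub qzero x"
definition times_quat :: "quat \<Rightarrow> quat \<Rightarrow> quat" where "x * y = qmul x y"
definition inverse_quat :: "quat \<Rightarrow> quat" where "inverse x = qinv x"
definition divide_quat :: "quat \<Rightarrow> quat \<Rightarrow> quat" where "divide_quat x y = qmul x (qinv y)"

instance
proof
  fix a b c :: quat
  note defs = zero_quat_def one_quat_def plus_quat_def minus_quat_def uminus_quat_def times_quat_def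
    inverse_quat_def divide_quat_def qzero_def qone_def qadd_def qsub_def qmul_def qinv_def
  show "a + b + c = a + (b + c)" "a + b = b + a" "0 + a = a" "- a + a = 0" "a - b = a + - b"
    "1 * a = a" "a * 1 = a" "(0::quat) \<noteq> 1"
    by (auto simp: defs quat_eq_iff)
  show "a * b * c = a * (b * c)" "(a + b) * c = a * c + b * c" "a * (b + c) = a * b + a * c"
    by (simp_all add: defs quat_eq_iff algebra_simps)
  show "inverse a * a = 1" "a * inverse a = 1" if "a \<noteq> 0"
  proof -
    have "qnorm2 a \<noteq> 0" using that by (simp add: qnorm2_eq_0 zero_quat_def)
    then show "inverse a * a = 1" "a * inverse a = 1"
      by (auto simp: defs quat_eq_iff simp flip: add_divide_distrib diff_divide_distrib)
        (auto simp: qnorm2_def power2_eq_square algebra_simps)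
  qed
  show "divide a b = a * inverse b" by (simp add: defs)
  show "inverse (0::quat) = 0" by (simp add: defs)
qed

end

lemma quat_ops:
  "qzero = 0" "qone = 1" "qadd x y = x + y" "qsub x y = x - y" "qmul x y = x * y" "qinv x = inverse x"
  by (simp_all add: zero_quat_def one_quat_def plus_quat_def minus_quat_def times_quat_def inverse_quat_def)

lemma quat_sel [simp]:
  "q0 0 = 0" "q1 0 = 0" "q2 0 = 0" "q3 0 = 0" "q0 1 = 1" "q1 1 = 0" "q2 1 = 0" "q3 1 = 0"
  "q0 (x + y) = q0 x + q0 y" "q1 (x + y) = q1 x + q1 y" "q2 (x + y) = q2 x + q2 y" "q3 (x + y) = q3 x + q3 y"
  "q0 (x - y) = q0 x - q0 y" "q1 (x - y) = q1 x - q1 y" "q2 (x - y) = q2 x - q2 y" "q3 (x - y) = q3 x - q3 y"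
  "q0 (- x) = - q0 x" "q1 (- x) = - q1 x" "q2 (- x) = - q2 x" "q3 (- x) = - q3 x"
  "q0 (x * y) = q0 x * q0 y - q1 x * q1 y - q2 x * q2 y - q3 x * q3 y"
  "q1 (x * y) = q0 x * q1 y + q1 x * q0 y + q2 x * q3 y - q3 x * q2 y"
  "q2 (x * y) = q0 x * q2 y - q1 x * q3 y + q2 x * q0 y + q3 x * q1 y"
  "q3 (x * y) = q0 x * q3 y + q1 x * q2 y - q2 x * q1 y + q3 x * q0 y"
  "q0 (inverse x) = q0 x / qnorm2 x" "q1 (inverse x) = - q1 x / qnorm2 x"
  "q2 (inverse x) = - q2 x / qnorm2 x" "q3 (inverse x) = - q3 x / qnorm2 x"
  by (simp_all add: zero_quat_def one_quat_def plus_quat_def minus_quat_def uminus_quat_def times_quat_def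
      inverse_quat_def qzero_def qone_def qadd_def qsub_def qmul_def qinv_def)

lemma qnorm2_0 [simp]: "qnorm2 0 = 0" and qnorm2_eq_0_iff [simp]: "qnorm2 q = 0 \<longleftrightarrow> q = 0"
  and qnorm2_nonneg [simp]: "qnorm2 q \<ge> 0" and qnorm2_pos_iff [simp]: "qnorm2 q > 0 \<longleftrightarrow> q \<noteq> 0"
proof -
  show "qnorm2 0 = 0" by (simp add: qnorm2_def)
  show eq: "qnorm2 q = 0 \<longleftrightarrow> q = 0" by (simp add: qnorm2_eq_0 quat_ops)
  show nn: "qnorm2 q \<ge> 0" by (simp add: qnorm2_def)
  show "qnorm2 q > 0 \<longleftrightarrow> q \<noteq> 0" using eq nn by linarith
qed

definition qre :: "real \<Rightarrow> quat" where "qre t = Quat t 0 0 0"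

definition qcnj :: "quat \<Rightarrow> quat" where "qcnj x = Quat (q0 x) (- q1 x) (- q2 x) (- q3 x)"

lemma qre_sel [simp]: "q0 (qre t) = t" "q1 (qre t) = 0" "q2 (qre t) = 0" "q3 (qre t) = 0"
  by (simp_all add: qre_def)

lemma qcnj_sel [simp]: "q0 (qcnj x) = q0 x" "q1 (qcnj x) = - q1 x" "q2 (qcnj x) = - q2 x" "q3 (qcnj x) = - q3 x"
  by (simp_all add: qcnj_def)

lemma qnorm2_mult: "qnorm2 (x * y) = qnorm2 x * qnorm2 y"
  by (simp add: qnorm2_def power2_eq_square algebra_simps)

lemma qre_commute: "qre t * x = x * qre t"
  by (simp add: quat_eq_iff)

lemma qre_eq_0 [simp]: "qre t = 0 \<longleftrightarrow> t = 0"
  by (simp add: quat_eq_iff)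

lemma qre_1 [simp]: "qre 1 = 1"
  by (simp add: quat_eq_iff)

section \<open>Homogeneous coordinates and the quaternionic Hopf map\<close>

type_synonym qvec = "quat \<times> quat"

abbreviation nzv :: "qvec \<Rightarrow> bool" where "nzv z \<equiv> z \<noteq> (0, 0)"

definition rscale :: "qvec \<Rightarrow> quat \<Rightarrow> qvec" where "rscale z l = (fst z * l, snd z * l)"

definition vnorm2 :: "qvec \<Rightarrow> real" where "vnorm2 z = qnorm2 (fst z) + qnorm2 (snd z)"

text \<open>The quaternionic Hopf map before normalisation: on \<open>(v, 1)\<close> the quotient by
  \<open>vnorm2\<close> is \<open>stereo v\<close>.\<close>

definition lvec :: "qvec \<Rightarrow> real^5" where
  "lvec z = (let p = fst z * qcnj (snd z) in
     vector [2 * q0 p, 2 * q1 p, 2 * q2 p, 2 * q3 p, qnorm2 (snd z) - qnorm2 (fst z)])"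

definition pt :: "qvec \<Rightarrow> real^5" where "pt z = (1 / vnorm2 z) *\<^sub>R lvec z"

lemma vnorm2_pos: "nzv z \<Longrightarrow> vnorm2 z > 0"
  by (cases z) (auto simp: vnorm2_def add_pos_nonneg add_nonneg_pos)

lemma vnorm2_eq_0: "vnorm2 z = 0 \<longleftrightarrow> z = (0, 0)"
  by (cases "nzv z") (use vnorm2_pos[of z] in \<open>auto simp: vnorm2_def\<close>)

lemma lvec_sel:
  "lvec z $ 1 = 2 * q0 (fst z * qcnj (snd z))" "lvec z $ 2 = 2 * q1 (fst z * qcnj (snd z))"
  "lvec z $ 3 = 2 * q2 (fst z * qcnj (snd z))" "lvec z $ 4 = 2 * q3 (fst z * qcnj (snd z))"
  "lvec z $ 5 = qnorm2 (snd z) - qnorm2 (fst z)"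
  by (simp_all add: lvec_def Let_def)

lemma lvec_eq_pt: "nzv z \<Longrightarrow> lvec z = vnorm2 z *\<^sub>R pt z"
  using vnorm2_pos[of z] by (simp add: pt_def)

lemma inner_lvec_self: "lvec z \<bullet> lvec z = (vnorm2 z)\<^sup>2"
  by (simp add: inner_5 lvec_sel vnorm2_def qnorm2_def power2_eq_square algebra_simps)

lemma norm_pt: "nzv z \<Longrightarrow> norm (pt z) = 1"
  unfolding norm_eq_1 using vnorm2_pos[of z] by (simp add: pt_def inner_lvec_self power2_eq_square)

lemma vnorm2_rscale: "vnorm2 (rscale z l) = qnorm2 l * vnorm2 z"
  by (simp add: vnorm2_def rscale_def qnorm2_mult algebra_simps)

lemma lvec_rscale: "lvec (rscale z l) = qnorm2 l *\<^sub>R lvec z"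
  by (simp add: vec5_eq_iff lvec_sel rscale_def qnorm2_mult)
    (simp add: qnorm2_def power2_eq_square algebra_simps)

lemma nzv_rscale: "nzv z \<Longrightarrow> l \<noteq> 0 \<Longrightarrow> nzv (rscale z l)"
  by (cases z) (auto simp: rscale_def)

lemma pt_rscale: "nzv z \<Longrightarrow> l \<noteq> 0 \<Longrightarrow> pt (rscale z l) = pt z"
  by (simp add: pt_def lvec_rscale vnorm2_rscale)

lemma hp1_class_eq: "hp1_class x y = {rscale (x, y) l | l. l \<noteq> 0}"
  by (simp add: hp1_class_def quat_ops rscale_def)

lemma hp1_class_rscale: "l \<noteq> 0 \<Longrightarrow> hp1_class (x * l) (y * l) = hp1_class x y"
proof -
  assume l: "l \<noteq> 0"
  have "rscale (x * l, y * l) k = rscale (x, y) (l * k)" for k by (simp add: rscale_def mult.assoc)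
  moreover have "rscale (x, y) k = rscale (x * l, y * l) (inverse l * k)" for k
    using l by (simp add: rscale_def mult.assoc[symmetric]) (simp add: mult.assoc)
  ultimately show ?thesis using l unfolding hp1_class_eq
    by (auto simp: set_eq_iff) (metis mult_eq_0_iff nonzero_imp_inverse_nonzero)+
qed

lemma pt_south: "x \<noteq> 0 \<Longrightarrow> pt (x, 0) = south"
  by (simp add: pt_def vec5_eq_iff lvec_sel south_def vnorm2_def)

lemma pt_sel_5: "nzv z \<Longrightarrow> 1 + pt z $ 5 = 2 * qnorm2 (snd z) / vnorm2 z"
  using vnorm2_pos[of z] by (simp add: pt_def lvec_sel field_simps) (simp add: vnorm2_def)

lemma S4_to_hp1_pt:
  assumes "nzv (x, y)"
  shows "S4_to_hp1 (pt (x, y)) = hp1_class x y"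
proof (cases "y = 0")
  case True
  then have "x \<noteq> 0" using assms by simp
  then show ?thesis using True hp1_class_rscale[of x 1 0]
    by (simp add: pt_south S4_to_hp1_def quat_ops)
next
  case False
  let ?s = "pt (x, y)"
  have t: "vnorm2 (x, y) > 0" using vnorm2_pos assms by blast
  have 5: "1 + ?s $ 5 = 2 * qnorm2 y / vnorm2 (x, y)" using pt_sel_5[OF assms] by simp
  then have "1 + ?s $ 5 > 0" using t False by simp
  then have "?s \<noteq> south" by (auto simp: south_def)
  moreover have "Quat (?s$1 / (1 + ?s$5)) (?s$2 / (1 + ?s$5)) (?s$3 / (1 + ?s$5)) (?s$4 / (1 + ?s$5)) = x * inverse y"
  proof -
    define N where "N = qnorm2 y"
    have "N \<noteq> 0" using False by (simp add: N_def)
    then show ?thesis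
      unfolding 5 N_def[symmetric] using t
      by (simp add: quat_eq_iff pt_def lvec_sel N_def[symmetric]) (simp add: field_simps)
  qed
  ultimately have "S4_to_hp1 ?s = hp1_class (x * inverse y) 1" by (simp add: S4_to_hp1_def quat_ops)
  also have "\<dots> = hp1_class (x * inverse y * y) (1 * y)" by (rule hp1_class_rscale[OF False, symmetric])
  also have "\<dots> = hp1_class x y" using False by (simp add: mult.assoc)
  finally show ?thesis .
qed

text \<open>The fibres of the Hopf map are the right orbits of the nonzero quaternions, because
  \<open>S4_to_hp1\<close> recovers the class from the point.\<close>

lemma pt_eq_imp_rscale:
  assumes "nzv z" "nzv z'" "pt z = pt z'"
  obtains l where "l \<noteq> 0" "z' = rscale z l"
proof -
  have "hp1_class (fst z) (snd z) = hp1_class (fst z') (snd z')"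
    using S4_to_hp1_pt[of "fst z" "snd z"] S4_to_hp1_pt[of "fst z'" "snd z'"] assms by simp
  moreover have "z' = rscale (fst z', snd z') 1" by (simp add: rscale_def)
  then have "z' \<in> hp1_class (fst z') (snd z')" unfolding hp1_class_eq by (intro CollectI exI[of _ 1]) auto
  ultimately have "z' \<in> hp1_class (fst z) (snd z)" by simp
  then show ?thesis using that unfolding hp1_class_eq by auto
qed

lemma pt_surj:
  assumes "norm s = 1"
  obtains z where "nzv z" "pt z = s"
proof (cases "1 + s $ 5 = 0")
  case True
  have "s = south"
  proof -
    have "s \<bullet> s = 1" using assms by (simp add: norm_eq_1)
    then have "(s$1)\<^sup>2 + (s$2)\<^sup>2 + (s$3)\<^sup>2 + (s$4)\<^sup>2 = 0"
      using True by (simp add: inner_5 power2_eq_square add_eq_0_iff)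
    then show ?thesis using True by (simp add: vec5_eq_iff south_def add_nonneg_eq_0_iff)
  qed
  then show ?thesis using that[of "(1, 0)"] by (simp add: pt_south)
next
  case False
  have "s \<bullet> s = 1" using assms by (simp add: norm_eq_1)
  then have sq: "(s$1)\<^sup>2 + (s$2)\<^sup>2 + (s$3)\<^sup>2 + (s$4)\<^sup>2 = (1 + s$5) * (1 - s$5)"
    by (simp add: inner_5 power2_eq_square algebra_simps)
  \<comment> \<open>The chart value is the vector of the first four coordinates divided by
    \<open>1 + s$5\<close>; clearing the denominator gives this representative.\<close>
  define z where "z = (Quat (s$1) (s$2) (s$3) (s$4), qre (1 + s$5))"
  have v: "vnorm2 z = 2 * (1 + s$5)"
    using sq by (simp add: vnorm2_def z_def qnorm2_def power2_eq_square algebra_simps)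
  have "lvec z = (2 * (1 + s$5)) *\<^sub>R s"
    using sq by (simp add: vec5_eq_iff lvec_sel z_def qnorm2_def power2_eq_square algebra_simps)
  then have "pt z = s" using False v by (simp add: pt_def)
  moreover have "nzv z" using False by (simp add: z_def)
  ultimately show ?thesis using that by blast
qed

lemma hp1_to_S4_class:
  assumes "nzv (x, y)"
  shows "hp1_to_S4 (hp1_class x y) = pt (x, y)"
proof -
  define z where "z = (SOME p. p \<in> hp1_class x y)"
  have "rscale (x, y) 1 \<in> hp1_class x y" unfolding hp1_class_eq by (intro CollectI exI[of _ 1]) auto
  then have "\<exists>p. p \<in> hp1_class x y" by blast
  then have "z \<in> hp1_class x y" unfolding z_def by (rule someI_ex)
  then obtain l where l: "l \<noteq> 0" "z = rscale (x, y) l" by (auto simp: hp1_class_eq)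
  have nz: "nzv z" unfolding l by (rule nzv_rscale[OF assms l(1)])
  have "hp1_to_S4 (hp1_class x y) = (if snd z = 0 then south else stereo (fst z * inverse (snd z)))"
    unfolding hp1_to_S4_def z_def[symmetric] by (simp add: case_prod_unfold quat_ops)
  also have "\<dots> = pt z"
  proof (cases "snd z = 0")
    case True
    then show ?thesis using nz pt_south[of "fst z"] by (metis prod.collapse)
  next
    case False
    let ?v = "fst z * inverse (snd z)"
    have "rscale (?v, 1) (snd z) = z" using False by (simp add: rscale_def mult.assoc)
    then have "pt z = pt (?v, 1)" using pt_rscale[of "(?v, 1)" "snd z"] False by simp
    also have "\<dots> = stereo ?v"
      by (simp add: pt_def stereo_def Let_def vec5_eq_iff lvec_sel vnorm2_def)
        (simp add: qnorm2_def add.commute)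
    finally show ?thesis using False by simp
  qed
  also have "\<dots> = pt (x, y)" unfolding l by (rule pt_rscale[OF assms l(1)])
  finally show ?thesis .
qed

lemma hp1_to_S4_to_hp1: "norm s = 1 \<Longrightarrow> hp1_to_S4 (S4_to_hp1 s) = s"
  by (metis pt_surj S4_to_hp1_pt hp1_to_S4_class prod.collapse)

lemma HP1_eq: "P \<in> HP1 \<longleftrightarrow> (\<exists>x y. nzv (x, y) \<and> P = hp1_class x y)"
  by (auto simp: HP1_def quat_ops)

lemma S4_to_hp1_in_HP1: "norm s = 1 \<Longrightarrow> S4_to_hp1 s \<in> HP1"
  by (metis pt_surj S4_to_hp1_pt HP1_eq prod.collapse)

lemma norm_hp1_to_S4: "P \<in> HP1 \<Longrightarrow> norm (hp1_to_S4 P) = 1"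
  by (metis HP1_eq hp1_to_S4_class norm_pt)

lemma S4_to_hp1_to_S4: "P \<in> HP1 \<Longrightarrow> S4_to_hp1 (hp1_to_S4 P) = P"
  by (metis HP1_eq hp1_to_S4_class S4_to_hp1_pt)

section \<open>Quaternionic matrices acting on the sphere\<close>

definition mact :: "qmat \<Rightarrow> qvec \<Rightarrow> qvec" where
  "mact M z = (case M of (a, b, c, d) \<Rightarrow> (a * fst z + b * snd z, c * fst z + d * snd z))"

definition mmul :: "qmat \<Rightarrow> qmat \<Rightarrow> qmat" where
  "mmul M N = (case M of (a, b, c, d) \<Rightarrow> case N of (a', b', c', d') \<Rightarrow>
     (a * a' + b * c', a * b' + b * d', c * a' + d * c', c * b' + d * d'))"

text \<open>Triviality of the kernel is stable under products without any multiplicativity of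
  \<open>ddet\<close>.\<close>

definition nonsing :: "qmat \<Rightarrow> bool" where
  "nonsing M \<longleftrightarrow> (\<forall>z. nzv z \<longrightarrow> nzv (mact M z))"

lemma mact_mmul: "mact (mmul M N) z = mact M (mact N z)"
  by (cases M; cases N) (simp add: mact_def mmul_def algebra_simps)

lemma nonsingD: "nonsing M \<Longrightarrow> nzv z \<Longrightarrow> nzv (mact M z)"
  unfolding nonsing_def by blast

lemma nonsing_mmul: "nonsing M \<Longrightarrow> nonsing N \<Longrightarrow> nonsing (mmul M N)"
  unfolding nonsing_def mact_mmul by blast

lemma mact_rscale: "mact M (rscale z l) = rscale (mact M z) l"
  by (cases M) (simp add: mact_def rscale_def algebra_simps)

lemma hp1_class_image: "hp1_class x y = rscale (x, y) ` {l. l \<noteq> 0}"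
  unfolding hp1_class_eq by blast

lemma mat_act_hp1_class: "mat_act M (hp1_class x y) = hp1_class (fst (mact M (x, y))) (snd (mact M (x, y)))"
proof -
  have "mat_act M (hp1_class x y) = mact M ` hp1_class x y"
    by (cases M) (force simp: mat_act_def mact_def quat_ops)
  also have "\<dots> = rscale (mact M (x, y)) ` {l. l \<noteq> 0}"
    by (simp add: hp1_class_image image_image mact_rscale)
  finally show ?thesis by (simp add: hp1_class_image)
qed

lemma mat_act_S4_to_hp1_pt:
  assumes "nonsing M" "nzv z"
  shows "mat_act M (S4_to_hp1 (pt z)) = S4_to_hp1 (pt (mact M z))"
  using assms S4_to_hp1_pt[of "fst z" "snd z"] S4_to_hp1_pt[of "fst (mact M z)" "snd (mact M z)"]
    nonsingD[OF assms] by (simp add: mat_act_hp1_class)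

lemma pt_mact_cong:
  assumes "nonsing M" "nzv z" "nzv z'" "pt z = pt z'"
  shows "pt (mact M z) = pt (mact M z')"
proof -
  obtain l where "l \<noteq> 0" "z' = rscale z l" using pt_eq_imp_rscale[OF assms(2-4)] .
  then show ?thesis using nonsingD[OF assms(1,2)] by (simp add: mact_rscale pt_rscale)
qed

text \<open>When \<open>a\<close> is nonzero, elimination leaves the Schur complement
  \<open>s\<close>, and \<open>(- (inverse a * b), 1)\<close> tests it: the first row kills this
  vector and the second gives \<open>s\<close>.\<close>

lemma ddet_pos_iff: "ddet M > 0 \<longleftrightarrow> nonsing M"
proof -
  obtain a b c d where M: "M = (a, b, c, d)" by (cases M)
  have qn: "qnorm q > 0 \<longleftrightarrow> q \<noteq> 0" "qnorm q \<ge> 0" "qnorm q = 0 \<longleftrightarrow> q = 0" for q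
    by (simp_all add: qnorm_def)
  have qn2: "qnorm p * qnorm q > 0 \<longleftrightarrow> p \<noteq> 0 \<and> q \<noteq> 0" for p q
    using mult_nonneg_nonneg[OF qn(2) qn(2), of p q] qn(3) by (auto simp: less_le)
  show ?thesis
  proof (cases "a = 0")
    case True
    have "c \<noteq> 0 \<and> b \<noteq> 0" if "nonsing M"
    proof -
      have "nzv (mact M (1, 0))" using that by (simp add: nonsing_def)
      then have c: "c \<noteq> 0" using True by (auto simp: M mact_def)
      have "nzv (mact M (- (inverse c * d), 1))" using that by (simp add: nonsing_def)
      then have "b \<noteq> 0" using c True by (auto simp: M mact_def mult.assoc[symmetric])
      then show ?thesis using c by simp
    qed
    moreover have "nonsing M" if "c \<noteq> 0" "b \<noteq> 0" using that True by (auto simp: nonsing_def M mact_def)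
    ultimately show ?thesis using True by (auto simp: ddet_def M quat_ops qn2)
  next
    case False
    define s where "s = d - c * (inverse a * b)"
    have "s \<noteq> 0" if "nonsing M"
    proof -
      have "nzv (mact M (- (inverse a * b), 1))" using that by (simp add: nonsing_def)
      then show ?thesis using False by (auto simp: M mact_def s_def mult.assoc[symmetric])
    qed
    moreover have "nonsing M" if "s \<noteq> 0"
      unfolding nonsing_def
    proof (intro allI impI notI)
      fix z assume z: "nzv z" and 0: "mact M z = (0, 0)"
      then have 1: "a * fst z + b * snd z = 0" and 2: "c * fst z + d * snd z = 0" by (auto simp: M mact_def)
      have "inverse a * (a * fst z + b * snd z) = fst z + inverse a * b * snd z"
        using False by (simp add: distrib_left mult.assoc[symmetric])
      then have x: "fst z = - (inverse a * b * snd z)" using 1 by (simp add: eq_neg_iff_add_eq_0)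
      then have "s * snd z = 0" using 2 by (simp add: s_def algebra_simps)
      then have "snd z = 0" using that by simp
      then show False using x z by (cases z) auto
    qed
    ultimately show ?thesis using False by (auto simp: ddet_def M quat_ops qn2 s_def[symmetric])
  qed
qed

lemma nonsing_SL2H: "M \<in> SL2H \<Longrightarrow> nonsing M"
  using ddet_pos_iff[of M] by (simp add: SL2H_def)

text \<open>A real factor \<open>t\<close> multiplies \<open>ddet\<close> by \<open>t * t\<close>,
  and it is central, so it acts trivially on projective classes.\<close>

lemma nonsing_imp_SL2H:
  assumes "nonsing M"
  obtains M' where "M' \<in> SL2H" "\<And>x y. mat_act M' (hp1_class x y) = mat_act M (hp1_class x y)"
proof -
  obtain a b c d where M: "M = (a, b, c, d)" by (cases M)
  have pos: "ddet M > 0" using assms ddet_pos_iff by blast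
  define t where "t = 1 / sqrt (ddet M)"
  have t: "t > 0" "t * t * ddet M = 1" using pos by (simp_all add: t_def field_simps)
  define M' where "M' = (qre t * a, qre t * b, qre t * c, qre t * d)"
  have qn: "qnorm (qre t * x) = t * qnorm x" for x
    using t by (simp add: qnorm_def qnorm2_mult real_sqrt_mult) (simp add: qnorm2_def)
  have "qre t * c * (inverse (qre t * a) * (qre t * b)) = qre t * (c * (inverse a * b))" if "a \<noteq> 0"
  proof -
    have "inverse (qre t * a) * (qre t * b) = inverse a * b"
      using that t by (simp add: nonzero_inverse_mult_distrib mult.assoc) (simp add: mult.assoc[symmetric])
    then show ?thesis by (simp add: mult.assoc)
  qed
  then have "ddet M' = t * t * ddet M"
    using t by (auto simp: ddet_def M M'_def quat_ops qn simp flip: right_diff_distrib)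
      (simp_all add: mult.assoc mult.left_commute)
  then have "M' \<in> SL2H" using t by (simp add: SL2H_def)
  moreover have "mat_act M' (hp1_class x y) = mat_act M (hp1_class x y)" for x y
  proof -
    have "mact M' (x, y) = rscale (mact M (x, y)) (qre t)"
      by (simp add: M M'_def mact_def rscale_def mult.assoc qre_commute distrib_right distrib_left)
    then show ?thesis unfolding mat_act_hp1_class using hp1_class_rscale[of "qre t"] t by (simp add: rscale_def)
  qed
  ultimately show ?thesis using that by blast
qed

section \<open>Rotations and boosts induced by matrices\<close>

definition acts :: "qmat \<Rightarrow> (real^5 \<Rightarrow> real^5) \<Rightarrow> (real^5 \<Rightarrow> real) \<Rightarrow> bool" where
  "acts M g N \<longleftrightarrow> nonsing M \<and> (\<forall>z. nzv z \<longrightarrow> pt (mact M z) = g (pt z) \<and> vnorm2 (mact M z) = N (pt z) * vnorm2 z)"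

text \<open>Multipliers form a cocycle: the outer one is evaluated at the image under the inner
  map.\<close>

lemma acts_mmul: "acts A f N \<Longrightarrow> acts B g N' \<Longrightarrow> acts (mmul A B) (\<lambda>u. f (g u)) (\<lambda>u. N (g u) * N' u)"
  unfolding acts_def mact_mmul using nonsing_mmul nonsingD by (metis mult.assoc)

lemma actsI:
  assumes "\<And>u. norm u = 1 \<Longrightarrow> N u > 0"
    and "\<And>z. nzv z \<Longrightarrow> vnorm2 (mact M z) = N (pt z) * vnorm2 z"
    and "\<And>z. nzv z \<Longrightarrow> lvec (mact M z) = (N (pt z) * vnorm2 z) *\<^sub>R g (pt z)"
  shows "acts M g N"
proof -
  have pos: "N (pt z) * vnorm2 z > 0" if "nzv z" for z using assms(1) norm_pt[OF that] vnorm2_pos[OF that] by simp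
  then have "nonsing M" unfolding nonsing_def using assms(2) vnorm2_eq_0 by (metis less_irrefl)
  moreover have "pt (mact M z) = g (pt z)" if "nzv z" for z
  proof -
    define k where "k = N (pt z) * vnorm2 z"
    have "k \<noteq> 0" using pos[OF that] unfolding k_def by (rule less_imp_neq[THEN not_sym])
    then show ?thesis using assms(2,3)[OF that] unfolding k_def[symmetric] pt_def[of "mact M z"] by simp
  qed
  ultimately show ?thesis using assms(2) by (simp add: acts_def)
qed

lemma acts_S4_to_hp1: "acts M g N \<Longrightarrow> norm s = 1 \<Longrightarrow> mat_act M (S4_to_hp1 s) = S4_to_hp1 (g s)"
  by (metis acts_def mat_act_S4_to_hp1_pt pt_surj)

definition refl_along :: "'a::real_inner \<Rightarrow> 'a \<Rightarrow> 'a" where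
  "refl_along m v = v - (2 * (v \<bullet> m)) *\<^sub>R m"

lemma refl_along_involution: "norm m = 1 \<Longrightarrow> refl_along m (refl_along m v) = v"
  by (simp add: refl_along_def inner_diff_left norm_eq_1)

lemma orthogonal_refl_along:
  assumes "norm m = 1"
  shows "orthogonal_transformation (refl_along m)"
  unfolding orthogonal_transformation_def
proof
  show "linear (refl_along m)"
    by (rule linearI) (simp_all add: refl_along_def inner_add_left algebra_simps)
  have "refl_along m v \<bullet> refl_along m w = v \<bullet> w" for v w
    using assms by (simp add: refl_along_def inner_diff_left inner_diff_right norm_eq_1 inner_commute[of m w])
  then show "\<forall>v w. refl_along m v \<bullet> refl_along m w = v \<bullet> w" by blast
qed

text \<open>An orthogonal matrix taking a coordinate axis to \<open>m\<close> conjugates the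
  reflection into a diagonal one with a single entry -1.\<close>

lemma det_refl_along:
  fixes m :: "real^'n"
  assumes m: "norm m = 1"
  shows "det (matrix (refl_along m)) = -1"
proof -
  fix k :: 'n
  let ?e = "axis k 1 :: real^'n"
  obtain A where A: "orthogonal_matrix A" and Ae: "A *v ?e = m" using orthogonal_matrix_exists_basis[OF m] .
  have lin: "linear (refl_along v)" if "norm v = 1" for v :: "real^'n"
    using orthogonal_refl_along[OF that] orthogonal_transformation_def by blast
  have AA: "transpose A ** A = mat 1" "A ** transpose A = mat 1"
    using A by (auto simp: orthogonal_matrix_def)
  have "matrix (refl_along m) ** A = A ** matrix (refl_along ?e)"
    unfolding matrix_eq
  proof
    fix x
    have "(A *v x) \<bullet> m = x \<bullet> ?e"
      unfolding Ae[symmetric] using A orthogonal_transformation_matrix[of "(*v) A"]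
      by (simp add: orthogonal_transformation_def)
    then show "(matrix (refl_along m) ** A) *v x = (A ** matrix (refl_along ?e)) *v x"
      using m by (simp add: matrix_vector_mul_assoc[symmetric] matrix_works lin refl_along_def Ae
          matrix_vector_mult_diff_distrib matrix_vector_mult_scaleR)
  qed
  then have "det (matrix (refl_along m)) * det A = det A * det (matrix (refl_along ?e))" by (metis det_mul)
  moreover have "det A \<noteq> 0" using det_orthogonal_matrix[OF A] by auto
  moreover have "det (matrix (refl_along ?e)) = -1"
  proof -
    have ent: "matrix (refl_along ?e) $ i $ j = (if i = j then if i = k then - 1 else 1 else 0)" for i j
      by (simp add: matrix_def refl_along_def inner_axis_axis) (auto simp: axis_def)
    then have "det (matrix (refl_along ?e)) = (\<Prod>i\<in>UNIV. if i = k then - 1 else 1)"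
      by (subst det_diagonal) (auto simp: ent)
    then show ?thesis by simp
  qed
  ultimately have "det A \<noteq> 0" "det (matrix (refl_along m)) * det A = (-1) * det A" by simp_all
  then show ?thesis using mult_right_cancel[of "det A" _ "-1"] by blast
qed

text \<open>The reference reflection; in the chart it is \<open>v \<mapsto> - qcnj v\<close>. A
  reflection alone is not induced by a matrix, but its product with this one is.\<close>

abbreviation refl_1 :: "real^5 \<Rightarrow> real^5" where "refl_1 \<equiv> refl_along (axis 1 1)"

lemma refl_1_sel [simp]: "refl_1 v $ 1 = - v $ 1" "refl_1 v $ 2 = v $ 2" "refl_1 v $ 3 = v $ 3"
  "refl_1 v $ 4 = v $ 4" "refl_1 v $ 5 = v $ 5"
  by (simp_all add: refl_along_def inner_axis) (simp_all add: axis_def)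

lemma acts_two_reflections:
  assumes m: "norm m = 1"
  shows "\<exists>M. acts M (\<lambda>u. refl_along m (refl_1 u)) (\<lambda>_. 1)"
proof
  \<comment> \<open>in the chart this is \<open>v \<mapsto> (n v - m\<^sub>5) (m\<^sub>5 v + n*)\<close> with the last factor inverted\<close>
  define n where "n = Quat (m$1) (m$2) (m$3) (m$4)"
  define M where "M = (n, qre (- (m$5)), qre (m$5), qcnj n)"
  have mm: "m \<bullet> m = 1" using m by (simp add: norm_eq_1)
  have "vnorm2 (mact M z) = (m \<bullet> m) * vnorm2 z" for z
    by (cases z) (simp add: M_def n_def mact_def vnorm2_def qnorm2_def inner_5 power2_eq_square algebra_simps)
  then have v: "vnorm2 (mact M z) = vnorm2 z" for z by (simp add: mm)
  have "lvec (mact M z) = (m \<bullet> m) *\<^sub>R refl_1 (lvec z) - (2 * (refl_1 (lvec z) \<bullet> m)) *\<^sub>R m" for z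
    by (cases z) (simp add: vec5_eq_iff lvec_sel M_def n_def mact_def qnorm2_def inner_5 power2_eq_square algebra_simps)
  then have l: "lvec (mact M z) = refl_along m (refl_1 (lvec z))" for z by (simp add: mm refl_along_def)
  have lin: "linear (refl_along m)" "linear refl_1"
    using orthogonal_refl_along[of m] orthogonal_refl_along[of "axis 1 1 :: real^5"] m
    by (auto simp: orthogonal_transformation_def)
  show "acts M (\<lambda>u. refl_along m (refl_1 u)) (\<lambda>_. 1)"
    by (rule actsI) (simp_all add: v l lvec_eq_pt linear_cmul[OF lin(1)] linear_cmul[OF lin(2)])
qed

lemma matrix_works_real: "linear (f :: real^'n \<Rightarrow> real^'m) \<Longrightarrow> matrix f *v x = f x"
  using fun_cong[OF matrix_vector_mul(2)] by blast

text \<open>Cartan-Dieudonne by induction on the number of moved basis vectors. Each peeled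
  reflection flips the determinant, hence both signs are treated together, the negative one after
  multiplication by \<open>refl_1\<close>.\<close>

lemma acts_rotation:
  assumes f: "orthogonal_transformation (f :: real^5 \<Rightarrow> real^5)"
  shows "(det (matrix f) = 1 \<longrightarrow> (\<exists>M. acts M f (\<lambda>_. 1))) \<and>
    (det (matrix f) = -1 \<longrightarrow> (\<exists>M. acts M (\<lambda>u. refl_1 (f u)) (\<lambda>_. 1)))"
  using f
proof (induction "card {i. f (axis i 1) \<noteq> axis i 1}" arbitrary: f rule: less_induct)
  case less
  have linf: "linear f" using less.prems by (simp add: orthogonal_transformation_def)
  have orth1: "orthogonal_transformation refl_1" by (rule orthogonal_refl_along) simp
  show ?case
  proof (cases "\<exists>i. f (axis i 1) \<noteq> axis i 1")
    case False
    then have "matrix f = mat 1" by (simp add: matrix_def mat_def vec_eq_iff axis_def)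
    then have det: "det (matrix f) = 1" and id: "f u = u" for u
      using matrix_works_real[OF linf, of u] by simp_all
    have "acts (1, 0, 0, 1) f (\<lambda>_. 1)"
      by (rule actsI) (simp_all add: id mact_def lvec_eq_pt)
    then show ?thesis using det by auto
  next
    case True
    then obtain i where i: "f (axis i 1) \<noteq> axis i 1" by blast
    \<comment> \<open>The reflection along this difference sends \<open>f (axis i 1)\<close> back to
      \<open>axis i 1\<close> and fixes every basis vector that \<open>f\<close> fixes, since these
      are orthogonal to \<open>d\<close>.\<close>
    define d where "d = f (axis i 1) - axis i 1"
    define m where "m = (1 / norm d) *\<^sub>R d"
    have d: "norm d \<noteq> 0" using i by (simp add: d_def)
    then have m: "norm m = 1" by (simp add: m_def)
    define g where "g u = refl_along m (f u)" for u
    have orth_m: "orthogonal_transformation (refl_along m)" by (rule orthogonal_refl_along[OF m])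
    have g: "orthogonal_transformation g"
      unfolding g_def using orthogonal_transformation_compose[OF orth_m less.prems] by (simp add: o_def)
    have fg: "f u = refl_along m (g u)" for u by (simp add: g_def refl_along_involution[OF m])
    have inner: "f v \<bullet> f w = v \<bullet> w" for v w using less.prems by (simp add: orthogonal_transformation_def)
    have "g (axis i 1) = axis i 1"
    proof -
      have "d \<bullet> d = 2 * (f (axis i 1) \<bullet> d)"
        using inner[of "axis i 1" "axis i 1"] by (simp add: d_def inner_diff_left inner_diff_right inner_commute)
      then have "2 * (f (axis i 1) \<bullet> d) = norm d * norm d" by (simp add: power2_norm_eq_inner[symmetric] power2_eq_square)
      then have "(2 * (f (axis i 1) \<bullet> m)) *\<^sub>R m = d" using d by (simp add: m_def field_simps)
      then show ?thesis by (simp add: g_def refl_along_def d_def)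
    qed
    moreover have "g (axis j 1) = axis j 1" if "f (axis j 1) = axis j 1" for j
    proof -
      have "axis j 1 \<bullet> d = 0" using inner[of "axis j 1" "axis i 1"] that by (simp add: d_def inner_diff_right)
      then show ?thesis using that by (simp add: g_def refl_along_def m_def)
    qed
    ultimately have "{j. g (axis j 1) \<noteq> axis j 1} \<subset> {j. f (axis j 1) \<noteq> axis j 1}" using i by auto
    then have card: "card {j. g (axis j 1) \<noteq> axis j 1} < card {j. f (axis j 1) \<noteq> axis j 1}"
      by (intro psubset_card_mono) auto
    note IH = less.hyps[OF card g]
    have "f = refl_along m \<circ> g" by (rule ext) (simp add: fg)
    then have "matrix f = matrix (refl_along m) ** matrix g"
      using matrix_compose[of g "refl_along m"] g orth_m by (simp only: orthogonal_transformation_def)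
    then have det: "det (matrix f) = - det (matrix g)" by (simp add: det_mul det_refl_along[OF m])
    have "\<exists>M. acts M f (\<lambda>_. 1)" if "det (matrix f) = 1"
    proof -
      have "det (matrix g) = -1" using that det by simp
      then obtain M where M: "acts M (\<lambda>u. refl_1 (g u)) (\<lambda>_. 1)" using IH by blast
      obtain K where K: "acts K (\<lambda>u. refl_along m (refl_1 u)) (\<lambda>_. 1)" using acts_two_reflections[OF m] by blast
      have eq: "(\<lambda>u. refl_along m (refl_1 (refl_1 (g u)))) = f" by (simp add: fun_eq_iff refl_along_involution fg)
      show ?thesis using acts_mmul[OF K M] unfolding eq mult_1 by (rule exI)
    qed
    moreover have "\<exists>M. acts M (\<lambda>u. refl_1 (f u)) (\<lambda>_. 1)" if "det (matrix f) = -1"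
    proof -
      have "det (matrix g) = 1" using that det by simp
      then obtain M where M: "acts M g (\<lambda>_. 1)" using IH by blast
      have "norm (refl_1 m) = 1" using m orthogonal_transformation_norm[OF orth1] by simp
      then obtain K where K: "acts K (\<lambda>u. refl_along (refl_1 m) (refl_1 u)) (\<lambda>_. 1)"
        using acts_two_reflections by blast
      \<comment> \<open>Moving \<open>refl_1\<close> past a reflection replaces its direction
        \<open>m\<close> by \<open>refl_1 m\<close>.\<close>
      have "refl_along (refl_1 m) (refl_1 u) = refl_1 (refl_along m u)" for u
        using orth1 by (simp add: refl_along_def[of "refl_1 m"] refl_along_def[of m] orthogonal_transformation_def linear_diff linear_cmul)
      then have eq: "(\<lambda>u. refl_along (refl_1 m) (refl_1 (g u))) = (\<lambda>u. refl_1 (f u))" by (simp add: fg)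
      show ?thesis using acts_mmul[OF K M] unfolding eq mult_1 by (rule exI)
    qed
    ultimately show ?thesis by blast
  qed
qed

lemma orthogonal_SO5: "R \<in> SO5 \<Longrightarrow> orthogonal_transformation ((*v) R)"
  by (simp add: SO5_def orthogonal_transformation_matrix)

lemma acts_SO5: "R \<in> SO5 \<Longrightarrow> \<exists>M. acts M ((*v) R) (\<lambda>_. 1)"
  using acts_rotation[OF orthogonal_SO5[of R]] by (simp add: SO5_def)

text \<open>In the chart this boost is the dilation by \<open>(1 + s) / (1 - s)\<close>, given by a
  real diagonal matrix.\<close>

lemma acts_boost_axis:
  assumes s: "0 \<le> s" "s < 1"
  shows "\<exists>M. acts M (boost (s *\<^sub>R axis 5 1)) (bden (s *\<^sub>R axis 5 1))"
proof
  let ?w = "s *\<^sub>R axis 5 1 :: real^5"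
  define M where "M = (qre (1 + s), 0 :: quat, 0 :: quat, qre (1 - s))"
  have w: "norm ?w < 1" using s by simp
  have ip: "u \<bullet> ?w = s * u $ 5" "?w \<bullet> ?w = s * s" for u by (simp_all add: inner_axis inner_axis_axis)
  have v: "vnorm2 (mact M z) = (1 + s * s) * vnorm2 z - 2 * s * lvec z $ 5" for z
    by (cases z) (simp add: M_def mact_def vnorm2_def lvec_sel qnorm2_mult, simp add: qnorm2_def power2_eq_square algebra_simps)
  have l: "lvec (mact M z) = (1 - s * s) *\<^sub>R (lvec z - (vnorm2 z) *\<^sub>R ?w) - ((1 + s * s) * vnorm2 z - 2 * s * lvec z $ 5) *\<^sub>R ?w" for z
    by (cases z) (simp add: vec5_eq_iff M_def mact_def vnorm2_def lvec_sel qnorm2_mult axis_def,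
        simp add: qnorm2_def power2_eq_square algebra_simps)
  show "acts M (boost ?w) (\<lambda>u. bden ?w u)"
  proof (rule actsI)
    show pos: "bden ?w u > 0" if "norm u = 1" for u by (rule bden_pos[OF that w])
    fix z assume z: "nzv z"
    define D where "D = bden ?w (pt z)"
    have D: "D > 0" unfolding D_def by (rule pos[OF norm_pt[OF z]])
    have Dv: "(1 + s * s) * vnorm2 z - 2 * s * lvec z $ 5 = D * vnorm2 z"
      by (simp add: D_def ip lvec_eq_pt[OF z] inner_axis algebra_simps)
    show "vnorm2 (mact M z) = bden ?w (pt z) * vnorm2 z"
      unfolding D_def[symmetric] v Dv ..
    have "lvec (mact M z) = ((1 - s * s) * vnorm2 z) *\<^sub>R (pt z - ?w) - (D * vnorm2 z) *\<^sub>R ?w"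
      unfolding l Dv unfolding lvec_eq_pt[OF z] by (simp add: algebra_simps)
    also have "\<dots> = (D * vnorm2 z) *\<^sub>R boost ?w (pt z)"
    proof -
      have "(c * v) *\<^sub>R x - (D * v) *\<^sub>R y = (D * v) *\<^sub>R ((c / D) *\<^sub>R x - y)" for c v and x y :: "real^5"
        using D by (simp add: scaleR_diff_right mult.commute)
      then show ?thesis unfolding boost_def D_def[symmetric] unfolding ip(2) .
    qed
    finally show "lvec (mact M z) = (bden ?w (pt z) * vnorm2 z) *\<^sub>R boost ?w (pt z)"
      unfolding D_def .
  qed
qed

text \<open>A rotation taking the fifth axis to the direction of \<open>w\<close> conjugates the
  boost along that axis into the given one; its inverse is again a rotation and so is also realised
  by a matrix.\<close>

lemma acts_boost:
  assumes w: "norm (w :: real^5) < 1"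
  shows "\<exists>M. acts M (boost w) (\<lambda>u. bden w u)"
proof -
  let ?e = "norm w *\<^sub>R axis 5 1 :: real^5"
  have "norm ?e = norm w" by simp
  then obtain f where f: "orthogonal_transformation f" "det (matrix f) = 1" "f ?e = w"
    using rotation_exists[of ?e w] by auto
  obtain f' where f': "orthogonal_transformation f'" "det (matrix f') = 1" and inv: "\<And>u. f (f' u) = u"
  proof -
    have linf: "linear f" using f by (simp add: orthogonal_transformation_def)
    have om: "orthogonal_matrix (matrix f)" using f by (simp add: orthogonal_transformation_matrix)
    have "orthogonal_transformation ((*v) (transpose (matrix f)))"
      using om by (simp add: orthogonal_transformation_matrix orthogonal_matrix_transpose)
    moreover have "det (matrix ((*v) (transpose (matrix f)))) = 1" using f by (simp add: det_transpose)
    moreover have "f (transpose (matrix f) *v u) = u" for u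
    proof -
      have "matrix f *v (transpose (matrix f) *v u) = u"
        unfolding matrix_vector_mul_assoc using om by (simp add: orthogonal_matrix_def)
      then show ?thesis by (simp only: matrix_works_real[OF linf])
    qed
    ultimately show ?thesis using that by blast
  qed
  obtain A where A: "acts A f (\<lambda>_. 1)" using acts_rotation[OF f(1)] f(2) by blast
  obtain A' where A': "acts A' f' (\<lambda>_. 1)" using acts_rotation[OF f'(1)] f'(2) by blast
  obtain B where B: "acts B (boost ?e) (\<lambda>u. bden ?e u)" using acts_boost_axis[of "norm w"] w by auto
  have in_f: "f u \<bullet> f v = u \<bullet> v" for u v using f(1) by (simp add: orthogonal_transformation_def)
  have acts: "acts (mmul A (mmul B A')) (\<lambda>u. f (boost ?e (f' u))) (\<lambda>u. bden ?e (f' u))"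
    using acts_mmul[OF A acts_mmul[OF B A']] by simp
  have g: "f (boost ?e (f' u)) = boost w u" for u
    using boost_orthogonal[OF f(1), of ?e "f' u"] unfolding f(3) inv ..
  have N1: "f' u \<bullet> ?e = u \<bullet> w" for u using in_f[of "f' u" ?e] unfolding inv f(3) by (rule sym)
  have N2: "?e \<bullet> ?e = w \<bullet> w" using in_f[of ?e ?e] unfolding f(3) by (rule sym)
  show ?thesis using acts unfolding g N1 N2 by (rule exI)
qed

section \<open>The action of a nonsingular matrix as a boost followed by a rotation\<close>

lemma qcnj_mult: "qcnj (x * y) = qcnj y * qcnj x"
  by (simp add: quat_eq_iff algebra_simps)

lemma q0_mult_commute: "q0 (x * y) = q0 (y * x)"
  by (simp add: algebra_simps)

lemma qnorm2_add: "qnorm2 (x + y) = qnorm2 x + qnorm2 y + 2 * q0 (x * qcnj y)"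
  by (simp add: qnorm2_def power2_eq_square algebra_simps)

definition herm :: "qvec \<Rightarrow> qvec \<Rightarrow> quat" where
  "herm z w = qcnj (fst z) * fst w + qcnj (snd z) * snd w"

lemma q0_mult_qcnj_swap: "q0 (x * qcnj (y * l)) = q0 (qcnj x * y * l)"
  by (simp add: algebra_simps)

text \<open>Polarisation: as \<open>l\<close> runs over 1 and the imaginary units, the cross term
  recovers all four components of \<open>herm z w\<close>.\<close>

lemma vnorm2_add_rscale: "vnorm2 (z + rscale w l) = vnorm2 z + qnorm2 l * vnorm2 w + 2 * q0 (herm z w * l)"
proof -
  have "q0 (herm z w * l) = q0 (fst z * qcnj (fst w * l)) + q0 (snd z * qcnj (snd w * l))"
    unfolding q0_mult_qcnj_swap herm_def distrib_right quat_sel(9) ..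
  then show ?thesis
    by (simp only: vnorm2_def rscale_def fst_add snd_add fst_conv snd_conv qnorm2_add qnorm2_mult) (simp add: algebra_simps)
qed

lemma mact_add: "mact M (z + w) = mact M z + mact M w"
  by (cases M) (simp add: mact_def algebra_simps)

text \<open>For given \<open>vnorm2\<close>, the angle between two points of the sphere depends only
  on the modulus of \<open>herm\<close>, so a map that scales both forms alike preserves it.\<close>

lemma inner_lvec_herm: "vnorm2 z * vnorm2 w + lvec z \<bullet> lvec w = 2 * qnorm2 (herm z w)"
  by (cases z; cases w) (simp add: vnorm2_def inner_5 lvec_sel herm_def qnorm2_def power2_eq_square algebra_simps)

text \<open>Polarisation turns the constant multiplier into a scaling of the modulus of
  \<open>herm\<close>, hence an isometry of the sphere, and such isometries extend to orthogonal
  maps.\<close>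

lemma conformal_acts_orthogonally:
  assumes k: "k > 0" and K: "\<And>z. vnorm2 (mact M z) = k * vnorm2 z"
  shows "\<exists>f. orthogonal_transformation f \<and> (\<forall>z. nzv z \<longrightarrow> pt (mact M z) = f (pt z))"
proof -
  have nonsing: "nonsing M" unfolding nonsing_def using k K by (metis mult_eq_0_iff vnorm2_eq_0 less_irrefl)
  have herm: "qnorm2 (herm (mact M z) (mact M w)) = k * k * qnorm2 (herm z w)" for z w
  proof -
    have "q0 (herm (mact M z) (mact M w) * l) = k * q0 (herm z w * l)" for l
      using vnorm2_add_rscale[of "mact M z" "mact M w" l] K[of "z + rscale w l"]
      unfolding mact_add mact_rscale vnorm2_add_rscale[of z w l] K by (simp add: algebra_simps)
    from this[of 1] this[of "Quat 0 1 0 0"] this[of "Quat 0 0 1 0"] this[of "Quat 0 0 0 1"]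
    show ?thesis by (simp add: qnorm2_def power2_eq_square algebra_simps)
  qed
  have inner: "lvec (mact M z) \<bullet> lvec (mact M w) = k * k * (lvec z \<bullet> lvec w)" for z w
  proof -
    have "k * k * (vnorm2 z * vnorm2 w + lvec z \<bullet> lvec w) = k * k * (2 * qnorm2 (herm z w))"
      by (simp only: inner_lvec_herm)
    then show ?thesis
      using inner_lvec_herm[of "mact M z" "mact M w"] herm[of z w] unfolding K by (simp add: algebra_simps)
  qed
  have pt_inner: "pt (mact M z) \<bullet> pt (mact M w) = pt z \<bullet> pt w" for z w
    unfolding pt_def K inner_scaleR_left inner_scaleR_right inner using k by (simp add: field_simps)
  define f where "f s = pt (mact M (SOME z. nzv z \<and> pt z = s))" for s
  have f_pt: "f (pt z) = pt (mact M z)" if z: "nzv z" for z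
  proof -
    have "nzv (SOME z'. nzv z' \<and> pt z' = pt z) \<and> pt (SOME z'. nzv z' \<and> pt z' = pt z) = pt z"
      by (rule someI[of "\<lambda>z'. nzv z' \<and> pt z' = pt z" z]) (use z in simp)
    then show ?thesis unfolding f_def using pt_mact_cong[OF nonsing _ z] by blast
  qed
  have dist_sq: "(dist a b)\<^sup>2 = 2 - 2 * (a \<bullet> b)" if "norm a = 1" "norm b = 1" for a b :: "real^5"
    using that by (simp add: dist_norm power2_norm_eq_inner inner_diff_left inner_diff_right norm_eq_1 inner_commute)
  have "\<exists>g. orthogonal_transformation g \<and> (\<forall>x. norm x = 1 \<longrightarrow> g x = f x)"
  proof (rule isometry_sphere_extend)
    show f1: "norm (f x) = 1" if x: "norm x = 1" for x
    proof -
      obtain z where "nzv z" "pt z = x" using pt_surj[OF x] .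
      then show ?thesis using f_pt norm_pt nonsingD[OF nonsing] by metis
    qed
    show "dist (f x) (f y) = dist x y" if x: "norm x = 1" and y: "norm y = 1" for x y
    proof -
      obtain z where z: "nzv z" "pt z = x" using pt_surj[OF x] .
      obtain w where w: "nzv w" "pt w = y" using pt_surj[OF y] .
      have "f x \<bullet> f y = x \<bullet> y" using f_pt[OF z(1)] f_pt[OF w(1)] pt_inner[of z w] z w by simp
      then have "(dist (f x) (f y))\<^sup>2 = (dist x y)\<^sup>2" by (simp add: dist_sq f1 x y)
      then show ?thesis by (simp add: power2_eq_iff_nonneg)
    qed
  qed
  then show ?thesis using f_pt norm_pt by metis
qed

text \<open>\<open>\<alpha>\<close>, \<open>\<beta>\<close>, \<open>\<gamma>\<close> are the entries
  of the conjugate transpose of \<open>M\<close> times \<open>M\<close>, and the Hermitian form is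
  linear in \<open>vnorm2\<close> and \<open>lvec\<close>. For \<open>k\<close> nonzero the strict
  inequality is positivity of the multiplier at the point of the sphere opposite to
  \<open>k\<close>.\<close>

lemma nonsing_multiplier:
  assumes M: "nonsing M"
  shows "\<exists>k0 k. norm k < k0 \<and> (\<forall>z. vnorm2 (mact M z) = k0 * vnorm2 z + k \<bullet> lvec z)"
proof -
  obtain a b c d where Md: "M = (a, b, c, d)" by (cases M)
  define \<beta> where "\<beta> = qcnj a * b + qcnj c * d"
  define \<alpha> where "\<alpha> = qnorm2 a + qnorm2 c"
  define \<gamma> where "\<gamma> = qnorm2 b + qnorm2 d"
  define k0 where "k0 = (\<alpha> + \<gamma>) / 2"
  define k :: "real^5" where "k = vector [q0 \<beta>, q1 \<beta>, q2 \<beta>, q3 \<beta>, (\<gamma> - \<alpha>) / 2]"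
  have cross: "q0 (a * x * qcnj (b * y)) = q0 (x * qcnj y * qcnj (qcnj a * b))" for a b x y
  proof -
    have "q0 (a * x * qcnj (b * y)) = q0 (a * (x * qcnj y * qcnj b))" by (simp only: qcnj_mult mult.assoc)
    also have "\<dots> = q0 (x * qcnj y * qcnj b * a)" by (rule q0_mult_commute)
    also have "qcnj b * a = qcnj (qcnj a * b)" by (simp add: quat_eq_iff algebra_simps)
    then have "x * qcnj y * qcnj b * a = x * qcnj y * qcnj (qcnj a * b)" by (simp only: mult.assoc)
    finally show ?thesis .
  qed
  have eq: "vnorm2 (mact M z) = k0 * vnorm2 z + k \<bullet> lvec z" for z
  proof -
    let ?p = "fst z * qcnj (snd z)"
    have "vnorm2 (mact M z) = \<alpha> * qnorm2 (fst z) + \<gamma> * qnorm2 (snd z) + 2 * (q0 (?p * qcnj (qcnj a * b)) + q0 (?p * qcnj (qcnj c * d)))"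
      by (simp only: Md mact_def vnorm2_def qnorm2_add qnorm2_mult
          cross[of a "fst z" b "snd z"] cross[of c "fst z" d "snd z"] \<alpha>_def \<gamma>_def prod.case fst_conv snd_conv) (simp add: algebra_simps)
    also have "q0 (?p * qcnj (qcnj a * b)) + q0 (?p * qcnj (qcnj c * d)) = q0 (?p * qcnj \<beta>)"
    proof -
      have "qcnj \<beta> = qcnj (qcnj a * b) + qcnj (qcnj c * d)" unfolding \<beta>_def by (simp add: quat_eq_iff)
      then show ?thesis by (simp only: distrib_left quat_sel(9))
    qed
    also have "2 * q0 (?p * qcnj \<beta>) = k$1 * lvec z$1 + k$2 * lvec z$2 + k$3 * lvec z$3 + k$4 * lvec z$4"
      unfolding lvec_sel k_def vector_5 quat_sel(21)[of ?p "qcnj \<beta>"] qcnj_sel by (simp add: algebra_simps)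
    finally show ?thesis
      unfolding inner_5 by (simp add: k_def k0_def vnorm2_def lvec_sel(5) field_simps)
  qed
  have "norm k < k0"
  proof (cases "k = 0")
    case True
    have "vnorm2 (mact M (1, 0)) > 0" by (rule vnorm2_pos[OF nonsingD[OF M]]) simp
    moreover have "vnorm2 (1, 0) = 1" by (simp add: vnorm2_def qnorm2_def)
    ultimately show ?thesis using eq[of "(1, 0)"] True by simp
  next
    case False
    obtain z where z: "nzv z" "pt z = - (1 / norm k) *\<^sub>R k" using pt_surj[of "- (1 / norm k) *\<^sub>R k"] False by auto
    have "vnorm2 (mact M z) = vnorm2 z * (k0 + k \<bullet> pt z)" unfolding eq lvec_eq_pt[OF z(1)] by (simp add: algebra_simps)
    moreover have "k \<bullet> pt z = - norm k" using False by (simp add: z(2) power2_norm_eq_inner[symmetric] power2_eq_square)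
    moreover have "vnorm2 (mact M z) > 0" "vnorm2 z > 0" using vnorm2_pos nonsingD[OF M] z by blast+
    ultimately show ?thesis by (simp add: zero_less_mult_iff)
  qed
  then show ?thesis using eq by blast
qed

lemma affine_positive_eq_distance:
  fixes k :: "'a::real_inner"
  assumes k: "norm k < k0"
  shows "\<exists>w c. norm w < 1 \<and> c > 0 \<and> (\<forall>u. k0 + k \<bullet> u = c * bden w u)"
proof -
  define e where "e = sqrt (k0\<^sup>2 - k \<bullet> k)"
  have k0: "k0 > 0" using k norm_ge_zero[of k] by linarith
  have "k \<bullet> k \<le> k0\<^sup>2" using k by (simp add: power2_norm_eq_inner[symmetric] power_mono)
  then have e: "e \<ge> 0" "e * e = k0\<^sup>2 - k \<bullet> k" by (simp_all add: e_def)
  \<comment> \<open>The smaller root of \<open>1 + b * b * (k \<bullet> k) = 2 * k0 * b\<close>, in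
    a form that also makes sense for \<open>k = 0\<close>; being smaller it puts \<open>w\<close>
    inside the ball.\<close>
  define b where "b = 1 / (k0 + e)"
  have b: "b > 0" using k0 e by (simp add: b_def)
  have quad: "1 + b * b * (k \<bullet> k) = 2 * k0 * b"
  proof -
    have "k \<bullet> k = (k0 - e) * (k0 + e)" using e by (simp add: algebra_simps power2_eq_square)
    then have "b * b * (k \<bullet> k) = b * (k0 - e)" using k0 e by (simp add: b_def)
    moreover have "b * (k0 + e) = 1" using k0 e by (simp add: b_def)
    ultimately show ?thesis by (simp add: algebra_simps)
  qed
  define w where "w = - b *\<^sub>R k"
  have "norm w = b * norm k" using b by (simp add: w_def)
  also have "\<dots> < b * (k0 + e)" using b k e by (intro mult_strict_left_mono) auto
  also have "\<dots> = 1" using k0 e by (simp add: b_def)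
  finally have "norm w < 1" .
  moreover have "k0 + k \<bullet> u = 1 / (2 * b) * bden w u" for u
  proof -
    have "bden w u = (1 + b * b * (k \<bullet> k)) + 2 * b * (k \<bullet> u)" by (simp add: w_def inner_commute)
    also have "\<dots> = 2 * b * (k0 + k \<bullet> u)" unfolding quad by (simp add: algebra_simps)
    finally show ?thesis using b by simp
  qed
  ultimately show ?thesis using b by (intro exI[of _ w] exI[of _ "1 / (2 * b)"]) simp
qed

text \<open>In the chart the matrix would satisfy \<open>a * v + b = - qcnj v * (c * v + d)\<close>.
  The values 0, 1 and -1 give \<open>b = 0\<close>, \<open>c = 0\<close> and \<open>a = - d\<close>;
  then \<open>d\<close> anticommutes with all three imaginary units and vanishes.\<close>

lemma not_acts_refl_1: "\<not> acts M refl_1 N"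
proof
  assume acts: "acts M refl_1 N"
  obtain a b c d where M: "M = (a, b, c, d)" by (cases M)
  have eq: "a * v + b = - qcnj v * (c * v + d)" for v
  proof -
    have "refl_1 (pt (v, 1)) = pt (- qcnj v, 1)"
      by (simp add: vec5_eq_iff pt_def lvec_sel vnorm2_def) (simp add: qnorm2_def)
    then have "pt (- qcnj v, 1) = pt (mact M (v, 1))" using acts by (simp add: acts_def)
    moreover have "nzv (mact M (v, 1))" by (rule nonsingD) (use acts in \<open>auto simp: acts_def\<close>)
    ultimately obtain l where "mact M (v, 1) = rscale (- qcnj v, 1) l"
      using pt_eq_imp_rscale[of "(- qcnj v, 1)" "mact M (v, 1)"] by auto
    then show ?thesis by (auto simp: M mact_def rscale_def)
  qed
  from eq[of 0] eq[of 1] eq[of "- 1"] eq[of "Quat 0 1 0 0"] eq[of "Quat 0 0 1 0"] eq[of "Quat 0 0 0 1"]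
  have "b = 0" "d = 0" by (auto simp: quat_eq_iff)
  then have "mact M (0, 1) = (0, 0)" by (simp add: M mact_def)
  moreover have "nzv (mact M (0, 1))" by (rule nonsingD) (use acts in \<open>auto simp: acts_def\<close>)
  ultimately show False by simp
qed

lemma transpose_SO5: "R \<in> SO5 \<Longrightarrow> transpose R \<in> SO5"
  by (simp add: SO5_def orthogonal_matrix_transpose det_transpose)

lemma SO5_transpose_mult: "R \<in> SO5 \<Longrightarrow> R *v (transpose R *v u) = u" "R \<in> SO5 \<Longrightarrow> transpose R *v (R *v u) = u"
  unfolding matrix_vector_mul_assoc by (simp_all add: SO5_def orthogonal_matrix_def)

theorem nonsing_decompose:
  assumes M: "nonsing M"
  shows "\<exists>R\<in>SO5. \<exists>w. norm w < 1 \<and> (\<forall>z. nzv z \<longrightarrow> pt (mact M z) = R *v boost w (pt z))"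
proof -
  obtain k0 k where k: "norm k < k0" and mult: "\<And>z. vnorm2 (mact M z) = k0 * vnorm2 z + k \<bullet> lvec z"
    using nonsing_multiplier[OF M] by blast
  obtain w c where w: "norm w < 1" and c: "c > 0" and kc: "\<And>u. k0 + k \<bullet> u = c * bden w u"
    using affine_positive_eq_distance[OF k] by blast
  have w': "norm (- w) < 1" using w by simp
  obtain B where B: "acts B (boost (- w)) (\<lambda>u. bden (- w) u)" using acts_boost[OF w'] by blast
  obtain B' where B': "acts B' (boost w) (\<lambda>u. bden w u)" using acts_boost[OF w] by blast
  have nB: "nonsing B" "nonsing B'" using B B' by (auto simp: acts_def)
  define K where "K = mmul M B"
  have nK: "nonsing K" unfolding K_def by (rule nonsing_mmul[OF M nB(1)])
  \<comment> \<open>The denominators of the boosts by \<open>w\<close> and \<open>- w\<close>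
    multiply to a constant, so composing with \<open>B\<close> makes the multiplier of
    \<open>K\<close> constant.\<close>
  define \<kappa> where "\<kappa> = c * (1 - w \<bullet> w)\<^sup>2"
  have \<kappa>: "\<kappa> > 0" using c inner_self_less_1[OF w] by (simp add: \<kappa>_def)
  have "vnorm2 (mact K z) = \<kappa> * vnorm2 z" for z
  proof (cases "nzv z")
    case True
    define y where "y = boost (- w) (pt z)"
    have Bz: "pt (mact B z) = y" "vnorm2 (mact B z) = bden (- w) (pt z) * vnorm2 z"
      using B True unfolding acts_def y_def by blast+
    have y: "norm y = 1" unfolding y_def by (rule norm_boost[OF norm_pt[OF True] w'])
    have "vnorm2 (mact K z) = (k0 + k \<bullet> y) * vnorm2 (mact B z)"
      unfolding K_def mact_mmul mult lvec_eq_pt[OF nonsingD[OF nB(1) True]] Bz(1) by (simp add: algebra_simps)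
    also have "k0 + k \<bullet> y = c * (norm (y - w))\<^sup>2" unfolding kc bden_eq[OF y] ..
    also have "(norm (y - w))\<^sup>2 = (1 - w \<bullet> w)\<^sup>2 / (norm (pt z - (- w)))\<^sup>2"
      using norm_boost_plus[OF norm_pt[OF True] w'] by (simp add: y_def)
    also have "vnorm2 (mact B z) = (norm (pt z - (- w)))\<^sup>2 * vnorm2 z"
      unfolding Bz(2) bden_eq[OF norm_pt[OF True]] ..
    finally have "vnorm2 (mact K z) = c * ((1 - w \<bullet> w)\<^sup>2 / (norm (pt z - (- w)))\<^sup>2) * ((norm (pt z - (- w)))\<^sup>2 * vnorm2 z)" .
    moreover have "norm (pt z - (- w)) \<noteq> 0" using bden_pos[OF norm_pt[OF True] w'] bden_eq[OF norm_pt[OF True], of "- w"] by auto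
    ultimately show ?thesis by (simp add: \<kappa>_def)
  next
    case False
    then show ?thesis by (cases K) (simp add: mact_def vnorm2_def)
  qed
  then obtain f where f: "orthogonal_transformation f" and Kf: "\<And>z. nzv z \<Longrightarrow> pt (mact K z) = f (pt z)"
    using conformal_acts_orthogonally[OF \<kappa>] by blast
  have actsK: "acts K f (\<lambda>_. \<kappa>)" unfolding acts_def using nK Kf \<open>\<And>z. vnorm2 (mact K z) = \<kappa> * vnorm2 z\<close> by blast
  define R where "R = matrix f"
  have linf: "linear f" using f by (simp add: orthogonal_transformation_def)
  have Rf: "R *v u = f u" for u unfolding R_def by (rule matrix_works_real[OF linf])
  have oR: "orthogonal_matrix R" using f by (simp add: R_def orthogonal_transformation_matrix)
  have "R \<in> SO5"
  proof (rule ccontr)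
    assume "R \<notin> SO5"
    \<comment> \<open>otherwise the orientation reversing \<open>refl_1\<close> would be induced by a matrix\<close>
    then have det: "det R = -1" using det_orthogonal_matrix[OF oR] oR by (auto simp: SO5_def)
    define S where "S = matrix refl_1 ** R"
    have lin1: "linear refl_1" and or1: "orthogonal_transformation refl_1"
      using orthogonal_refl_along[of "axis 1 1 :: real^5"] by (auto simp: orthogonal_transformation_def)
    have "S \<in> SO5"
      using oR or1 det det_refl_along[of "axis 1 1 :: real^5"]
      by (auto simp: S_def SO5_def det_mul orthogonal_transformation_matrix intro: orthogonal_matrix_mul)
    then obtain M2 where M2: "acts M2 ((*v) (transpose S)) (\<lambda>_. 1)" using acts_SO5[OF transpose_SO5] by blast
    have "f (transpose S *v u) = refl_1 u" for u
    proof -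
      have "refl_1 (f (transpose S *v u)) = S *v (transpose S *v u)"
        unfolding S_def matrix_vector_mul_assoc[symmetric] Rf matrix_works_real[OF lin1] ..
      also have "\<dots> = u" by (rule SO5_transpose_mult(1)[OF \<open>S \<in> SO5\<close>])
      finally have "refl_1 (refl_1 (f (transpose S *v u))) = refl_1 u" by simp
      then show ?thesis by (simp only: refl_along_involution[OF norm_axis_1])
    qed
    then have "acts (mmul K M2) refl_1 (\<lambda>u. \<kappa> * 1)" using acts_mmul[OF actsK M2] by simp
    then show False using not_acts_refl_1 by blast
  qed
  moreover have "pt (mact M z) = R *v boost w (pt z)" if z: "nzv z" for z
  proof -
    \<comment> \<open>\<open>B\<close> undoes \<open>B'\<close> on the sphere, so \<open>M\<close>
      acts there as \<open>K\<close> after \<open>B'\<close>.\<close>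
    let ?y = "mact B' z"
    have y: "nzv ?y" by (rule nonsingD[OF nB(2) z])
    have py: "pt ?y = boost w (pt z)" using B' z unfolding acts_def by blast
    have "pt (mact B ?y) = boost (- w) (boost w (pt z))" using B y py unfolding acts_def by metis
    also have "\<dots> = pt z" by (rule boost_minus[OF norm_pt[OF z] w])
    finally have "pt (mact M (mact B ?y)) = pt (mact M z)"
      by (intro pt_mact_cong[OF M nonsingD[OF nB(1) y] z])
    then show ?thesis using Kf[OF y] py by (simp add: K_def mact_mmul Rf)
  qed
  ultimately show ?thesis using w by blast
qed

section \<open>Configurations of points\<close>

definition hp1n_of :: "real^5^'n::finite \<Rightarrow> 'n \<Rightarrow> hp1" where
  "hp1n_of u = (\<lambda>i. S4_to_hp1 (u $ i))"

definition spheres :: "(real^5^'n::finite) set" where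
  "spheres = {u. \<forall>i. norm (u $ i) = 1}"

text \<open>The orbit relation of \<open>SL2H\<close> in sphere coordinates, through which the two
  quotients are compared.\<close>

definition conf_equiv :: "real^5^'n::finite \<Rightarrow> real^5^'n \<Rightarrow> bool" where
  "conf_equiv u v \<longleftrightarrow> (\<exists>R\<in>SO5. \<exists>w. norm w < 1 \<and> (\<forall>i. v $ i = R *v boost w (u $ i)))"

definition saturate :: "(real^5^'n::finite) set \<Rightarrow> (real^5^'n) set" where
  "saturate W = {v \<in> spheres. \<exists>u\<in>W. conf_equiv u v}"

definition so5_orbit :: "real^5^'n::finite \<Rightarrow> (real^5^'n) set" where
  "so5_orbit u = {(\<chi> i. R *v (u $ i)) | R. R \<in> SO5}"

lemma norm_SO5: "R \<in> SO5 \<Longrightarrow> norm (R *v u) = norm u"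
  using orthogonal_transformation_norm[OF orthogonal_SO5] .

lemma mat_1_SO5: "mat 1 \<in> SO5"
  by (simp add: SO5_def orthogonal_matrix_id)

lemma U_r_spheres: "U_r r \<subseteq> spheres"
  by (auto simp: U_r_def spheres_def)

lemma hp1n_emb_of: "u \<in> spheres \<Longrightarrow> hp1n_emb (hp1n_of u) = u"
  by (simp add: hp1n_emb_def hp1n_of_def spheres_def vec_eq_iff hp1_to_S4_to_hp1)

lemma hp1n_of_emb: "(\<And>i. p i \<in> HP1) \<Longrightarrow> hp1n_of (hp1n_emb p) = p"
  by (simp add: hp1n_emb_def hp1n_of_def S4_to_hp1_to_S4)

lemma hp1n_emb_spheres: "(\<And>i. p i \<in> HP1) \<Longrightarrow> hp1n_emb p \<in> spheres"
  by (simp add: hp1n_emb_def spheres_def norm_hp1_to_S4)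

lemma mat_act_decompose:
  assumes "nonsing M"
  obtains R w where "R \<in> SO5" "norm w < 1"
    "\<And>s. norm s = 1 \<Longrightarrow> mat_act M (S4_to_hp1 s) = S4_to_hp1 (R *v boost w s)"
proof -
  obtain R w where R: "R \<in> SO5" and w: "norm w < 1" and eq: "\<And>z. nzv z \<Longrightarrow> pt (mact M z) = R *v boost w (pt z)"
    using nonsing_decompose[OF assms] by blast
  have "mat_act M (S4_to_hp1 s) = S4_to_hp1 (R *v boost w s)" if s: "norm s = 1" for s
  proof -
    obtain z where "nzv z" "pt z = s" using pt_surj[OF s] .
    then show ?thesis using mat_act_S4_to_hp1_pt[OF assms] eq by metis
  qed
  then show ?thesis using that R w by blast
qed

lemma mat_act_compose:
  assumes R: "R \<in> SO5" and w: "norm w < 1"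
  obtains M where "M \<in> SL2H" "\<And>s. norm s = 1 \<Longrightarrow> mat_act M (S4_to_hp1 s) = S4_to_hp1 (R *v boost w s)"
proof -
  obtain A where A: "acts A ((*v) R) (\<lambda>_. 1)" using acts_SO5[OF R] by blast
  obtain B where B: "acts B (boost w) (\<lambda>u. bden w u)" using acts_boost[OF w] by blast
  note AB = acts_mmul[OF A B]
  then have "nonsing (mmul A B)" by (simp add: acts_def)
  then obtain M where M: "M \<in> SL2H" "\<And>x y. mat_act M (hp1_class x y) = mat_act (mmul A B) (hp1_class x y)"
    by (rule nonsing_imp_SL2H) blast
  have "mat_act M (S4_to_hp1 s) = S4_to_hp1 (R *v boost w s)" if s: "norm s = 1" for s
  proof -
    obtain x y where "S4_to_hp1 s = hp1_class x y" using S4_to_hp1_in_HP1[OF s] by (auto simp: HP1_eq)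
    then show ?thesis using acts_S4_to_hp1[OF AB s] M(2) by simp
  qed
  then show ?thesis using that M by blast
qed

lemma G_orbit_hp1n_of:
  assumes u: "u \<in> spheres"
  shows "G_orbit (hp1n_of u) = hp1n_of ` {v. conf_equiv u v}"
proof (rule set_eqI, rule iffI)
  fix p assume "p \<in> G_orbit (hp1n_of u)"
  then obtain A where A: "A \<in> SL2H" and p: "p = (\<lambda>i. mat_act A (S4_to_hp1 (u $ i)))"
    by (auto simp: G_orbit_def hp1n_of_def)
  obtain R w where R: "R \<in> SO5" "norm w < 1" and eq: "\<And>s. norm s = 1 \<Longrightarrow> mat_act A (S4_to_hp1 s) = S4_to_hp1 (R *v boost w s)"
    using mat_act_decompose[OF nonsing_SL2H[OF A]] by blast
  have "p = hp1n_of (\<chi> i. R *v boost w (u $ i))" using u by (simp add: p hp1n_of_def eq spheres_def)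
  moreover have "conf_equiv u (\<chi> i. R *v boost w (u $ i))" unfolding conf_equiv_def using R by auto
  ultimately show "p \<in> hp1n_of ` {v. conf_equiv u v}" by blast
next
  fix p assume "p \<in> hp1n_of ` {v. conf_equiv u v}"
  then obtain v R w where p: "p = hp1n_of v" and R: "R \<in> SO5" "norm w < 1" and v: "\<And>i. v $ i = R *v boost w (u $ i)"
    by (auto simp: conf_equiv_def)
  obtain M where M: "M \<in> SL2H" and eq: "\<And>s. norm s = 1 \<Longrightarrow> mat_act M (S4_to_hp1 s) = S4_to_hp1 (R *v boost w s)"
    using mat_act_compose[OF R] by blast
  have "p = (\<lambda>i. mat_act M (hp1n_of u i))" using u by (simp add: p hp1n_of_def v eq spheres_def)
  then show "p \<in> G_orbit (hp1n_of u)" unfolding G_orbit_def using M by blast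
qed

lemma conf_equiv_spheres: "conf_equiv u v \<Longrightarrow> u \<in> spheres \<Longrightarrow> v \<in> spheres"
  unfolding conf_equiv_def spheres_def by (auto simp: norm_SO5 norm_boost)

lemma conf_equiv_refl: "conf_equiv u u"
  unfolding conf_equiv_def by (intro bexI[of _ "mat 1"] exI[of _ 0]) (auto simp: mat_1_SO5)

text \<open>A rotation \<open>R\<close> carries the boost by \<open>w\<close> to the boost by
  \<open>R *v w\<close>, so the inverse map is the boost by \<open>- (R *v w)\<close> followed by
  \<open>transpose R\<close>.\<close>

lemma conf_equiv_sym:
  assumes "conf_equiv u v" and u: "u \<in> spheres"
  shows "conf_equiv v u"
proof -
  obtain R w where R: "R \<in> SO5" and w: "norm w < 1" and v: "\<And>i. v $ i = R *v boost w (u $ i)"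
    using assms by (auto simp: conf_equiv_def)
  have "u $ i = transpose R *v boost (- (R *v w)) (v $ i)" for i
  proof -
    have neg: "- (R *v w) = R *v (- w)" by (simp add: linear_neg[OF matrix_vector_mul_linear])
    have "transpose R *v boost (- (R *v w)) (v $ i) = transpose R *v (R *v boost (- w) (boost w (u $ i)))"
      unfolding neg v by (simp only: boost_orthogonal[OF orthogonal_SO5[OF R]])
    also have "\<dots> = u $ i" using SO5_transpose_mult(2)[OF R] boost_minus[OF _ w] u by (simp add: spheres_def)
    finally show ?thesis by simp
  qed
  moreover have "norm (- (R *v w)) < 1" using w by (simp add: norm_SO5[OF R])
  ultimately show ?thesis unfolding conf_equiv_def using transpose_SO5[OF R] by blast
qed

lemma conf_equiv_trans:
  assumes "conf_equiv u v" "conf_equiv v x" and u: "u \<in> spheres"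
  shows "conf_equiv u x"
proof -
  obtain R w where R: "R \<in> SO5" "norm w < 1" and v: "\<And>i. v $ i = R *v boost w (u $ i)"
    using assms by (auto simp: conf_equiv_def)
  obtain R' w' where R': "R' \<in> SO5" "norm w' < 1" and x: "\<And>i. x $ i = R' *v boost w' (v $ i)"
    using assms by (auto simp: conf_equiv_def)
  have vs: "v \<in> spheres" and xs: "x \<in> spheres" using assms conf_equiv_spheres by blast+
  obtain M where M: "M \<in> SL2H" "\<And>s. norm s = 1 \<Longrightarrow> mat_act M (S4_to_hp1 s) = S4_to_hp1 (R *v boost w s)"
    using mat_act_compose[OF R] by blast
  obtain M' where M': "M' \<in> SL2H" "\<And>s. norm s = 1 \<Longrightarrow> mat_act M' (S4_to_hp1 s) = S4_to_hp1 (R' *v boost w' s)"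
    using mat_act_compose[OF R'] by blast
  have ns: "nonsing (mmul M' M)" using nonsing_mmul nonsing_SL2H M M' by blast
  obtain Q y where Q: "Q \<in> SO5" "norm y < 1" and eq: "\<And>s. norm s = 1 \<Longrightarrow> mat_act (mmul M' M) (S4_to_hp1 s) = S4_to_hp1 (Q *v boost y s)"
    using mat_act_decompose[OF ns] by blast
  have "x $ i = Q *v boost y (u $ i)" for i
  proof -
    have n: "norm (u $ i) = 1" "norm (v $ i) = 1" "norm (x $ i) = 1" using u vs xs by (simp_all add: spheres_def)
    obtain a b where ab: "S4_to_hp1 (u $ i) = hp1_class a b" using S4_to_hp1_in_HP1[OF n(1)] by (auto simp: HP1_eq)
    have "mat_act (mmul M' M) (S4_to_hp1 (u $ i)) = mat_act M' (mat_act M (S4_to_hp1 (u $ i)))"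
      unfolding ab mat_act_hp1_class mact_mmul by simp
    also have "\<dots> = S4_to_hp1 (x $ i)" using M M' n by (simp add: x) (simp add: v)
    finally have "S4_to_hp1 (x $ i) = S4_to_hp1 (Q *v boost y (u $ i))" using eq[OF n(1)] by simp
    moreover have "norm (Q *v boost y (u $ i)) = 1" using Q n by (simp add: norm_SO5 norm_boost)
    ultimately show ?thesis using hp1_to_S4_to_hp1 n(3) by metis
  qed
  then show ?thesis unfolding conf_equiv_def using Q by blast
qed

lemma G_orbit_eq_iff:
  assumes u: "u \<in> spheres" and v: "v \<in> spheres"
  shows "G_orbit (hp1n_of u) = G_orbit (hp1n_of v) \<longleftrightarrow> conf_equiv u v"
proof
  assume eq: "G_orbit (hp1n_of u) = G_orbit (hp1n_of v)"
  have "hp1n_of v \<in> G_orbit (hp1n_of v)" using G_orbit_hp1n_of[OF v] conf_equiv_refl by blast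
  then obtain x where x: "conf_equiv u x" "hp1n_of v = hp1n_of x" using G_orbit_hp1n_of[OF u] eq by auto
  then have "v = x" using hp1n_emb_of[OF v] hp1n_emb_of[OF conf_equiv_spheres[OF x(1) u]] by metis
  then show "conf_equiv u v" using x by simp
next
  assume "conf_equiv u v"
  then have "{x. conf_equiv u x} = {x. conf_equiv v x}"
    using conf_equiv_trans conf_equiv_sym u v by blast
  then show "G_orbit (hp1n_of u) = G_orbit (hp1n_of v)"
    unfolding G_orbit_hp1n_of[OF u] G_orbit_hp1n_of[OF v] by (rule arg_cong)
qed

lemma so5_orbit_self: "u \<in> so5_orbit u"
  unfolding so5_orbit_def by (intro CollectI exI[of _ "mat 1"]) (simp add: mat_1_SO5)

lemma so5_orbit_conf_equiv:
  assumes "v \<in> so5_orbit u"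
  shows "conf_equiv u v"
proof -
  obtain R where "R \<in> SO5" "v = (\<chi> i. R *v (u $ i))" using assms unfolding so5_orbit_def by blast
  then show ?thesis unfolding conf_equiv_def by (intro bexI[of _ R] exI[of _ 0]) auto
qed

section \<open>Openness and analyticity relative to a subset\<close>

lemma openin_top_of_set_iff_nhds:
  "openin (top_of_set X) S \<longleftrightarrow> S \<subseteq> X \<and> (\<forall>x\<in>S. \<forall>\<^sub>F y in nhds x. y \<in> X \<longrightarrow> y \<in> S)"
proof
  assume "openin (top_of_set X) S"
  then obtain T where "open T" "S = X \<inter> T" by (auto simp: openin_open)
  then show "S \<subseteq> X \<and> (\<forall>x\<in>S. \<forall>\<^sub>F y in nhds x. y \<in> X \<longrightarrow> y \<in> S)"
    unfolding eventually_nhds by blast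
next
  assume *: "S \<subseteq> X \<and> (\<forall>x\<in>S. \<forall>\<^sub>F y in nhds x. y \<in> X \<longrightarrow> y \<in> S)"
  show "openin (top_of_set X) S"
  proof (subst openin_subopen, rule ballI)
    fix x assume "x \<in> S"
    with * obtain T where "open T" "x \<in> T" "\<forall>y\<in>T. y \<in> X \<longrightarrow> y \<in> S" unfolding eventually_nhds by blast
    then show "\<exists>T. openin (top_of_set X) T \<and> x \<in> T \<and> T \<subseteq> S"
      using * \<open>x \<in> S\<close> by (intro exI[of _ "X \<inter> T"]) (auto simp: openin_open_Int)
  qed
qed

lemma real_analytic_on_set_cong:
  assumes "\<And>x. x \<in> S \<Longrightarrow> f x = g x"
  shows "real_analytic_on_set S f \<longleftrightarrow> real_analytic_on_set S g"
proof -
  have "(\<forall>x\<in>S \<inter> U. f x = h x) \<longleftrightarrow> (\<forall>x\<in>S \<inter> U. g x = h x)" for U h using assms by auto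
  then show ?thesis unfolding real_analytic_on_set_def by simp
qed

lemma real_analytic_on_set_subset:
  assumes "real_analytic_on_set S f" "T \<subseteq> S"
  shows "real_analytic_on_set T f"
  unfolding real_analytic_on_set_def
proof
  fix a assume "a \<in> T"
  then have "a \<in> S" using assms by blast
  then obtain U g where "open U" "a \<in> U" "\<forall>x\<in>U. real_analytic_at g x" "\<forall>x\<in>S \<inter> U. f x = g x"
    using assms(1) unfolding real_analytic_on_set_def by metis
  then show "\<exists>U g. open U \<and> a \<in> U \<and> (\<forall>x\<in>U. real_analytic_at g x) \<and> (\<forall>x\<in>T \<inter> U. f x = g x)"
    using assms(2) by (intro exI[of _ U] exI[of _ g]) auto
qed

lemma so5_orbit_U_r: "u \<in> U_r r \<Longrightarrow> so5_orbit u \<subseteq> U_r r"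
proof
  fix v assume u: "u \<in> U_r r" and "v \<in> so5_orbit u"
  then obtain R where R: "R \<in> SO5" and v: "v = (\<chi> i. R *v (u $ i))" unfolding so5_orbit_def by blast
  have "(\<Sum>i\<in>UNIV. r i *\<^sub>R (R *v (u $ i))) = R *v (\<Sum>i\<in>UNIV. r i *\<^sub>R (u $ i))"
    by (simp add: linear_sum[OF matrix_vector_mul_linear] matrix_vector_mult_scaleR)
  then show "v \<in> U_r r" using u by (simp add: U_r_def v norm_SO5[OF R])
qed

lemma M_r_eq: "M_r r = so5_orbit ` U_r r"
  unfolding M_r_def so5_orbit_def by blast

section \<open>The polygon space, stable configurations and the comparison of quotients\<close>

context
  fixes r :: "'n::finite \<Rightarrow> real"
  assumes pos: "\<And>i. r i > 0" and sum2: "(\<Sum>i\<in>UNIV. r i) = 2" and gen: "generic_weights r"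
begin

text \<open>If weight at least 1 sat at \<open>s\<close>, the nonnegative terms
  \<open>r i * (1 + s \<bullet> u $ i)\<close>, which add up to 2, would be used up there. All other
  points would be \<open>- s\<close>, and a balanced collinear configuration contradicts
  genericity.\<close>

lemma U_r_stable:
  assumes u: "u \<in> U_r r"
  shows "hp1n_of u \<in> M_st r"
proof -
  have n: "norm (u $ i) = 1" for i using u by (simp add: U_r_def)
  have bal: "(\<Sum>i\<in>UNIV. r i *\<^sub>R (u $ i)) = 0" using u by (simp add: U_r_def)
  have "(\<Sum>i | S4_to_hp1 (u $ i) = q. r i) < 1" if q: "q \<in> HP1" for q
  proof (rule ccontr)
    define s where "s = hp1_to_S4 q"
    have s: "norm s = 1" unfolding s_def by (rule norm_hp1_to_S4[OF q])
    have "S4_to_hp1 (u $ i) = q \<longleftrightarrow> u $ i = s" for i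
      using hp1_to_S4_to_hp1[OF n] S4_to_hp1_to_S4[OF q] by (auto simp: s_def)
    moreover assume "\<not> (\<Sum>i | S4_to_hp1 (u $ i) = q. r i) < 1"
    ultimately have S: "(\<Sum>i | u $ i = s. r i) \<ge> 1" by simp
    have ge: "1 + s \<bullet> u $ i \<ge> 0" for i
      using Cauchy_Schwarz_ineq2[of s "u $ i"] n[of i] s by simp
    have "(\<Sum>i\<in>UNIV. r i * (1 + s \<bullet> u $ i)) = 2 + s \<bullet> (\<Sum>i\<in>UNIV. r i *\<^sub>R (u $ i))"
      by (simp add: distrib_left sum.distrib sum2 inner_sum_right)
    also have "\<dots> = 2" by (simp add: bal)
    also have "(\<Sum>i\<in>UNIV. r i * (1 + s \<bullet> u $ i)) =
        (\<Sum>i | u $ i = s. r i * (1 + s \<bullet> u $ i)) + (\<Sum>i | u $ i \<noteq> s. r i * (1 + s \<bullet> u $ i))"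
      by (subst sum.union_disjoint[symmetric]) (auto intro: sum.cong)
    also have "(\<Sum>i | u $ i = s. r i * (1 + s \<bullet> u $ i)) = 2 * (\<Sum>i | u $ i = s. r i)"
      using s by (simp add: sum_distrib_left norm_eq_1 mult.commute)
    finally have "(\<Sum>i | u $ i \<noteq> s. r i * (1 + s \<bullet> u $ i)) \<le> 0" using S by simp
    moreover have "r i * (1 + s \<bullet> u $ i) \<ge> 0" for i using pos[of i] ge[of i] by simp
    ultimately have "(\<Sum>i | u $ i \<noteq> s. r i * (1 + s \<bullet> u $ i)) = 0" by (intro antisym sum_nonneg) auto
    then have "\<forall>i\<in>{i. u $ i \<noteq> s}. r i * (1 + s \<bullet> u $ i) = 0"
      using \<open>\<And>i. r i * (1 + s \<bullet> u $ i) \<ge> 0\<close> by (subst (asm) sum_nonneg_eq_0_iff) auto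
    then have "u $ i \<noteq> s \<Longrightarrow> s \<bullet> u $ i = -1" for i using pos[of i] by (force simp: add_eq_0_iff)
    then have "(s \<bullet> u $ i)\<^sup>2 = s \<bullet> s" for i using s by (cases "u $ i = s") (auto simp: norm_eq_1)
    then have "s = 0" by (rule generic_not_collinear[OF gen bal])
    then show False using s by simp
  qed
  then show ?thesis using S4_to_hp1_in_HP1[OF n] by (simp add: M_st_def stable_def hp1n_of_def)
qed

lemma conf_equiv_U_r_iff:
  assumes u: "u \<in> U_r r"
  shows "conf_equiv u v \<and> v \<in> U_r r \<longleftrightarrow> v \<in> so5_orbit u"
proof
  assume "conf_equiv u v \<and> v \<in> U_r r"
  then obtain R w where v: "v \<in> U_r r" and R: "R \<in> SO5" and w: "norm w < 1" and eq: "\<And>i. v $ i = R *v boost w (u $ i)"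
    by (auto simp: conf_equiv_def)
  have "R *v (\<Sum>i\<in>UNIV. r i *\<^sub>R boost w (u $ i)) = (\<Sum>i\<in>UNIV. r i *\<^sub>R (v $ i))"
    by (simp add: eq linear_sum[OF matrix_vector_mul_linear] matrix_vector_mult_scaleR)
  also have "\<dots> = 0" using v by (simp add: U_r_def)
  finally have "(\<Sum>i\<in>UNIV. r i *\<^sub>R boost w (u $ i)) = 0"
    using SO5_transpose_mult(2)[OF R, of "\<Sum>i\<in>UNIV. r i *\<^sub>R boost w (u $ i)"] by simp
  then have "w = 0" using balanced_boost_unique[of r "\<lambda>i. u $ i" w] pos gen w u by (simp add: U_r_def)
  then have "v = (\<chi> i. R *v (u $ i))" by (intro vec_eq_iff[THEN iffD2] allI) (simp only: eq vec_lambda_beta boost_0)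
  then show "v \<in> so5_orbit u" unfolding so5_orbit_def using R by blast
next
  assume "v \<in> so5_orbit u"
  then show "conf_equiv u v \<and> v \<in> U_r r" using so5_orbit_conf_equiv so5_orbit_U_r[OF u] by blast
qed

lemma stable_conf_equiv_U_r:
  assumes p: "p \<in> M_st r"
  shows "\<exists>u\<in>U_r r. conf_equiv (hp1n_emb p) u"
proof -
  have HP: "p i \<in> HP1" for i using p by (simp add: M_st_def)
  let ?v = "hp1n_emb p"
  have v: "norm (?v $ i) = 1" for i using hp1n_emb_spheres[of p] HP by (simp add: spheres_def)
  have "(\<Sum>i | ?v $ i = q. r i) < 1" if q: "norm q = 1" for q
  proof -
    have "?v $ i = q \<longleftrightarrow> p i = S4_to_hp1 q" for i
      using hp1_to_S4_to_hp1[OF q] S4_to_hp1_to_S4[OF HP] by (auto simp: hp1n_emb_def)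
    then show ?thesis using p S4_to_hp1_in_HP1[OF q] by (simp add: M_st_def stable_def)
  qed
  then obtain w where w: "norm w < 1" and bal: "(\<Sum>i\<in>UNIV. r i *\<^sub>R boost w (?v $ i)) = 0"
    using balanced_boost_exists[of r "\<lambda>i. ?v $ i"] pos sum2 v by blast
  let ?u = "\<chi> i. boost w (?v $ i)"
  have "?u \<in> U_r r" using bal by (simp add: U_r_def norm_boost[OF v w])
  moreover have "conf_equiv ?v ?u"
    unfolding conf_equiv_def by (intro bexI[of _ "mat 1"] exI[of _ w]) (auto simp: w mat_1_SO5)
  ultimately show ?thesis by blast
qed

text \<open>The slice is available only near the polygon space, so a fixed boost first carries
  \<open>v0\<close> there; dropping the rotation that accompanies it is allowed because
  \<open>U_r r\<close> is invariant under \<open>SO5\<close>.\<close>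

lemma analytic_retraction:
  assumes v0: "v0 \<in> saturate (U_r r)"
  obtains \<rho> where "analytic_map_at \<rho> v0" "\<rho> v0 \<in> U_r r" "conf_equiv v0 (\<rho> v0)"
    "\<forall>\<^sub>F v in nhds v0. v \<in> spheres \<longrightarrow> \<rho> v \<in> U_r r \<and> conf_equiv v (\<rho> v)"
proof -
  obtain u where v0s: "v0 \<in> spheres" and u: "u \<in> U_r r" and uv: "conf_equiv u v0" using v0 by (auto simp: saturate_def)
  have us: "u \<in> spheres" using u U_r_spheres by blast
  obtain R w where R: "R \<in> SO5" and w: "norm w < 1" and eq: "\<And>i. u $ i = R *v boost w (v0 $ i)"
    using conf_equiv_sym[OF uv us] by (auto simp: conf_equiv_def)
  define B where "B v = (\<chi> i. boost w (v $ i))" for v :: "real^5^'n"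
  have B_spheres: "v \<in> spheres \<Longrightarrow> B v \<in> spheres" for v by (simp add: B_def spheres_def norm_boost w)
  have B_equiv: "conf_equiv v (B v)" for v
    unfolding conf_equiv_def by (intro bexI[of _ "mat 1"] exI[of _ w]) (auto simp: w mat_1_SO5 B_def)
  have "B v0 = (\<chi> i. transpose R *v (u $ i))" 
    by (intro vec_eq_iff[THEN iffD2] allI) (simp only: B_def vec_lambda_beta eq SO5_transpose_mult(2)[OF R])
  then have "B v0 \<in> so5_orbit u" unfolding so5_orbit_def using transpose_SO5[OF R] by blast
  then have Bv0: "B v0 \<in> U_r r" using so5_orbit_U_r[OF u] by blast
  have ident: "analytic_map_at (\<lambda>v. v) x" for x :: "real^5^'n"
    by (intro analytic_map_at_linear linear_id[unfolded id_def])
  have anaB: "analytic_map_at B v0"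
    unfolding B_def using v0s bden_pos[OF _ w]
    by (intro analytic_map_at_vec_lambda analytic_map_at_boost analytic_map_at_const analytic_map_at_vec_nth ident)
      (auto simp: spheres_def less_imp_neq[THEN not_sym])
  obtain \<omega> where \<omega>: "analytic_map_at \<omega> (B v0)" "\<omega> (B v0) = 0"
    and bal: "\<forall>\<^sub>F p in nhds (B v0). (\<Sum>i\<in>UNIV. r i *\<^sub>R boost (\<omega> p) (p $ i)) = 0"
    using balancing_slice[of r "B v0"] pos gen Bv0 by (auto simp: U_r_def)
  define \<rho>' where "\<rho>' p = (\<chi> i. boost (\<omega> p) (p $ i))" for p
  have "analytic_map_at \<rho>' (B v0)"
    unfolding \<rho>'_def using \<omega>
    by (intro analytic_map_at_vec_lambda analytic_map_at_boost analytic_map_at_vec_nth ident) auto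
  then have ana: "analytic_map_at (\<lambda>v. \<rho>' (B v)) v0" by (rule analytic_map_at_compose[OF anaB])
  have id0: "\<rho>' (B v0) = B v0" by (simp add: \<rho>'_def \<omega>)
  \<comment> \<open>Only parameters inside the ball define genuine boosts; \<open>\<omega>\<close>
    vanishes at \<open>B v0\<close> and is continuous there.\<close>
  have "\<forall>\<^sub>F p in nhds (B v0). norm (\<omega> p) < 1"
  proof -
    have "((\<lambda>p. norm (\<omega> p)) \<longlongrightarrow> norm (\<omega> (B v0))) (nhds (B v0))"
      by (rule tendsto_norm[OF analytic_map_at_tendsto[OF \<omega>(1)]])
    then show ?thesis using \<omega>(2) by (intro order_tendstoD(2)[of _ 0]) auto
  qed
  with bal have ev: "\<forall>\<^sub>F p in nhds (B v0). norm (\<omega> p) < 1 \<and> (\<Sum>i\<in>UNIV. r i *\<^sub>R boost (\<omega> p) (p $ i)) = 0"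
    by eventually_elim auto
  have evB: "\<forall>\<^sub>F v in nhds v0. v \<in> spheres \<longrightarrow> \<rho>' (B v) \<in> U_r r \<and> conf_equiv v (\<rho>' (B v))"
    using eventually_compose_filterlim[OF ev analytic_map_at_tendsto[OF anaB]]
  proof eventually_elim
    case (elim v)
    show ?case
    proof
      assume v: "v \<in> spheres"
      have Bv: "B v \<in> spheres" by (rule B_spheres[OF v])
      have "\<rho>' (B v) \<in> U_r r" using elim Bv by (simp add: U_r_def \<rho>'_def spheres_def norm_boost)
      moreover have "conf_equiv (B v) (\<rho>' (B v))"
        unfolding conf_equiv_def using elim
        by (intro bexI[of _ "mat 1"] exI[of _ "\<omega> (B v)"]) (auto simp: mat_1_SO5 \<rho>'_def)
      ultimately show "\<rho>' (B v) \<in> U_r r \<and> conf_equiv v (\<rho>' (B v))"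
        using conf_equiv_trans[OF B_equiv _ v] by blast
    qed
  qed
  show ?thesis
    by (rule that[OF ana _ _ evB]) (simp_all add: id0 Bv0 B_equiv)
qed

text \<open>Equivalent points of the polygon space differ by a rotation only, so an invariant
  \<open>W\<close> is recovered from its saturation.\<close>

lemma saturateD:
  assumes W: "W \<subseteq> U_r r" and sat: "\<And>u. u \<in> W \<Longrightarrow> so5_orbit u \<subseteq> W" and v: "v \<in> saturate W"
    and u: "u \<in> U_r r" "conf_equiv v u"
  shows "u \<in> W"
proof -
  obtain x where x: "x \<in> W" "conf_equiv x v" using v by (auto simp: saturate_def)
  have xs: "x \<in> spheres" using x W U_r_spheres by blast
  have "conf_equiv x u" by (rule conf_equiv_trans[OF x(2) u(2) xs])
  then have "u \<in> so5_orbit x" using conf_equiv_U_r_iff[of x u] x W u by blast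
  then show ?thesis using sat[OF x(1)] by blast
qed

lemma saturate_superset: "W \<subseteq> U_r r \<Longrightarrow> W \<subseteq> saturate W"
  unfolding saturate_def using U_r_spheres conf_equiv_refl by blast

lemma openin_saturate_iff:
  assumes W: "W \<subseteq> U_r r" and sat: "\<And>u. u \<in> W \<Longrightarrow> so5_orbit u \<subseteq> W"
  shows "openin (top_of_set (U_r r)) W \<longleftrightarrow> openin (top_of_set (saturate (U_r r))) (saturate W)"
proof
  assume op: "openin (top_of_set (U_r r)) W"
  show "openin (top_of_set (saturate (U_r r))) (saturate W)"
    unfolding openin_top_of_set_iff_nhds
  proof (intro conjI ballI)
    show "saturate W \<subseteq> saturate (U_r r)" using W by (auto simp: saturate_def)
    fix v0 assume v0: "v0 \<in> saturate W"
    then have "v0 \<in> saturate (U_r r)" using W by (auto simp: saturate_def)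
    then obtain \<rho> where \<rho>: "analytic_map_at \<rho> v0" "\<rho> v0 \<in> U_r r" "conf_equiv v0 (\<rho> v0)"
      and ev: "\<forall>\<^sub>F v in nhds v0. v \<in> spheres \<longrightarrow> \<rho> v \<in> U_r r \<and> conf_equiv v (\<rho> v)" by (rule analytic_retraction)
    have "\<rho> v0 \<in> W" by (rule saturateD[OF W sat v0 \<rho>(2,3)])
    then have "\<forall>\<^sub>F p in nhds (\<rho> v0). p \<in> U_r r \<longrightarrow> p \<in> W" using op unfolding openin_top_of_set_iff_nhds by blast
    then have "\<forall>\<^sub>F v in nhds v0. \<rho> v \<in> U_r r \<longrightarrow> \<rho> v \<in> W"
      by (rule eventually_compose_filterlim[OF _ analytic_map_at_tendsto[OF \<rho>(1)]])
    with ev show "\<forall>\<^sub>F v in nhds v0. v \<in> saturate (U_r r) \<longrightarrow> v \<in> saturate W"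
    proof eventually_elim
      case (elim v)
      then show ?case using conf_equiv_sym by (auto simp: saturate_def)
    qed
  qed
next
  assume "openin (top_of_set (saturate (U_r r))) (saturate W)"
  then obtain T where T: "open T" "saturate W = saturate (U_r r) \<inter> T" by (auto simp: openin_open)
  have "W = U_r r \<inter> T"
  proof
    show "W \<subseteq> U_r r \<inter> T" using W saturate_superset[OF W] T by blast
    show "U_r r \<inter> T \<subseteq> W"
    proof
      fix u assume u: "u \<in> U_r r \<inter> T"
      then have "u \<in> saturate W" using T saturate_superset[of "U_r r"] by blast
      then show "u \<in> W" using saturateD[OF W sat _ _ conf_equiv_refl] u by blast
    qed
  qed
  then show "openin (top_of_set (U_r r)) W" using T by (auto simp: openin_open)
qed

text \<open>By invariance \<open>F\<close> agrees near \<open>v0\<close>, on the saturation, with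
  \<open>g \<circ> \<rho>\<close>, where \<open>g\<close> extends \<open>F\<close> near
  \<open>\<rho> v0\<close>. The definition asks for analyticity on a whole open set; analyticity at
  \<open>v0\<close> spreads to a neighbourhood.\<close>

lemma real_analytic_on_saturate_iff:
  assumes W: "W \<subseteq> U_r r" and sat: "\<And>u. u \<in> W \<Longrightarrow> so5_orbit u \<subseteq> W"
    and inv: "\<And>u v. u \<in> spheres \<Longrightarrow> conf_equiv u v \<Longrightarrow> F u = F v"
  shows "real_analytic_on_set W F \<longleftrightarrow> real_analytic_on_set (saturate W) F"
proof
  assume ana: "real_analytic_on_set W F"
  show "real_analytic_on_set (saturate W) F"
    unfolding real_analytic_on_set_def
  proof
    fix v0 assume v0: "v0 \<in> saturate W"
    then have "v0 \<in> saturate (U_r r)" using W by (auto simp: saturate_def)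
    then obtain \<rho> where \<rho>: "analytic_map_at \<rho> v0" "\<rho> v0 \<in> U_r r" "conf_equiv v0 (\<rho> v0)"
      and ev: "\<forall>\<^sub>F v in nhds v0. v \<in> spheres \<longrightarrow> \<rho> v \<in> U_r r \<and> conf_equiv v (\<rho> v)" by (rule analytic_retraction)
    have "\<rho> v0 \<in> W" by (rule saturateD[OF W sat v0 \<rho>(2,3)])
    then obtain U g where U: "open U" "\<rho> v0 \<in> U" and g: "\<And>x. x \<in> U \<Longrightarrow> real_analytic_at g x"
      and F: "\<And>x. x \<in> W \<inter> U \<Longrightarrow> F x = g x"
      using ana unfolding real_analytic_on_set_def by metis
    have evU: "\<forall>\<^sub>F v in nhds v0. \<rho> v \<in> U"
      by (rule topological_tendstoD[OF analytic_map_at_tendsto[OF \<rho>(1)] U])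
    have "real_analytic_at (\<lambda>v. g (\<rho> v)) v0" by (rule real_analytic_at_compose[OF \<rho>(1) g[OF U(2)]])
    from real_analytic_at_eventually[OF this]
    have "\<forall>\<^sub>F v in nhds v0. real_analytic_at (\<lambda>v. g (\<rho> v)) v \<and> (v \<in> saturate W \<longrightarrow> F v = g (\<rho> v))"
      using ev evU
    proof eventually_elim
      case (elim v)
      have "F v = g (\<rho> v)" if v: "v \<in> saturate W"
      proof -
        have vs: "v \<in> spheres" using v by (simp add: saturate_def)
        have "\<rho> v \<in> W" by (rule saturateD[OF W sat v]) (use elim vs in auto)
        then show ?thesis using F[of "\<rho> v"] inv[OF vs] elim vs by auto
      qed
      then show ?case using elim by blast
    qed
    then obtain T where "open T" "v0 \<in> T" "\<forall>v\<in>T. real_analytic_at (\<lambda>v. g (\<rho> v)) v \<and> (v \<in> saturate W \<longrightarrow> F v = g (\<rho> v))"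
      unfolding eventually_nhds by blast
    then show "\<exists>U g. open U \<and> v0 \<in> U \<and> (\<forall>x\<in>U. real_analytic_at g x) \<and> (\<forall>x\<in>saturate W \<inter> U. F x = g x)"
      by (intro exI[of _ T] exI[of _ "\<lambda>v. g (\<rho> v)"]) auto
  qed
next
  assume "real_analytic_on_set (saturate W) F"
  then show "real_analytic_on_set W F" by (rule real_analytic_on_set_subset[OF _ saturate_superset[OF W]])
qed

lemma so5_orbit_eq_iff:
  assumes u: "u \<in> U_r r" and v: "v \<in> U_r r"
  shows "so5_orbit u = so5_orbit v \<longleftrightarrow> conf_equiv u v"
proof
  assume "so5_orbit u = so5_orbit v"
  then show "conf_equiv u v" using so5_orbit_self[of v] so5_orbit_conf_equiv by blast
next
  assume uv: "conf_equiv u v"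
  have us: "u \<in> spheres" "v \<in> spheres" using u v U_r_spheres by blast+
  have "conf_equiv u x \<longleftrightarrow> conf_equiv v x" for x
    using conf_equiv_trans conf_equiv_sym uv us by blast
  then show "so5_orbit u = so5_orbit v"
    using conf_equiv_U_r_iff[OF u] conf_equiv_U_r_iff[OF v] by blast
qed

lemma Q_st_eq: "Q_st r = (\<lambda>u. G_orbit (hp1n_of u)) ` U_r r"
proof
  show "(\<lambda>u. G_orbit (hp1n_of u)) ` U_r r \<subseteq> Q_st r" using U_r_stable unfolding Q_st_def by blast
  show "Q_st r \<subseteq> (\<lambda>u. G_orbit (hp1n_of u)) ` U_r r"
  proof
    fix C assume "C \<in> Q_st r"
    then obtain p where p: "p \<in> M_st r" and C: "C = G_orbit p" by (auto simp: Q_st_def)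
    have HP: "\<And>i. p i \<in> HP1" using p by (simp add: M_st_def)
    obtain u where u: "u \<in> U_r r" "conf_equiv (hp1n_emb p) u" using stable_conf_equiv_U_r[OF p] by blast
    have "u \<in> spheres" using u U_r_spheres by blast
    then have "C = G_orbit (hp1n_of u)"
      using G_orbit_eq_iff[OF hp1n_emb_spheres[of p, OF HP], of u] u hp1n_of_emb[of p, OF HP] C by simp
    then show "C \<in> (\<lambda>u. G_orbit (hp1n_of u)) ` U_r r" using u by blast
  qed
qed

theorem quotients_analytically_isomorphic:
  "\<exists>\<xi>. (\<forall>C\<in>M_r r. \<forall>u\<in>C. \<xi> C = G_orbit (hp1n_of u)) \<and> analytic_quotient_iso (M_r r) id (Q_st r) hp1n_emb \<xi>"
proof -
  define \<xi> where "\<xi> C = G_orbit (hp1n_of (SOME u. u \<in> C))" for C :: "(real^5^'n) set"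
  have C_eq: "C = so5_orbit u" "u \<in> U_r r" if "C \<in> M_r r" "u \<in> C" for C u
  proof -
    obtain u0 where u0: "u0 \<in> U_r r" "C = so5_orbit u0" using \<open>C \<in> M_r r\<close> by (auto simp: M_r_eq)
    then show u: "u \<in> U_r r" using so5_orbit_U_r that by blast
    have "conf_equiv u0 u" using so5_orbit_conf_equiv that u0 by blast
    then show "C = so5_orbit u" using so5_orbit_eq_iff[OF u0(1) u] u0 by simp
  qed
  have \<xi>: "\<xi> C = G_orbit (hp1n_of u)" if C: "C \<in> M_r r" and u: "u \<in> C" for C u
  proof -
    have "(SOME u. u \<in> C) \<in> C" using u by (rule someI)
    then have s: "C = so5_orbit (SOME u. u \<in> C)" "(SOME u. u \<in> C) \<in> U_r r" using C_eq[OF C] by blast+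
    then have "conf_equiv (SOME u. u \<in> C) u" using u so5_orbit_conf_equiv by blast
    moreover have "(SOME u. u \<in> C) \<in> spheres" "u \<in> spheres" using s C_eq[OF C u] U_r_spheres by blast+
    ultimately show ?thesis using G_orbit_eq_iff unfolding \<xi>_def by blast
  qed
  have \<xi>_orbit: "\<xi> (so5_orbit u) = G_orbit (hp1n_of u)" if "u \<in> U_r r" for u
    using that by (intro \<xi> so5_orbit_self) (simp add: M_r_eq)
  have G_emb: "hp1n_emb ` G_orbit (hp1n_of u) = {v \<in> spheres. conf_equiv u v}" if "u \<in> U_r r" for u
  proof -
    have us: "u \<in> spheres" using that U_r_spheres by blast
    have "hp1n_emb ` G_orbit (hp1n_of u) = (\<lambda>v. hp1n_emb (hp1n_of v)) ` {v. conf_equiv u v}"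
      by (simp add: G_orbit_hp1n_of[OF us] image_image)
    also have "\<dots> = (\<lambda>v. v) ` {v. conf_equiv u v}"
      by (rule image_cong) (auto intro!: hp1n_emb_of dest: conf_equiv_spheres[OF _ us])
    finally show ?thesis using conf_equiv_spheres[OF _ us] by auto
  qed
  have Union_M: "\<Union> (M_r r) = U_r r" unfolding M_r_eq using so5_orbit_U_r so5_orbit_self by blast
  have W: "\<Union> V \<subseteq> U_r r" "\<And>u. u \<in> \<Union> V \<Longrightarrow> so5_orbit u \<subseteq> \<Union> V" if V: "V \<subseteq> M_r r" for V
    using V Union_M C_eq by blast+
  \<comment> \<open>Read on the spheres, a class of the second quotient is the saturation of the
    corresponding rotation orbit.\<close>
  have emb_\<xi>: "hp1n_emb ` \<Union> (\<xi> ` V) = saturate (\<Union> V)" if V: "V \<subseteq> M_r r" for V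
  proof -
    have "hp1n_emb ` \<xi> C = {v \<in> spheres. \<exists>u\<in>C. conf_equiv u v}" if C: "C \<in> V" for C
    proof -
      obtain u where u: "u \<in> U_r r" "C = so5_orbit u" using C V by (auto simp: M_r_eq)
      have us: "u \<in> spheres" using u U_r_spheres by blast
      have "hp1n_emb ` \<xi> C = {v \<in> spheres. conf_equiv u v}" using \<xi>_orbit[OF u(1)] G_emb[OF u(1)] u(2) by simp
      also have "\<dots> = {v \<in> spheres. \<exists>u\<in>C. conf_equiv u v}"
        using u(2) so5_orbit_self[of u] so5_orbit_conf_equiv conf_equiv_trans[OF _ _ us] by blast
      finally show ?thesis .
    qed
    then have "hp1n_emb ` \<Union> (\<xi> ` V) = (\<Union>C\<in>V. {v \<in> spheres. \<exists>u\<in>C. conf_equiv u v})" by (simp add: image_UN)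
    then show ?thesis by (auto simp: saturate_def)
  qed
  have bij: "bij_betw \<xi> (M_r r) (Q_st r)"
    unfolding bij_betw_def
  proof
    show "inj_on \<xi> (M_r r)"
    proof (rule inj_onI)
      fix C D assume "C \<in> M_r r" "D \<in> M_r r" and eq: "\<xi> C = \<xi> D"
      then obtain u v where u: "u \<in> U_r r" "C = so5_orbit u" and v: "v \<in> U_r r" "D = so5_orbit v" by (auto simp: M_r_eq)
      have "conf_equiv u v" using eq \<xi>_orbit u v G_orbit_eq_iff[of u v] U_r_spheres by (metis subsetD)
      then show "C = D" using so5_orbit_eq_iff u v by blast
    qed
    show "\<xi> ` M_r r = Q_st r" unfolding M_r_eq Q_st_eq image_image using \<xi>_orbit by (rule image_cong[OF refl])
  qed
  then have \<xi>M: "\<xi> ` M_r r = Q_st r" by (simp add: bij_betw_def)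
  have emb_Q: "hp1n_emb ` \<Union> (Q_st r) = saturate (U_r r)" using emb_\<xi>[OF subset_refl] by (simp add: \<xi>M Union_M)
  have opens: "quotient_open (M_r r) id V \<longleftrightarrow> quotient_open (Q_st r) hp1n_emb (\<xi> ` V)" if V: "V \<subseteq> M_r r" for V
    using openin_saturate_iff[OF W[OF V]] V \<xi>M unfolding quotient_open_def emb_\<xi>[OF V] emb_Q
    by (auto simp: Union_M)
  have ana: "quotient_analytic (M_r r) id V (f \<circ> \<xi>) \<longleftrightarrow> quotient_analytic (Q_st r) hp1n_emb (\<xi> ` V) f"
    if V: "V \<subseteq> M_r r" for V f
  proof -
    \<comment> \<open>Pulled back to configurations, the functions on the two quotients are this
      single invariant \<open>F\<close>, considered on \<open>\<Union> V\<close> and on its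
      saturation.\<close>
    define F where "F u = f (G_orbit (hp1n_of u))" for u
    have 1: "(f \<circ> \<xi>) (THE C. C \<in> V \<and> y \<in> C) = F y" if y: "y \<in> \<Union> V" for y
    proof -
      obtain C where C: "C \<in> V" "y \<in> C" using y by blast
      have "(THE C. C \<in> V \<and> y \<in> C) = C"
      proof (rule the_equality)
        fix D assume "D \<in> V \<and> y \<in> D"
        then have "D \<in> M_r r" "y \<in> D" using V by auto
        then show "D = C" using C_eq(1)[of D y] C_eq(1)[of C y] C V by blast
      qed (use C in simp)
      then show ?thesis using \<xi>[of C y] C V by (auto simp: F_def)
    qed
    have 2: "f (THE C. C \<in> \<xi> ` V \<and> y \<in> hp1n_emb ` C) = F y" if y: "y \<in> saturate (\<Union> V)" for y
    proof -
      have ys: "y \<in> spheres" using y by (simp add: saturate_def)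
      obtain D where D: "D \<in> \<xi> ` V" "y \<in> hp1n_emb ` D" using y unfolding emb_\<xi>[OF V, symmetric] by blast
      have uniq: "D = G_orbit (hp1n_of y)" if "D \<in> \<xi> ` V" "y \<in> hp1n_emb ` D" for D
      proof -
        obtain u where u: "u \<in> U_r r" "D = G_orbit (hp1n_of u)"
          using \<open>D \<in> \<xi> ` V\<close> V \<xi>M Q_st_eq by blast
        then have "conf_equiv u y" using that G_emb by blast
        then show ?thesis using u ys G_orbit_eq_iff[of u y] U_r_spheres by blast
      qed
      have "(THE C. C \<in> \<xi> ` V \<and> y \<in> hp1n_emb ` C) = G_orbit (hp1n_of y)"
        by (rule the_equality) (use D uniq in blast)+
      then show ?thesis by (simp add: F_def)
    qed
    have inv: "F u = F v" if "u \<in> spheres" "conf_equiv u v" for u v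
      using G_orbit_eq_iff[OF that(1) conf_equiv_spheres[OF that(2,1)]] that by (simp add: F_def)
    have "quotient_analytic (M_r r) id V (f \<circ> \<xi>) \<longleftrightarrow> real_analytic_on_set (\<Union> V) F"
    proof -
      have "id ` A = A" for A :: "(real^5^'n) set" by simp
      then show ?thesis unfolding quotient_analytic_def by (simp only:) (rule real_analytic_on_set_cong[OF 1])
    qed
    also have "\<dots> \<longleftrightarrow> real_analytic_on_set (saturate (\<Union> V)) F"
      by (rule real_analytic_on_saturate_iff[OF W[OF V] inv])
    also have "\<dots> \<longleftrightarrow> quotient_analytic (Q_st r) hp1n_emb (\<xi> ` V) f"
      unfolding quotient_analytic_def emb_\<xi>[OF V] using 2 by (intro real_analytic_on_set_cong) simp
    finally show ?thesis .
  qed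
  have "analytic_quotient_iso (M_r r) id (Q_st r) hp1n_emb \<xi>"
    unfolding analytic_quotient_iso_def using bij opens ana by (auto simp: quotient_open_def)
  then show ?thesis using \<xi> by blast
qed

end

theorem theorem3p2:
  fixes r :: "'n::finite \<Rightarrow> real"
  assumes pos: "\<And>i. r i > 0"
    and sum2: "(\<Sum>i\<in>UNIV. r i) = 2"
    and le1: "\<And>j. r j \<le> 1"
    and generic: "\<And>\<epsilon>::'n \<Rightarrow> real. (\<forall>i. \<epsilon> i = 1 \<or> \<epsilon> i = -1) \<Longrightarrow> (\<Sum>i\<in>UNIV. \<epsilon> i * r i) \<noteq> 0"
  shows "(\<forall>u\<in>U_r r. (\<lambda>i. S4_to_hp1 (u$i)) \<in> M_st r)
    \<and> (\<exists>\<xi>. (\<forall>C\<in>M_r r. \<forall>u\<in>C. \<xi> C = G_orbit (\<lambda>i. S4_to_hp1 (u$i)))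
          \<and> analytic_quotient_iso (M_r r) id (Q_st r) hp1n_emb \<xi>)"
proof -
  have gen: "generic_weights r" using generic by (simp add: generic_weights_def)
  show ?thesis
    using U_r_stable[OF pos sum2 gen] quotients_analytically_isomorphic[OF pos sum2 gen]
    unfolding hp1n_of_def by blast
qed

end
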